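(* Let $(R,\mu)$ be a $\sigma$-finite nonatomic measure space and let $1<p<\infty$ and $1\le s\le\infty$. Then, for any function $f\in L^{p,s}(R,\mu)$, $$\|f\|'_{p,s}=\|f\|_{(p,s)}.$$
   Context: Functions are real-valued, measurable and finite a.e. For a $\mu$-measurable function $f$ on $R$, $f^*$ denotes its non-increasing rearrangement on $\mathbb{R}_+=(0,\infty)$. For $1<p<\infty$ and $1\le s<\infty$, $$\|f\|_{p,s}=\left(\int_0^\infty (t^{1/p}f^*(t))^s\,\frac{dt}{t}\right)^{1/s},\qquad \|f\|_{p,\infty}=\sup_{t>0}t^{1/p}f^*(t),$$ and $L^{p,s}(R,\mu)$ is the set of $f$ with $\|f\|_{p,s}<\infty$. Conjugate exponents: $1/p+1/p'=1$, $1/s+1/s'=1$ ($s'=\infty$ if $s=1$, $s'=1$ if $s=\infty$). Dual norm: $\|f\|'_{p,s}=\sup\left\{\int_R fg\,d\mu:\ g\in L^{p',s'}(R,\mu),\ \|g\|_{p',s'}=1\right\}$. Decomposition norm: $\|f\|_{(p,s)}=\inf\left\{\sum_k\|f_k\|_{p,s}\right\}$, where the infimum is taken over all finite representations $f=\sum_k f_k$ with $f_k\in L^{p,s}(R,\mu)$. *)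

theory Defs
  imports "HOL-Analysis.Analysis"
begin

definition nonatomic :: "'a measure \<Rightarrow> bool" where
  "nonatomic M \<longleftrightarrow>
     (\<forall>A\<in>sets M. 0 < emeasure M A \<longrightarrow>
        (\<exists>B\<in>sets M. B \<subseteq> A \<and> 0 < emeasure M B \<and> emeasure M B < emeasure M A))"

(* Only used with a > 0, where the value at infinity is infinity. *)
definition ennreal_powr :: "ennreal \<Rightarrow> real \<Rightarrow> ennreal" where
  "ennreal_powr x a = (if x = \<infinity> then \<infinity> else ennreal (enn2real x powr a))"

(* The value is infinity iff every superlevel set of |f| has measure greater than t. *)
definition rearr :: "'a measure \<Rightarrow> ('a \<Rightarrow> real) \<Rightarrow> real \<Rightarrow> ennreal" where
  "rearr M f t =
     Inf {y::ennreal. emeasure M {x\<in>space M. y < ennreal \<bar>f x\<bar>} \<le> ennreal t}"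

definition lorentz_norm :: "'a measure \<Rightarrow> real \<Rightarrow> ennreal \<Rightarrow> ('a \<Rightarrow> real) \<Rightarrow> ennreal" where
  "lorentz_norm M p s f =
     (if s = \<infinity> then (SUP t\<in>{0<..}. ennreal (t powr (1 / p)) * rearr M f t)
      else ennreal_powr
             (\<integral>\<^sup>+t\<in>{0<..}. ennreal_powr (ennreal (t powr (1 / p)) * rearr M f t) (enn2real s)
                           / ennreal t \<partial>lborel)
             (1 / enn2real s))"

definition lorentz_space :: "'a measure \<Rightarrow> real \<Rightarrow> ennreal \<Rightarrow> ('a \<Rightarrow> real) set" where
  "lorentz_space M p s = {f \<in> borel_measurable M. lorentz_norm M p s f < \<infinity>}"

definition conj_exp :: "ennreal \<Rightarrow> ennreal" where
  "conj_exp s = inverse (1 - inverse s)"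

lemma conj_exp_eq:
  assumes "1 \<le> s"
  shows "inverse s + inverse (conj_exp s) = 1"
proof -
  have inv_inv: "inverse (inverse x) = x" for x :: ennreal
    by (cases x; cases "x = 0") (auto simp: inverse_ennreal less_le)
  have "inverse s \<le> 1"
  proof (cases s)
    case (real r)
    with assms have "1 \<le> r" by (simp flip: ennreal_1)
    with real show ?thesis by (simp add: inverse_ennreal field_simps flip: ennreal_1)
  qed simp
  then show ?thesis
    by (simp add: conj_exp_def inv_inv add_diff_self_ennreal)
qed

lemma conj_exp_1: "conj_exp 1 = \<infinity>"
  by (simp add: conj_exp_def)

lemma conj_exp_infinity: "conj_exp \<infinity> = 1"
  by (simp add: conj_exp_def)

(* For f in the Lorentz space the product f g is integrable by the Hoelder inequality,
   so the Bochner integral is the intended one.  Taking the supremum in [0, infinity]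
   (ennreal truncates negative reals to 0) does not change it, since g and -g have the same
   Lorentz norm; if M is a null measure there is no g of norm 1 and the supremum is 0. *)
definition lorentz_dual_norm :: "'a measure \<Rightarrow> real \<Rightarrow> ennreal \<Rightarrow> ('a \<Rightarrow> real) \<Rightarrow> ennreal" where
  "lorentz_dual_norm M p s f =
     (let p' = p / (p - 1); s' = conj_exp s in
      SUP g\<in>{g \<in> lorentz_space M p' s'. lorentz_norm M p' s' g = 1}.
        ennreal (\<integral>x. f x * g x \<partial>M))"

(* Functions are identified when equal almost everywhere, so the representation is
   only required almost everywhere. *)
definition lorentz_decomp_norm :: "'a measure \<Rightarrow> real \<Rightarrow> ennreal \<Rightarrow> ('a \<Rightarrow> real) \<Rightarrow> ennreal" where
  "lorentz_decomp_norm M p s f =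
     Inf {\<Sum>k<n. lorentz_norm M p s (h k) | (n::nat) (h::nat \<Rightarrow> 'a \<Rightarrow> real).
            (\<forall>k<n. h k \<in> lorentz_space M p s) \<and> (AE x in M. f x = (\<Sum>k<n. h k x))}"

end

theory Submission
  imports Defs "HOL-Combinatorics.Permutations"
begin

text \<open>
  Hoelder's inequality for rearrangements gives that the dual norm is at most the decomposition norm.
  For the converse, a nonatomic \<open>\<sigma>\<close>-finite space carries, for each \<open>f\<close> in the Lorentz space, a
  measure preserving map \<open>\<tau>\<close> onto an interval along which \<open>\<bar>f\<bar>\<close> is the composition of
  its rearrangement \<open>f*\<close> with \<open>\<tau>\<close> (Ryff). Testing the dual norm with \<open>G \<circ> \<tau>\<close>
  bounds \<open>\<integral> f* G\<close> for every nonincreasing \<open>G\<close>.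

  If \<open>s \<le> p\<close>, then \<open>G t = t powr (s/p - 1) * f* t powr (s - 1)\<close> is nonincreasing and already yields the
  full norm of \<open>f\<close>. If \<open>p < s < \<infinity>\<close>, then \<open>f\<close> is discretized on equal cells, and \<open>G\<close> is taken from the
  (discrete) level function of \<open>f*\<close>, the slope of the least concave majorant of its primitive. The level
  function has the dual norm of \<open>f\<close> as its Lorentz norm and majorizes \<open>f*\<close> in the sense of
  Hardy-Littlewood-Polya, so that by Rado's theorem \<open>f\<close> lies below a convex combination of functions
  obtained from it by permuting cells. If \<open>s = \<infinity>\<close>, a multiple of \<open>t powr (- 1/p)\<close> plays the role of the
  level function; simple functions are then not dense, so the half-line is cut into geometric blocks, the
  same permutation argument is run in all blocks simultaneously, and the portion of \<open>f\<close> next to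
  the cuts, which is not controlled, is averaged out by shifting the cuts.
\<close>

section \<open>Powers and rearrangements\<close>

text \<open>Useful test functions are nonincreasing, because the norm of a test function sees only
  its rearrangement. For \<open>s > p\<close> the Hoelder extremal of \<open>f*\<close> contains an
  increasing power of \<open>t\<close> and may fail this. The level function repairs it: divided by
  the weight of the dual space it is nonincreasing, so its own Hoelder extremal is an admissible
  test function; and this extremal is constant wherever the primitives of \<open>f*\<close> and of
  the level function differ, so it pairs equally with both. The decomposition norm is monotone under
  pointwise domination. Hence an upper bound of \<open>f\<close> by permuted copies of the level
  function suffices, which leaves room for discretization errors. Permutations require cells of
  equal length, whereas the weight is singular at 0; the constants \<open>L\<close>,
  \<open>\<delta>\<close> and \<open>k\<close> reconcile the two. For \<open>s = \<infinity>\<close>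
  infinitely many blocks have to share one finite list of functions. The convex weights depend on
  the block, so they are rounded to equal weights; the q-th permutations of all blocks then form a
  single function.\<close>

lemma ennreal_powr_ennreal: "0 \<le> x \<Longrightarrow> ennreal_powr (ennreal x) a = ennreal (x powr a)"
  by (simp add: ennreal_powr_def)

lemma ennreal_powr_top [simp]: "ennreal_powr \<infinity> a = \<infinity>" "ennreal_powr top a = \<infinity>"
  by (simp_all add: ennreal_powr_def)

lemma ennreal_powr_0 [simp]: "ennreal_powr 0 a = 0"
  by (simp add: ennreal_powr_def)

lemma ennreal_powr_mono:
  assumes "x \<le> y" "0 \<le> a" shows "ennreal_powr x a \<le> ennreal_powr y a"
proof (cases "y = top")
  case False
  then have y: "y < top" and x: "x < top" using assms(1) by (auto simp: less_top top_unique)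
  then have "enn2real x \<le> enn2real y" using assms(1) by (intro enn2real_mono)
  then show ?thesis using x[THEN less_imp_neq] y[THEN less_imp_neq] assms(2)
    by (simp add: ennreal_powr_def powr_mono2 ennreal_leI)
qed simp

lemma ennreal_powr_mult: "ennreal_powr (x * y) a = ennreal_powr x a * ennreal_powr y a"
proof -
  have *: "ennreal_powr (top * z) a = top * ennreal_powr z a" for z
  proof (cases "z = 0 \<or> z = top")
    case False
    then obtain r where "z = ennreal r" "0 < r" by (cases z) (auto simp: less_le)
    then show ?thesis by (simp add: ennreal_powr_ennreal ennreal_top_mult)
  qed auto
  show ?thesis
  proof (cases "x = top \<or> y = top")
    case True then show ?thesis using *[of x] *[of y] by (auto simp: mult.commute)
  next
    case False
    then obtain r q where "x = ennreal r" "0 \<le> r" "y = ennreal q" "0 \<le> q"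
      by (cases x; cases y) auto
    then show ?thesis by (simp add: ennreal_powr_ennreal powr_mult ennreal_mult[symmetric])
  qed
qed

lemma ennreal_powr_powr:
  "0 < a \<Longrightarrow> 0 < b \<Longrightarrow> ennreal_powr (ennreal_powr x a) b = ennreal_powr x (a * b)"
  by (cases x) (auto simp: ennreal_powr_ennreal powr_powr)

lemma ennreal_powr_1 [simp]: "ennreal_powr x 1 = x"
  by (cases x) (auto simp: ennreal_powr_ennreal)

lemma ennreal_powr_inverse: "0 < a \<Longrightarrow> ennreal_powr (ennreal_powr x a) (1 / a) = x"
  by (simp add: ennreal_powr_powr)

lemma ennreal_powr_inverse': "0 < a \<Longrightarrow> ennreal_powr (ennreal_powr x (1 / a)) a = x"
  by (simp add: ennreal_powr_powr)

lemma borel_measurable_ennreal_powr [measurable (raw)]: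
  assumes [measurable]: "f \<in> borel_measurable M"
  shows "(\<lambda>x. ennreal_powr (f x) a) \<in> borel_measurable M"
  unfolding ennreal_powr_def by measurable

text \<open>As the level decreases to the infimum in \<open>rearr\<close>, the superlevel sets
  increase to their union, so continuity from below shows that the infimum is attained. With this
  equivalence the rearrangement is handled through the distribution function.\<close>

lemma rearr_greater_iff:
  assumes [measurable]: "f \<in> borel_measurable M"
  shows "y < rearr M f t \<longleftrightarrow> ennreal t < emeasure M {x\<in>space M. y < ennreal \<bar>f x\<bar>}"
proof
  assume *: "y < rearr M f t"
  show "ennreal t < emeasure M {x\<in>space M. y < ennreal \<bar>f x\<bar>}"
  proof (rule ccontr)
    assume "\<not> ?thesis"
    then have "rearr M f t \<le> y" unfolding rearr_def by (intro Inf_lower) simp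
    with * show False by simp
  qed
next
  assume A: "ennreal t < emeasure M {x\<in>space M. y < ennreal \<bar>f x\<bar>}"
  let ?d = "\<lambda>y. emeasure M {x\<in>space M. y < ennreal \<bar>f x\<bar>}"
  show "y < rearr M f t"
  proof (rule ccontr)
    assume "\<not> ?thesis"
    then have le: "rearr M f t \<le> y" by simp
    let ?S = "{y. ?d y \<le> ennreal t}"
    have ne: "?S \<noteq> {}" by (auto intro!: exI[of _ top])
    obtain g :: "nat \<Rightarrow> ennreal" where g': "antimono g \<and> range g \<subseteq> ?S \<and> Inf ?S = Inf (range g)"
      using ennreal_Inf_countable_INF[OF ne] by (rule exE)
    then have g: "antimono g" "range g \<subseteq> ?S" "Inf ?S = (INF i. g i)" by simp_all
    have "{x\<in>space M. y < ennreal \<bar>f x\<bar>} \<subseteq> (\<Union>i. {x\<in>space M. g i < ennreal \<bar>f x\<bar>})"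
    proof
      fix x assume x: "x \<in> {x\<in>space M. y < ennreal \<bar>f x\<bar>}"
      have "(INF i. g i) \<le> y" using le unfolding rearr_def g(3) .
      also have "y < ennreal \<bar>f x\<bar>" using x by simp
      finally obtain i where "g i < ennreal \<bar>f x\<bar>" by (auto simp only: INF_less_iff)
      with x show "x \<in> (\<Union>i. {x\<in>space M. g i < ennreal \<bar>f x\<bar>})" by blast
    qed
    then have "?d y \<le> emeasure M (\<Union>i. {x\<in>space M. g i < ennreal \<bar>f x\<bar>})"
      by (rule emeasure_mono) measurable
    also have "\<dots> = (SUP i. ?d (g i))"
    proof (rule SUP_emeasure_incseq[symmetric])
      show "incseq (\<lambda>i. {x\<in>space M. g i < ennreal \<bar>f x\<bar>})"
        using g(1) unfolding incseq_def monotone_def by (fast elim: le_less_trans)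
    qed auto
    also have "\<dots> \<le> ennreal t" using g(2) by (intro SUP_least) blast
    finally show False using A by simp
  qed
qed

lemma rearr_le_iff:
  "f \<in> borel_measurable M \<Longrightarrow>
    rearr M f t \<le> y \<longleftrightarrow> emeasure M {x\<in>space M. y < ennreal \<bar>f x\<bar>} \<le> ennreal t"
  using rearr_greater_iff[of f M y t] by (auto simp: not_less[symmetric])

lemma rearr_antimono: "s \<le> t \<Longrightarrow> rearr M f t \<le> rearr M f s"
  unfolding rearr_def by (intro Inf_superset_mono) (auto intro: order_trans ennreal_leI)

lemma borel_measurable_rearr [measurable]: "rearr M f \<in> borel_measurable borel"
proof (rule borel_measurableI_greater)
  fix y
  have "is_interval {t. y < rearr M f t}"
    unfolding is_interval_1 using rearr_antimono[of _ _ M f] less_le_trans by blast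
  then show "{x \<in> space borel. y < rearr M f x} \<in> sets borel"
    by (simp add: real_interval_borel_measurable)
qed

lemma rearr_mono_AE:
  assumes [measurable]: "f \<in> borel_measurable M" "g \<in> borel_measurable M"
    and "AE x in M. \<bar>f x\<bar> \<le> \<bar>g x\<bar>"
  shows "rearr M f t \<le> rearr M g t"
proof -
  have "emeasure M {x\<in>space M. y < ennreal \<bar>f x\<bar>} \<le> emeasure M {x\<in>space M. y < ennreal \<bar>g x\<bar>}" for y
    using assms(3) by (intro emeasure_mono_AE) (auto elim!: eventually_mono dest: ennreal_leI less_le_trans)
  then show ?thesis unfolding rearr_def by (intro Inf_superset_mono) (auto intro: order_trans)
qed

lemma rearr_cmult:
  assumes [measurable]: "f \<in> borel_measurable M" and c: "c \<noteq> 0"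
  shows "rearr M (\<lambda>x. c * f x) t = ennreal \<bar>c\<bar> * rearr M f t"
proof -
  have eq: "ennreal \<bar>c\<bar> * y < ennreal \<bar>c\<bar> * z \<longleftrightarrow> y < z" for y z
    using c by (simp add: not_le[symmetric] ennreal_mult_le_mult_iff)
  have div: "\<exists>z. y = ennreal \<bar>c\<bar> * z" for y
    using c by (intro exI[of _ "ennreal (1/\<bar>c\<bar>) * y"])
      (simp add: mult.assoc[symmetric] ennreal_mult[symmetric])
  have "y < rearr M (\<lambda>x. c * f x) t \<longleftrightarrow> y < ennreal \<bar>c\<bar> * rearr M f t" for y
  proof -
    obtain z where z: "y = ennreal \<bar>c\<bar> * z" using div by blast
    show ?thesis unfolding z eq by (simp add: rearr_greater_iff abs_mult ennreal_mult eq)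
  qed
  then show ?thesis by (meson less_irrefl linorder_neqE)
qed

section \<open>Lorentz norms and Hoelder's inequality\<close>

text \<open>The Lorentz functional of an arbitrary function on the half-line. Test functions
  \<open>G\<close> and majorants \<open>H\<close> are constructed there directly, not as
  rearrangements of functions on the measure space.\<close>

definition lorentz_fun :: "real \<Rightarrow> ennreal \<Rightarrow> (real \<Rightarrow> ennreal) \<Rightarrow> ennreal" where
  "lorentz_fun p s \<phi> =
     (if s = \<infinity> then (SUP t\<in>{0<..}. ennreal (t powr (1 / p)) * \<phi> t)
      else ennreal_powr
             (\<integral>\<^sup>+t\<in>{0<..}. ennreal_powr (ennreal (t powr (1 / p)) * \<phi> t) (enn2real s)
                           / ennreal t \<partial>lborel)
             (1 / enn2real s))"

lemma lorentz_norm_eq: "lorentz_norm M p s f = lorentz_fun p s (rearr M f)"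
  by (simp add: lorentz_norm_def lorentz_fun_def)

lemma lorentz_fun_mono:
  assumes "\<And>t. 0 < t \<Longrightarrow> \<phi> t \<le> \<psi> t"
  shows "lorentz_fun p s \<phi> \<le> lorentz_fun p s \<psi>"
proof (cases "s = \<infinity>")
  case True
  then show ?thesis unfolding lorentz_fun_def using assms
    by (auto intro!: SUP_mono bexI mult_left_mono)
next
  case False
  then show ?thesis unfolding lorentz_fun_def using assms
    by (auto intro!: mult_left_mono ennreal_powr_mono nn_integral_mono divide_right_mono_ennreal
        simp: indicator_def)
qed

lemma lorentz_fun_cmult:
  assumes [measurable]: "\<phi> \<in> borel_measurable borel" and "1 \<le> s"
  shows "lorentz_fun p s (\<lambda>t. c * \<phi> t) = c * lorentz_fun p s \<phi>"
proof (cases s)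
  case top
  then show ?thesis
    by (simp add: lorentz_fun_def SUP_mult_left_ennreal mult.left_commute)
next
  case (real r)
  with assms(2) have r: "1 \<le> r" by (simp flip: ennreal_1)
  have "(\<integral>\<^sup>+t\<in>{0<..}. ennreal_powr (ennreal (t powr (1 / p)) * (c * \<phi> t)) r / ennreal t \<partial>lborel)
    = ennreal_powr c r * (\<integral>\<^sup>+t\<in>{0<..}. ennreal_powr (ennreal (t powr (1 / p)) * \<phi> t) r / ennreal t \<partial>lborel)"
    by (subst nn_integral_cmult[symmetric])
      (auto intro!: nn_integral_cong simp: ennreal_powr_mult divide_ennreal_def mult_ac)
  then show ?thesis using real r
    by (simp add: lorentz_fun_def ennreal_powr_mult ennreal_powr_inverse)
qed

lemma lorentz_fun_top: "lorentz_fun p \<infinity> \<phi> = (SUP t\<in>{0<..}. ennreal (t powr (1 / p)) * \<phi> t)"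
  by (simp add: lorentz_fun_def)

lemma lorentz_fun_real:
  assumes "1 \<le> r"
  shows "lorentz_fun p (ennreal r) \<phi> =
    ennreal_powr (\<integral>\<^sup>+t\<in>{0<..}. ennreal (t powr (r / p - 1)) * ennreal_powr (\<phi> t) r \<partial>lborel) (1 / r)"
proof -
  have "ennreal_powr (ennreal (t powr (1 / p)) * \<phi> t) r / ennreal t
      = ennreal (t powr (r / p - 1)) * ennreal_powr (\<phi> t) r" if "0 < t" for t
  proof -
    have "ennreal (t powr (r/p)) * inverse (ennreal t) = ennreal (t powr (r / p - 1))"
      using that by (simp add: inverse_ennreal powr_diff divide_inverse flip: ennreal_mult)
    then show ?thesis
      by (simp add: ennreal_powr_mult ennreal_powr_ennreal powr_powr divide_ennreal_def)
        (metis (no_types, lifting) mult.assoc mult.commute)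
  qed
  then show ?thesis using assms unfolding lorentz_fun_def
    by (auto intro!: arg_cong2[where f = ennreal_powr] nn_integral_cong simp: indicator_def)
qed

lemma conj_exp_ennreal:
  assumes "1 < r" shows "conj_exp (ennreal r) = ennreal (r / (r - 1))"
proof -
  have "conj_exp (ennreal r) = inverse (ennreal (1 - 1 / r))"
    using assms unfolding conj_exp_def
    by (simp add: inverse_ennreal ennreal_minus[symmetric] inverse_eq_divide flip: ennreal_1)
  also have "\<dots> = ennreal (r / (r - 1))"
    using assms by (subst inverse_ennreal) (auto simp: field_simps)
  finally show ?thesis .
qed

lemma exponent_cases:
  assumes "1 \<le> s"
  obtains "s = \<infinity>" | "s = 1" | r where "s = ennreal r" "1 < r"
  using assms by (cases s) (auto simp: less_le simp flip: ennreal_1)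

lemma one_le_conj_exp: "1 \<le> s \<Longrightarrow> 1 \<le> conj_exp s"
  by (erule exponent_cases)
    (auto simp: conj_exp_1 conj_exp_infinity[simplified] conj_exp_ennreal field_simps ennreal_ge_1)

lemma ennreal_Youngs_inequality:
  assumes "1 < r"
  shows "a * b \<le> ennreal (1 / r) * ennreal_powr a r + ennreal (1 - 1 / r) * ennreal_powr b (r / (r - 1))"
proof (cases "a = top \<or> b = top")
  case True
  then show ?thesis using assms by (auto simp: ennreal_mult_top)
next
  case False
  then obtain x y where xy: "a = ennreal x" "0 \<le> x" "b = ennreal y" "0 \<le> y"
    by (cases a; cases b) auto
  have "x * y \<le> x powr r / r + y powr (r / (r - 1)) / (r / (r - 1))"
    using assms xy by (intro Youngs_inequality) (auto simp: field_simps)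
  also have "\<dots> = (1 / r) * x powr r + (1 - 1 / r) * y powr (r / (r - 1))"
    using assms by (simp add: field_simps)
  finally have "ennreal (x * y) \<le> ennreal ((1 / r) * x powr r + (1 - 1 / r) * y powr (r / (r - 1)))"
    by (rule ennreal_leI)
  also have "\<dots> = ennreal (1 / r) * ennreal (x powr r) + ennreal (1 - 1 / r) * ennreal (y powr (r / (r - 1)))"
    using assms by (intro trans[OF ennreal_plus] arg_cong2[where f = "(+)"] ennreal_mult) auto
  finally show ?thesis using xy
    by (simp add: ennreal_powr_ennreal ennreal_mult)
qed

text \<open>Hoelder's inequality for the measure dt/t: \<open>\<phi> t * \<psi> t\<close> is
  \<open>A t * B t / t\<close>, where \<open>A\<close> and \<open>B\<close> carry the powers of
  \<open>t\<close> from the two Lorentz norms, whose exponents add up to 1.\<close>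

lemma lorentz_fun_Hoelder:
  assumes [measurable]: "\<phi> \<in> borel_measurable borel" "\<psi> \<in> borel_measurable borel"
    and p: "1 < p" and s: "1 \<le> s"
    and \<psi>: "lorentz_fun (p / (p - 1)) (conj_exp s) \<psi> \<le> 1"
  shows "(\<integral>\<^sup>+t\<in>{0<..}. \<phi> t * \<psi> t \<partial>lborel) \<le> lorentz_fun p s \<phi>"
proof -
  define A where "A t = ennreal (t powr (1 / p)) * \<phi> t" for t
  define B where "B t = ennreal (t powr (1 - 1 / p)) * \<psi> t" for t
  have [measurable]: "A \<in> borel_measurable borel" "B \<in> borel_measurable borel"
    unfolding A_def B_def by measurable
  have p': "1 / (p / (p - 1)) = 1 - 1 / p" using p by (simp add: field_simps)
  have eq: "\<phi> t * \<psi> t = A t * B t / ennreal t" if "0 < t" for t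
  proof -
    have "ennreal (t powr (1 / p)) * ennreal (t powr (1 - 1 / p)) * inverse (ennreal t) = 1"
      using that by (simp add: inverse_ennreal flip: ennreal_mult powr_add)
    then show ?thesis unfolding A_def B_def divide_ennreal_def
      by (metis (no_types, lifting) mult.assoc mult.commute mult.right_neutral)
  qed
  have eqI: "(\<integral>\<^sup>+t\<in>{0<..}. \<phi> t * \<psi> t \<partial>lborel) = (\<integral>\<^sup>+t\<in>{0<..}. A t * B t / ennreal t \<partial>lborel)"
    using eq by (intro nn_integral_cong) (auto simp: indicator_def)
  from s show ?thesis
  proof (cases rule: exponent_cases)
    case 1
    have B: "(\<integral>\<^sup>+t\<in>{0<..}. B t / ennreal t \<partial>lborel) \<le> 1"
      using \<psi> unfolding 1 conj_exp_infinity lorentz_fun_def p' B_def by simp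
    have "(\<integral>\<^sup>+t\<in>{0<..}. A t * B t / ennreal t \<partial>lborel)
      \<le> (\<integral>\<^sup>+t. lorentz_fun p s \<phi> * (B t / ennreal t * indicator {0<..} t) \<partial>lborel)"
      unfolding 1 lorentz_fun_top A_def
      by (intro nn_integral_mono)
        (auto simp: indicator_def ennreal_times_divide[symmetric] intro!: mult_right_mono SUP_upper)
    also have "\<dots> = lorentz_fun p s \<phi> * (\<integral>\<^sup>+t\<in>{0<..}. B t / ennreal t \<partial>lborel)"
      by (intro nn_integral_cmult) measurable
    also have "\<dots> \<le> lorentz_fun p s \<phi> * 1" by (intro mult_left_mono B) simp
    finally show ?thesis using eqI by simp
  next
    case 2
    have B: "B t \<le> 1" if "0 < t" for t
      using \<psi> that unfolding 2 conj_exp_1 lorentz_fun_top p' B_def by (auto simp: SUP_le_iff)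
    have "(\<integral>\<^sup>+t\<in>{0<..}. A t * B t / ennreal t \<partial>lborel) \<le> (\<integral>\<^sup>+t\<in>{0<..}. A t / ennreal t \<partial>lborel)"
      using mult_left_mono[OF B, of _ "A _"]
      by (intro nn_integral_mono) (auto simp: indicator_def intro!: divide_right_mono_ennreal)
    then show ?thesis unfolding eqI 2 lorentz_fun_def A_def by simp
  next
    case (3 r)
    define q where "q = r / (r - 1)"
    have q: "1 < q" using 3 by (simp add: q_def field_simps)
    define IA where "IA = (\<integral>\<^sup>+t\<in>{0<..}. ennreal_powr (A t) r / ennreal t \<partial>lborel)"
    define IB where "IB = (\<integral>\<^sup>+t\<in>{0<..}. ennreal_powr (B t) q / ennreal t \<partial>lborel)"
    have N: "lorentz_fun p s \<phi> = ennreal_powr IA (1 / r)"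
      using 3 by (simp add: lorentz_fun_def IA_def A_def)
    have "ennreal_powr IB (1 / q) \<le> 1"
      using \<psi> q unfolding 3 conj_exp_ennreal[OF 3(2)] q_def[symmetric] lorentz_fun_def p' IB_def B_def by simp
    then have "ennreal_powr (ennreal_powr IB (1 / q)) q \<le> ennreal_powr 1 q"
      using q by (intro ennreal_powr_mono) auto
    then have IB: "IB \<le> 1"
      using q by (simp add: ennreal_powr_inverse' ennreal_powr_ennreal flip: ennreal_1)
    show ?thesis
    proof (rule dense_ge)
      \<comment> \<open>Young's inequality is applied with the scale \<open>c\<close>, an arbitrary
        real number above the norm. Unlike the norm itself, \<open>c\<close> is never 0, so dividing
        by it is safe.\<close>
      fix l assume l: "lorentz_fun p s \<phi> < l"
      show "(\<integral>\<^sup>+t\<in>{0<..}. \<phi> t * \<psi> t \<partial>lborel) \<le> l"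
      proof (cases l)
        case (real c)
        with l have c: "0 < c" by (cases "c = 0") auto
        have "ennreal_powr (ennreal_powr IA (1 / r)) r \<le> ennreal_powr l r"
          using l 3 unfolding N by (intro ennreal_powr_mono) auto
        then have IA: "IA \<le> ennreal (c powr r)"
          using real c 3 by (simp add: ennreal_powr_inverse' ennreal_powr_ennreal)
        have "A t * B t / ennreal t * indicator {0<..} t
          \<le> ennreal (c * (1 / r) * (1 / c) powr r) * (ennreal_powr (A t) r / ennreal t * indicator {0<..} t)
           + ennreal (c * (1 - 1 / r)) * (ennreal_powr (B t) q / ennreal t * indicator {0<..} t)" for t
        proof -
          have "A t * B t = ennreal c * (ennreal (1 / c) * A t * B t)"
            using c by (simp add: mult.assoc[symmetric] ennreal_mult[symmetric])
          also have "\<dots> \<le> ennreal c * (ennreal (1 / r) * ennreal_powr (ennreal (1 / c) * A t) r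
              + ennreal (1 - 1 / r) * ennreal_powr (B t) q)"
            unfolding q_def by (intro mult_left_mono ennreal_Youngs_inequality 3) simp
          also have "\<dots> = ennreal (c * (1 / r) * (1 / c) powr r) * ennreal_powr (A t) r
              + ennreal (c * (1 - 1 / r)) * ennreal_powr (B t) q"
          proof -
            have "ennreal (c * (1 / r) * (1 / c) powr r) = ennreal c * ennreal (1 / r) * ennreal ((1 / c) powr r)"
              "ennreal (c * (1 - 1 / r)) = ennreal c * ennreal (1 - 1 / r)"
              using c 3 by (auto intro!: trans[OF ennreal_mult] arg_cong2[where f = "(*)"] ennreal_mult
                  simp del: times_divide_eq_right)
            moreover have "ennreal_powr (ennreal (1 / c)) r = ennreal ((1 / c) powr r)"
              using c by (intro ennreal_powr_ennreal) simp
            ultimately show ?thesis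
              by (simp only: ennreal_powr_mult distrib_left mult.assoc)
          qed
          finally show ?thesis
            by (auto simp: indicator_def ennreal_times_divide add_divide_distrib_ennreal[symmetric]
                 intro!: divide_right_mono_ennreal)
        qed
        then have "(\<integral>\<^sup>+t\<in>{0<..}. A t * B t / ennreal t \<partial>lborel) \<le>
           (\<integral>\<^sup>+t. ennreal (c * (1 / r) * (1 / c) powr r) * (ennreal_powr (A t) r / ennreal t * indicator {0<..} t)
           + ennreal (c * (1 - 1 / r)) * (ennreal_powr (B t) q / ennreal t * indicator {0<..} t) \<partial>lborel)"
          by (rule nn_integral_mono)
        also have "\<dots> = ennreal (c * (1 / r) * (1 / c) powr r) * IA + ennreal (c * (1 - 1 / r)) * IB"
          unfolding IA_def IB_def by (simp add: nn_integral_add nn_integral_cmult)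
        also have "\<dots> \<le> ennreal (c * (1 / r) * (1 / c) powr r) * ennreal (c powr r) + ennreal (c * (1 - 1 / r)) * 1"
          by (intro add_mono mult_left_mono IA IB) auto
        also have "\<dots> = ennreal (c * (1 / r) * ((1 / c) powr r * c powr r) + c * (1 - 1 / r))"
          using c 3 by (simp add: ennreal_mult[symmetric] ennreal_plus[symmetric] mult.assoc del: ennreal_plus)
        also have "(1 / c) powr r * c powr r = 1" using c by (simp add: powr_divide)
        also have "c * (1 / r) * 1 + c * (1 - 1 / r) = c" by (simp add: algebra_simps)
        finally show ?thesis using real eqI by simp
      qed simp
    qed
  qed
qed

section \<open>Layer cake formula and the Hardy-Littlewood inequality\<close>

lemma ennreal_layer_cake:
  "(\<integral>\<^sup>+y. indicator {y. 0 \<le> y \<and> ennreal y < a} y \<partial>lborel) = a"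
proof (cases a)
  case (real r)
  have "{y. 0 \<le> y \<and> ennreal y < a} = {0..<r}" using real by (auto simp: ennreal_less_iff)
  then show ?thesis using real by simp
next
  case top
  have "{y. 0 \<le> y \<and> ennreal y < a} = {0..}" using top by auto
  moreover have "of_nat n \<le> emeasure lborel {0::real..}" for n
    using emeasure_mono[of "{0..real n}" "{0..}" lborel] by (auto simp: ennreal_of_nat_eq_real_of_nat)
  then have "emeasure lborel {0::real..} = top"
    by (metis ennreal_SUP_of_nat_eq_top SUP_le_iff top_unique)
  ultimately show ?thesis using top by simp
qed

lemma nn_integral_mult_layer_cake:
  assumes "sigma_finite_measure N"
    and [measurable]: "a \<in> borel_measurable N" "b \<in> borel_measurable N"
  shows "(\<integral>\<^sup>+x. a x * b x \<partial>N) =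
    (\<integral>\<^sup>+y. \<integral>\<^sup>+z. emeasure N {x\<in>space N. (0 \<le> y \<and> ennreal y < a x) \<and> (0 \<le> z \<and> ennreal z < b x)} \<partial>lborel \<partial>lborel)"
proof -
  interpret N: sigma_finite_measure N by fact
  interpret pair_sigma_finite N lborel by standard
  let ?I = "\<lambda>x y. indicator {y. 0 \<le> y \<and> ennreal y < a x} y :: ennreal"
  let ?J = "\<lambda>x y. indicator {y. 0 \<le> y \<and> ennreal y < b x} y :: ennreal"
  have "(\<integral>\<^sup>+x. a x * b x \<partial>N) = (\<integral>\<^sup>+x. (\<integral>\<^sup>+y. ?I x y \<partial>lborel) * b x \<partial>N)"
    by (simp only: ennreal_layer_cake)
  also have "\<dots> = (\<integral>\<^sup>+x. \<integral>\<^sup>+y. ?I x y * b x \<partial>lborel \<partial>N)"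
    by (intro nn_integral_cong nn_integral_multc[symmetric]) measurable
  also have "\<dots> = (\<integral>\<^sup>+y. \<integral>\<^sup>+x. ?I x y * b x \<partial>N \<partial>lborel)"
    by (rule Fubini'[symmetric]) measurable
  also have "\<dots> = (\<integral>\<^sup>+y. \<integral>\<^sup>+x. ?I x y * (\<integral>\<^sup>+z. ?J x z \<partial>lborel) \<partial>N \<partial>lborel)"
    by (simp only: ennreal_layer_cake)
  also have "\<dots> = (\<integral>\<^sup>+y. \<integral>\<^sup>+x. \<integral>\<^sup>+z. ?I x y * ?J x z \<partial>lborel \<partial>N \<partial>lborel)"
    by (intro nn_integral_cong nn_integral_cmult[symmetric]) measurable
  also have "\<dots> = (\<integral>\<^sup>+y. \<integral>\<^sup>+z. \<integral>\<^sup>+x. ?I x y * ?J x z \<partial>N \<partial>lborel \<partial>lborel)"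
    by (intro nn_integral_cong Fubini'[symmetric]) measurable
  also have "\<dots> = (\<integral>\<^sup>+y. \<integral>\<^sup>+z. \<integral>\<^sup>+x. indicator {x\<in>space N. (0 \<le> y \<and> ennreal y < a x) \<and> (0 \<le> z \<and> ennreal z < b x)} x \<partial>N \<partial>lborel \<partial>lborel)"
    by (intro nn_integral_cong) (auto simp: indicator_def)
  finally show ?thesis by simp
qed

text \<open>After both products are expanded into levels, the inequality holds for each pair of
  levels: the measure of an intersection is at most the smaller of two distribution functions, while
  the superlevel sets of the rearrangements are nested initial intervals, whose intersection has
  exactly the smaller length.\<close>

lemma Hardy_Littlewood:
  assumes M: "sigma_finite_measure M"
    and [measurable]: "f \<in> borel_measurable M" "g \<in> borel_measurable M"
  shows "(\<integral>\<^sup>+x. ennreal \<bar>f x\<bar> * ennreal \<bar>g x\<bar> \<partial>M) \<le> (\<integral>\<^sup>+t\<in>{0<..}. rearr M f t * rearr M g t \<partial>lborel)"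
proof -
  define F G where "F t = rearr M f t * indicator {0<..} t" and "G t = rearr M g t * indicator {0<..} t" for t
  have [measurable]: "F \<in> borel_measurable borel" "G \<in> borel_measurable borel"
    unfolding F_def G_def by measurable
  have "(\<integral>\<^sup>+x. ennreal \<bar>f x\<bar> * ennreal \<bar>g x\<bar> \<partial>M) \<le> (\<integral>\<^sup>+t. F t * G t \<partial>lborel)"
  proof (subst (1 2) nn_integral_mult_layer_cake)
    show "(\<integral>\<^sup>+y. \<integral>\<^sup>+z. emeasure M {x\<in>space M. (0 \<le> y \<and> ennreal y < ennreal \<bar>f x\<bar>) \<and> (0 \<le> z \<and> ennreal z < ennreal \<bar>g x\<bar>)} \<partial>lborel \<partial>lborel)
      \<le> (\<integral>\<^sup>+y. \<integral>\<^sup>+z. emeasure lborel {t\<in>space lborel. (0 \<le> y \<and> ennreal y < F t) \<and> (0 \<le> z \<and> ennreal z < G t)} \<partial>lborel \<partial>lborel)"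
    proof (intro nn_integral_mono)
      fix y z :: real
      let ?A = "{x\<in>space M. (0 \<le> y \<and> ennreal y < ennreal \<bar>f x\<bar>) \<and> (0 \<le> z \<and> ennreal z < ennreal \<bar>g x\<bar>)}"
      let ?T = "{t\<in>space lborel. (0 \<le> y \<and> ennreal y < F t) \<and> (0 \<le> z \<and> ennreal z < G t)}"
      show "emeasure M ?A \<le> emeasure lborel ?T"
      proof (cases "0 \<le> y \<and> 0 \<le> z")
        case True
        have le: "emeasure M ?A \<le> emeasure M {x\<in>space M. ennreal y < ennreal \<bar>f x\<bar>}"
          "emeasure M ?A \<le> emeasure M {x\<in>space M. ennreal z < ennreal \<bar>g x\<bar>}"
          by (auto intro!: emeasure_mono)
        \<comment> \<open>The measure of \<open>?A\<close> is rewritten as the length of an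
          interval, which can be compared with \<open>?T\<close> point by point. The point 0 is
          split off because \<open>F\<close> and \<open>G\<close> vanish there.\<close>
        have "emeasure M ?A = emeasure lborel {t. 0 \<le> t \<and> ennreal t < emeasure M ?A}"
          using ennreal_layer_cake[of "emeasure M ?A"] by simp
        also have "\<dots> \<le> emeasure lborel ({0} \<union> ?T)"
        proof (rule emeasure_mono)
          show "{t. 0 \<le> t \<and> ennreal t < emeasure M ?A} \<subseteq> {0} \<union> ?T"
            using True le by (auto simp: F_def G_def rearr_greater_iff indicator_def dest: less_le_trans)
        qed measurable
        also have "\<dots> = emeasure lborel ?T"
          by (subst Un_commute, intro emeasure_Un_null_set) (auto intro: null_setsI)
        finally show ?thesis .
      qed auto
    qed
  qed (use M in \<open>auto intro: sigma_finite_lborel\<close>)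
  also have "\<dots> = (\<integral>\<^sup>+t\<in>{0<..}. rearr M f t * rearr M g t \<partial>lborel)"
    by (intro nn_integral_cong) (auto simp: F_def G_def indicator_def)
  finally show ?thesis .
qed

lemma lorentz_Hoelder:
  assumes "sigma_finite_measure M" "f \<in> borel_measurable M" "g \<in> borel_measurable M"
    and "1 < p" "1 \<le> s" "lorentz_norm M (p / (p - 1)) (conj_exp s) g \<le> 1"
  shows "(\<integral>\<^sup>+x. ennreal \<bar>f x\<bar> * ennreal \<bar>g x\<bar> \<partial>M) \<le> lorentz_norm M p s f"
  using Hardy_Littlewood[OF assms(1-3)]
    lorentz_fun_Hoelder[of "rearr M f" "rearr M g" p s] assms(4-6)
  by (force simp: lorentz_norm_eq)

section \<open>The easy inequality, and monotonicity of the decomposition norm\<close>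

lemma lorentz_norm_mono_AE:
  assumes "f \<in> borel_measurable M" "g \<in> borel_measurable M" "AE x in M. \<bar>f x\<bar> \<le> \<bar>g x\<bar>"
  shows "lorentz_norm M p s f \<le> lorentz_norm M p s g"
  unfolding lorentz_norm_eq by (intro lorentz_fun_mono rearr_mono_AE assms)

lemma lorentz_norm_cmult:
  assumes "f \<in> borel_measurable M" "1 \<le> s" "c \<noteq> 0"
  shows "lorentz_norm M p s (\<lambda>x. c * f x) = ennreal \<bar>c\<bar> * lorentz_norm M p s f"
proof -
  have "rearr M (\<lambda>x. c * f x) = (\<lambda>t. ennreal \<bar>c\<bar> * rearr M f t)"
    using assms by (intro ext rearr_cmult)
  then show ?thesis using assms by (simp add: lorentz_norm_eq lorentz_fun_cmult)
qed

lemma lorentz_dual_le_decomp: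
  assumes M: "sigma_finite_measure M" and p: "1 < p" and s: "1 \<le> s"
    and [measurable]: "f \<in> borel_measurable M"
  shows "lorentz_dual_norm M p s f \<le> lorentz_decomp_norm M p s f"
  unfolding lorentz_dual_norm_def lorentz_decomp_norm_def Let_def
proof (intro SUP_least Inf_greatest, safe)
  fix g n h assume g: "g \<in> lorentz_space M (p / (p - 1)) (conj_exp s)"
      "lorentz_norm M (p / (p - 1)) (conj_exp s) g = 1"
    and h: "\<forall>k<(n::nat). h k \<in> lorentz_space M p s" "AE x in M. f x = (\<Sum>k<n. h k x)"
  have [measurable]: "g \<in> borel_measurable M" "\<And>k. k < n \<Longrightarrow> h k \<in> borel_measurable M"
    using g(1) h(1) by (auto simp: lorentz_space_def)
  have "ennreal (\<integral>x. f x * g x \<partial>M) \<le> ennreal (norm (\<integral>x. f x * g x \<partial>M))"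
    by (intro ennreal_leI) simp
  also have "\<dots> \<le> (\<integral>\<^sup>+x. ennreal (norm (f x * g x)) \<partial>M)"
    \<comment> \<open>A non-integrable product has Bochner integral 0, so the bound holds in that
      case as well.\<close>
    by (cases "integrable M (\<lambda>x. f x * g x)")
      (auto simp: not_integrable_integral_eq intro: integral_norm_bound_ennreal simp del: real_norm_def)
  also have "\<dots> \<le> (\<integral>\<^sup>+x. (\<Sum>k<n. ennreal \<bar>h k x\<bar> * ennreal \<bar>g x\<bar>) \<partial>M)"
  proof (rule nn_integral_mono_AE)
    show "AE x in M. ennreal (norm (f x * g x)) \<le> (\<Sum>k<n. ennreal \<bar>h k x\<bar> * ennreal \<bar>g x\<bar>)"
      using h(2)
    proof eventually_elim
      case (elim x)
      have "\<bar>f x * g x\<bar> \<le> (\<Sum>k<n. \<bar>h k x\<bar> * \<bar>g x\<bar>)"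
        unfolding elim abs_mult sum_distrib_right[symmetric] by (intro mult_right_mono sum_abs) simp
      then show ?case by (simp add: ennreal_leI sum_ennreal flip: ennreal_mult)
    qed
  qed
  also have "\<dots> = (\<Sum>k<n. \<integral>\<^sup>+x. ennreal \<bar>h k x\<bar> * ennreal \<bar>g x\<bar> \<partial>M)"
    by (intro nn_integral_sum) auto
  also have "\<dots> \<le> (\<Sum>k<n. lorentz_norm M p s (h k))"
    using g(2) by (intro sum_mono lorentz_Hoelder M p s) auto
  finally show "ennreal (\<integral>x. f x * g x \<partial>M) \<le> (\<Sum>k<n. lorentz_norm M p s (h k))" .
qed

text \<open>Splitting \<open>f\<close> in the proportions \<open>\<bar>h i x\<bar> / S x\<close>
  gives pieces dominated by the \<open>h i\<close>, so a pointwise majorant is as good as a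
  representation. All upper bounds of the decomposition norm below are obtained in this way.\<close>

lemma lorentz_decomp_le_sum:
  assumes [measurable]: "f \<in> borel_measurable M" and I: "finite I"
    and h: "\<And>i. i \<in> I \<Longrightarrow> h i \<in> lorentz_space M p s"
    and le: "AE x in M. \<bar>f x\<bar> \<le> (\<Sum>i\<in>I. \<bar>h i x\<bar>)"
  shows "lorentz_decomp_norm M p s f \<le> (\<Sum>i\<in>I. lorentz_norm M p s (h i))"
proof -
  obtain e where e: "bij_betw e {0..<card I} I" using ex_bij_betw_nat_finite[OF I] by blast
  then have e: "bij_betw e {..<card I} I" by (simp add: lessThan_atLeast0)
  have [measurable]: "i \<in> I \<Longrightarrow> h i \<in> borel_measurable M" for i
    using h by (auto simp: lorentz_space_def)
  define S where "S x = (\<Sum>i\<in>I. \<bar>h i x\<bar>)" for x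
  \<comment> \<open>The value 0 where the majorization fails makes
    \<open>\<bar>q i x\<bar> \<le> \<bar>h i x\<bar>\<close> true at every point.\<close>
  define q where "q i x = (if \<bar>f x\<bar> \<le> S x then f x * (\<bar>h i x\<bar> / S x) else 0)" for i x
  have [measurable]: "S \<in> borel_measurable M" unfolding S_def by measurable
  have [measurable]: "i \<in> I \<Longrightarrow> q i \<in> borel_measurable M" for i unfolding q_def by measurable
  have q_le: "\<bar>q i x\<bar> \<le> \<bar>h i x\<bar>" for i x
  proof (cases "S x > 0 \<and> \<bar>f x\<bar> \<le> S x")
    case True
    then have "\<bar>f x\<bar> * \<bar>h i x\<bar> \<le> S x * \<bar>h i x\<bar>" by (intro mult_right_mono) auto
    with True show ?thesis by (simp add: q_def abs_mult field_simps)
  next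
    case False
    have "0 \<le> S x" unfolding S_def by (intro sum_nonneg) auto
    with False show ?thesis by (auto simp: q_def)
  qed
  have q_norm: "lorentz_norm M p s (q i) \<le> lorentz_norm M p s (h i)" if "i \<in> I" for i
    using that q_le by (intro lorentz_norm_mono_AE) auto
  have "lorentz_decomp_norm M p s f \<le> (\<Sum>k<card I. lorentz_norm M p s (q (e k)))"
    unfolding lorentz_decomp_norm_def
  proof (intro Inf_lower CollectI exI conjI allI impI)
    fix k assume "k < card I"
    then have "e k \<in> I" using e by (auto dest: bij_betwE)
    then show "q (e k) \<in> lorentz_space M p s"
      using h[of "e k"] q_norm[of "e k"] by (auto simp: lorentz_space_def)
  next
    show "AE x in M. f x = (\<Sum>k<card I. q (e k) x)"
      using le
    proof eventually_elim
      case (elim x)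
      have "(\<Sum>k<card I. q (e k) x) = (\<Sum>i\<in>I. q i x)" by (rule sum.reindex_bij_betw[OF e])
      also have "\<dots> = (\<Sum>i\<in>I. f x * (\<bar>h i x\<bar> / S x))" using elim by (simp add: q_def S_def)
      also have "\<dots> = f x * (S x / S x)"
        by (simp add: sum_distrib_left[symmetric] sum_divide_distrib[symmetric] S_def)
      also have "\<dots> = f x" using elim by (cases "S x = 0") (auto simp: S_def[symmetric])
      finally show ?case ..
    qed
  qed simp
  also have "\<dots> = (\<Sum>i\<in>I. lorentz_norm M p s (q i))" by (rule sum.reindex_bij_betw[OF e])
  also have "\<dots> \<le> (\<Sum>i\<in>I. lorentz_norm M p s (h i))" by (intro sum_mono q_norm)
  finally show ?thesis .
qed

section \<open>Rank functions on nonatomic spaces\<close>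

text \<open>A set of positive finite measure splits into two parts of positive measure, one of which
  has at most half of the measure; this is iterated.\<close>

lemma nonatomic_small_subset:
  assumes na: "nonatomic M" and A: "A \<in> fmeasurable M" "0 < measure M A" and e: "0 < e"
  obtains B where "B \<in> fmeasurable M" "B \<subseteq> A" "0 < measure M B" "measure M B < e"
proof -
  have halve: "\<exists>B\<in>fmeasurable M. B \<subseteq> A \<and> 0 < measure M B \<and> 2 * measure M B \<le> measure M A"
    if A: "A \<in> fmeasurable M" "0 < measure M A" for A
  proof -
    have "0 < emeasure M A" using A by (simp add: emeasure_eq_measure2)
    then obtain B where B: "B \<in> sets M" "B \<subseteq> A" "0 < emeasure M B" "emeasure M B < emeasure M A"
      using na A unfolding nonatomic_def by (meson fmeasurableD)
    have Bf: "B \<in> fmeasurable M" using B A by (blast intro: fmeasurableI2)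
    have D: "A - B \<in> fmeasurable M" "measure M (A - B) = measure M A - measure M B"
      using A B Bf by (auto intro: fmeasurable.Diff measurable_measure_Diff)
    have "0 < measure M B" "measure M B < measure M A"
      using B(3,4) A(1) Bf by (auto simp: emeasure_eq_measure2 ennreal_less_iff)
    moreover have "2 * measure M B \<le> measure M A \<or> 2 * measure M (A - B) \<le> measure M A"
      using D(2) by linarith
    ultimately show ?thesis
      using D Bf B(2) by (metis Diff_subset diff_gt_0_iff_gt)
  qed
  have "\<exists>B\<in>fmeasurable M. B \<subseteq> A \<and> 0 < measure M B \<and> 2 ^ n * measure M B \<le> measure M A" for n :: nat
  proof (induction n)
    case 0
    then show ?case using A by auto
  next
    case (Suc n)
    then obtain B where B: "B \<in> fmeasurable M" "B \<subseteq> A" "0 < measure M B" "2 ^ n * measure M B \<le> measure M A" by blast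
    from halve[OF B(1,3)] obtain C where C: "C \<in> fmeasurable M" "C \<subseteq> B" "0 < measure M C" "2 * measure M C \<le> measure M B"
      by blast
    have "2 ^ Suc n * measure M C \<le> 2 ^ n * measure M B" using C(4) by simp
    also have "\<dots> \<le> measure M A" by (rule B(4))
    finally show ?case using B C by blast
  qed note * = this
  obtain n where n: "measure M A / e < 2 ^ n" using real_arch_pow[of 2 "measure M A / e"] by auto
  obtain B where B: "B \<in> fmeasurable M" "B \<subseteq> A" "0 < measure M B" "2 ^ n * measure M B \<le> measure M A"
    using *[of n] by blast
  have "measure M A < 2 ^ n * e" using n e by (simp add: field_simps)
  with B(4) have "2 ^ n * measure M B < 2 ^ n * e" by (rule le_less_trans)
  then have "measure M B < e" by simp
  with B that show ?thesis by blast
qed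

text \<open>Sierpinski's exhaustion argument. A subset of measure at most \<open>c\<close> is
  enlarged repeatedly by a set whose measure is at least half of what can be added without exceeding
  \<open>c\<close>. The increments tend to 0, so if the union fell short of \<open>c\<close>, a
  small remaining set of positive measure would contradict the choice of some increment.\<close>

lemma nonatomic_halve:
  assumes na: "nonatomic M" and A: "A \<in> fmeasurable M"
  shows "\<exists>B\<in>sets M. B \<subseteq> A \<and> measure M B = measure M A / 2"
proof -
  define c where "c = measure M A / 2"
  have c0: "0 \<le> c" by (simp add: c_def)
  define Q where "Q B \<longleftrightarrow> B \<in> fmeasurable M \<and> B \<subseteq> A \<and> measure M B \<le> c" for B
  define adm where "adm B C \<longleftrightarrow> C \<in> fmeasurable M \<and> C \<subseteq> A - B \<and> measure M C \<le> c - measure M B" for B C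
  \<comment> \<open>The increment has to reach only half of the measure of every admissible set,
    since the supremum of these measures need not be attained.\<close>
  define R where "R B B' \<longleftrightarrow> B \<subseteq> B' \<and> (\<forall>C. adm B C \<longrightarrow> measure M C \<le> 2 * (measure M B' - measure M B))" for B B'
  have step: "\<exists>B'. Q B' \<and> R B B'" if B: "Q B" for B
  proof -
    define S where "S = measure M ` {C. adm B C}"
    have ne: "S \<noteq> {}" using B by (auto simp: S_def adm_def Q_def intro!: exI[of _ "{}"])
    have bdd: "bdd_above S" by (auto simp: S_def adm_def intro!: bdd_aboveI)
    obtain C where C: "adm B C" "\<And>C'. adm B C' \<Longrightarrow> measure M C' \<le> 2 * measure M C"
    proof (cases "Sup S \<le> 0")
      case True
      have "measure M C' \<le> 0" if "adm B C'" for C'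
        using cSup_upper[OF _ bdd, of "measure M C'"] that True by (auto simp: S_def)
      moreover have "adm B {}" using B by (auto simp: adm_def Q_def)
      ultimately show ?thesis using that[of "{}"] by simp
    next
      case False
      then have "Sup S / 2 < Sup S" by simp
      then obtain y where "y \<in> S" "Sup S / 2 < y" using less_cSup_iff[OF ne bdd] by blast
      then obtain C where C: "adm B C" "Sup S / 2 < measure M C" by (auto simp: S_def)
      have "measure M C' \<le> 2 * measure M C" if "adm B C'" for C'
        using cSup_upper[OF _ bdd, of "measure M C'"] that C by (auto simp: S_def)
      with C that show ?thesis by blast
    qed
    have eq: "measure M (B \<union> C) = measure M B + measure M C"
    proof -
      have "B \<inter> C = {}" using C by (auto simp: adm_def)
      then show ?thesis using B C by (subst measure_Un3) (auto simp: Q_def adm_def)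
    qed
    have "Q (B \<union> C)" using B C(1) eq by (auto simp: Q_def adm_def)
    moreover have "R B (B \<union> C)" using C(2) eq by (auto simp: R_def)
    ultimately show ?thesis by blast
  qed
  have "Q {}" using c0 by (simp add: Q_def)
  then obtain B where B: "\<And>n. Q (B n)" "\<And>n. R (B n) (B (Suc n))"
    using dependent_nat_choice[of "\<lambda>_. Q" "\<lambda>_. R"] step by metis
  have [measurable]: "B n \<in> sets M" for n using B(1) by (auto simp: Q_def)
  define U where "U = (\<Union>n. B n)"
  have inc: "incseq B" using B(2) by (intro incseq_SucI) (auto simp: R_def)
  have UA: "U \<subseteq> A" using B(1) by (auto simp: U_def Q_def)
  have U: "U \<in> fmeasurable M" using UA A by (intro fmeasurableI2[OF A]) (auto simp: U_def)
  have lim: "(\<lambda>n. measure M (B n)) \<longlonglongrightarrow> measure M U"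
    unfolding U_def using U inc by (intro Lim_measure_incseq) (auto simp: U_def fmeasurableD2)
  have Uc: "measure M U \<le> c"
    using lim B(1) by (intro LIMSEQ_le_const2[OF lim]) (auto simp: Q_def)
  have "measure M U = c"
  proof (rule ccontr)
    assume "measure M U \<noteq> c"
    with Uc have lt: "measure M U < c" by simp
    have "measure M (A - U) = measure M A - measure M U"
      using A U UA by (intro measurable_measure_Diff) auto
    then have "0 < measure M (A - U)" using lt measure_nonneg[of M U] unfolding c_def by linarith
    then obtain E where E: "E \<in> fmeasurable M" "E \<subseteq> A - U" "0 < measure M E" "measure M E < c - measure M U"
      using nonatomic_small_subset[OF na, of "A - U" "c - measure M U"] A U lt
      by (metis diff_gt_0_iff_gt fmeasurable.Diff)
    have "measure M E \<le> 2 * (measure M (B (Suc n)) - measure M (B n))" for n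
    proof -
      have "measure M (B n) \<le> measure M U"
        using U by (intro measure_mono_fmeasurable) (auto simp: U_def)
      then have "adm (B n) E" using E by (auto simp: adm_def U_def)
      then show ?thesis using B(2)[of n] by (auto simp: R_def)
    qed
    moreover have "(\<lambda>n. 2 * (measure M (B (Suc n)) - measure M (B n))) \<longlonglongrightarrow> 2 * (measure M U - measure M U)"
      by (intro tendsto_intros lim LIMSEQ_Suc)
    ultimately have "measure M E \<le> 2 * (measure M U - measure M U)"
      by (intro LIMSEQ_le_const) auto
    with E(3) show False by simp
  qed
  with U UA show ?thesis by (auto simp: c_def)
qed

text \<open>The cells of a partition into sets of finite measure are halved again and again, and
  \<open>u\<close> is built from the number of the initial cell and the binary digits of the
  choices. A level set of \<open>u\<close> meets at most two cells of each generation, and the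
  measures of these tend to 0.\<close>

lemma nonatomic_imp_atomless_function:
  assumes "sigma_finite_measure M" and na: "nonatomic M"
  obtains u :: "'a \<Rightarrow> real" where "u \<in> borel_measurable M" "\<And>c. {x\<in>space M. u x = c} \<in> null_sets M"
proof -
  interpret sigma_finite_measure M by fact
  obtain A :: "nat \<Rightarrow> 'a set" where A: "range A \<subseteq> sets M" "(\<Union>i. A i) = space M"
    "\<And>i. emeasure M (A i) \<noteq> \<infinity>" "disjoint_family A"
    using sigma_finite_disjoint by metis
  have [measurable]: "A i \<in> sets M" for i using A by auto
  have Af: "A i \<in> fmeasurable M" for i using A(3) by (auto intro: fmeasurableI simp: less_top)
  obtain h where h: "\<And>B. B \<in> fmeasurable M \<Longrightarrow> h B \<in> sets M \<and> h B \<subseteq> B \<and> measure M (h B) = measure M B / 2"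
    using nonatomic_halve[OF na] by metis
  \<comment> \<open>\<open>v n x\<close> codes the number of the initial cell and \<open>n\<close>
    binary digits in one natural number; integer division by \<open>2 ^ n\<close> returns the
    initial cell. The next digit tells whether \<open>x\<close> lies in the chosen half of its
    current cell.\<close>
  define v where "v = rec_nat (\<lambda>x. LEAST i. x \<in> A i)
    (\<lambda>n w x. 2 * w x + (if x \<in> h {y\<in>space M. w y = w x} then 1 else (0::nat)))"
  have v0: "v 0 x = (LEAST i. x \<in> A i)" for x by (simp add: v_def)
  have vS: "v (Suc n) x = 2 * v n x + (if x \<in> h {y\<in>space M. v n y = v n x} then 1 else 0)" for n x
    by (simp add: v_def)
  have v: "v n \<in> measurable M (count_space UNIV) \<and> (\<forall>m. {x\<in>space M. v n x = m} \<in> fmeasurable M \<and>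
    measure M {x\<in>space M. v n x = m} \<le> measure M (A (m div 2 ^ n)) / 2 ^ n)" for n
  proof (induction n)
    case 0
    have sub: "{x \<in> space M. v 0 x = m} \<subseteq> A m" for m
      unfolding v0 using A(2) by (auto intro: LeastI)
    have m: "v 0 \<in> measurable M (count_space UNIV)" unfolding v0[abs_def] by measurable
    have "{x \<in> space M. v 0 x = m} \<in> sets M" for m using m by measurable
    then have "{x \<in> space M. v 0 x = m} \<in> fmeasurable M \<and>
      measure M {x \<in> space M. v 0 x = m} \<le> measure M (A m)" for m
      using fmeasurableI2[OF Af sub] measure_mono_fmeasurable[OF sub _ Af] by blast
    then show ?case using m by simp
  next
    case (Suc n)
    let ?L = "\<lambda>k. {y\<in>space M. v n y = k}"
    have [measurable]: "v n \<in> measurable M (count_space UNIV)" using Suc by blast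
    have Lf: "?L k \<in> fmeasurable M" for k using Suc by blast
    have [measurable]: "h (?L k) \<in> sets M" for k using h[OF Lf] by blast
    have m: "v (Suc n) \<in> measurable M (count_space UNIV)"
      unfolding vS[abs_def]
      by (rule measurable_compose_countable[where g = "v n" and f = "\<lambda>k x. 2 * k + (if x \<in> h (?L k) then 1 else 0)"]) measurable
    have L: "measure M (?L k) \<le> measure M (A (k div 2 ^ n)) / 2 ^ n" for k using Suc by blast
    have "{x\<in>space M. v (Suc n) x = m} \<in> fmeasurable M \<and>
      measure M {x\<in>space M. v (Suc n) x = m} \<le> measure M (A (m div 2 ^ Suc n)) / 2 ^ Suc n" for m
    proof -
      have eq: "m div 2 ^ Suc n = (m div 2) div 2 ^ n" by (simp add: div_mult2_eq)
      have hk: "h (?L (m div 2)) \<in> sets M" "h (?L (m div 2)) \<subseteq> ?L (m div 2)"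
        "measure M (h (?L (m div 2))) = measure M (?L (m div 2)) / 2"
        using h[OF Lf] by blast+
      have E: "{x\<in>space M. v (Suc n) x = m} =
        (if odd m then h (?L (m div 2)) else ?L (m div 2) - h (?L (m div 2)))" (is "_ = ?E")
      proof (intro set_eqI iffI)
        fix x assume "x \<in> {x\<in>space M. v (Suc n) x = m}"
        then show "x \<in> ?E" by (auto simp: vS split: if_splits)
      next
        fix x assume "x \<in> ?E"
        then show "x \<in> {x\<in>space M. v (Suc n) x = m}"
          using hk(2) by (auto simp: vS split: if_splits)
      qed
      have "?E \<in> fmeasurable M" using fmeasurableI2[OF Lf hk(2,1)] Lf by auto
      moreover have "measure M ?E = measure M (?L (m div 2)) / 2"
        using hk measurable_measure_Diff[OF Lf hk(1,2)] by auto
      ultimately show ?thesis unfolding E eq using L[of "m div 2"] by simp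
    qed
    with m show ?case by blast
  qed
  have [measurable]: "v n \<in> measurable M (count_space UNIV)" for n using v by blast
  define u where "u x = lim (\<lambda>n. real (v n x) / 2 ^ n)" for x
  have "\<exists>l. ((\<forall>n. real (v n x) / 2 ^ n \<le> l) \<and> (\<lambda>n. real (v n x) / 2 ^ n) \<longlonglongrightarrow> l) \<and>
    ((\<forall>n. l \<le> (real (v n x) + 1) / 2 ^ n) \<and> (\<lambda>n. (real (v n x) + 1) / 2 ^ n) \<longlonglongrightarrow> l)" for x
  proof (rule nested_sequence_unique)
    show "(\<lambda>n. real (v n x) / 2 ^ n - (real (v n x) + 1) / 2 ^ n) \<longlonglongrightarrow> 0"
    proof -
      have "(\<lambda>n. real (v n x) / 2 ^ n - (real (v n x) + 1) / 2 ^ n) = (\<lambda>n. - ((1 / 2) ^ n))"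
        by (simp add: diff_divide_distrib[symmetric] power_one_over[symmetric] inverse_eq_divide)
      moreover have "(\<lambda>n. - ((1 / 2 :: real) ^ n)) \<longlonglongrightarrow> - 0"
        by (intro tendsto_intros LIMSEQ_realpow_zero) auto
      ultimately show ?thesis by simp
    qed
    show "\<forall>n. real (v n x) / 2 ^ n \<le> real (v (Suc n) x) / 2 ^ Suc n"
      by (simp add: vS divide_simps)
    show "\<forall>n. (real (v (Suc n) x) + 1) / 2 ^ Suc n \<le> (real (v n x) + 1) / 2 ^ n"
      by (simp add: vS divide_simps)
    show "\<forall>n. real (v n x) / 2 ^ n \<le> (real (v n x) + 1) / 2 ^ n"
      by (simp add: divide_right_mono)
  qed
  note nested = this
  have u: "real (v n x) / 2 ^ n \<le> u x \<and> u x \<le> (real (v n x) + 1) / 2 ^ n" for n x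
  proof -
    obtain l where l: "\<And>n. real (v n x) / 2 ^ n \<le> l" "(\<lambda>n. real (v n x) / 2 ^ n) \<longlonglongrightarrow> l"
      "\<And>n. l \<le> (real (v n x) + 1) / 2 ^ n" using nested[of x] by blast
    have "u x = l" unfolding u_def by (rule limI) (rule l(2))
    with l show ?thesis by simp
  qed
  have [measurable]: "u \<in> borel_measurable M" unfolding u_def[abs_def] by measurable
  have "{x\<in>space M. u x = c} \<in> null_sets M" for c
  proof -
    \<comment> \<open>A cell with index \<open>m\<close> that meets the level set has an initial
      cell with number \<open>m div 2 ^ n \<le> c\<close>. So \<open>b\<close> bounds the measures
      of all initial cells involved, independently of \<open>n\<close>.\<close>
    define b where "b = (\<Sum>i\<le>nat \<lfloor>c\<rfloor>. measure M (A i))"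
    have le: "emeasure M {x\<in>space M. u x = c} \<le> ennreal (2 * b / 2 ^ n)" for n
    proof -
      \<comment> \<open>\<open>2 ^ n * c\<close> lies in the closed interval from
        \<open>v n x\<close> to \<open>v n x + 1\<close>; if it is an integer, it may be either end,
        hence two candidates.\<close>
      define k where "k = nat \<lfloor>2 ^ n * c\<rfloor>"
      have kk: "v n x = k \<or> v n x = k - 1" if "u x = c" for x
      proof -
        have "real (v n x) \<le> 2 ^ n * c" "2 ^ n * c \<le> real (v n x) + 1"
          using u[of n x] that by (auto simp: field_simps)
        then have "int (v n x) \<le> \<lfloor>2 ^ n * c\<rfloor>" "\<lfloor>2 ^ n * c\<rfloor> \<le> int (v n x) + 1"
          by linarith+
        then show ?thesis unfolding k_def by linarith
      qed
      have lev: "measure M {x\<in>space M. v n x = m \<and> u x = c} \<le> b / 2 ^ n \<and>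
          {x\<in>space M. v n x = m \<and> u x = c} \<in> fmeasurable M" for m
      proof (cases "{x\<in>space M. v n x = m \<and> u x = c} = {}")
        case False
        then obtain x where "v n x = m" "u x = c" by blast
        then have "real m / 2 ^ n \<le> c" using u[of n x] by simp
        then have "\<lfloor>real m / 2 ^ n\<rfloor> \<le> \<lfloor>c\<rfloor>" by (rule floor_mono)
        moreover have "\<lfloor>real m / 2 ^ n\<rfloor> = int (m div 2 ^ n)"
          using floor_divide_of_nat_eq[of m "2 ^ n", where ?'a = real] unfolding of_nat_power of_nat_numeral .
        ultimately have "m div 2 ^ n \<le> nat \<lfloor>c\<rfloor>" by linarith
        then have "measure M (A (m div 2 ^ n)) \<le> b"
          unfolding b_def using member_le_sum[of "m div 2 ^ n" "{..nat \<lfloor>c\<rfloor>}" "\<lambda>i. measure M (A i)"] by simp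
        then have "measure M (A (m div 2 ^ n)) / 2 ^ n \<le> b / 2 ^ n" by (intro divide_right_mono) auto
        moreover have sub: "{x\<in>space M. v n x = m \<and> u x = c} \<subseteq> {x\<in>space M. v n x = m}"
          "{x\<in>space M. v n x = m \<and> u x = c} \<in> sets M" "{x\<in>space M. v n x = m} \<in> fmeasurable M"
          using v[of n] by auto
        moreover have "measure M {x\<in>space M. v n x = m \<and> u x = c} \<le> measure M {x\<in>space M. v n x = m}"
          by (rule measure_mono_fmeasurable[OF sub])
        moreover have "{x\<in>space M. v n x = m \<and> u x = c} \<in> fmeasurable M"
          by (rule fmeasurableI2[OF sub(3,1,2)])
        moreover have "measure M {x\<in>space M. v n x = m} \<le> measure M (A (m div 2 ^ n)) / 2 ^ n"
          using v[of n] by blast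
        ultimately show ?thesis by linarith
      next
        case True
        have "0 \<le> b / 2 ^ n" by (simp add: b_def sum_nonneg)
        then show ?thesis unfolding True by simp
      qed
      have "{x\<in>space M. u x = c} = {x\<in>space M. v n x = k \<and> u x = c} \<union> {x\<in>space M. v n x = k - 1 \<and> u x = c}"
        using kk by blast
      then have "emeasure M {x\<in>space M. u x = c} \<le>
         emeasure M {x\<in>space M. v n x = k \<and> u x = c} + emeasure M {x\<in>space M. v n x = k - 1 \<and> u x = c}"
        by (simp add: emeasure_subadditive)
      also have "\<dots> \<le> ennreal (b / 2 ^ n) + ennreal (b / 2 ^ n)"
        using lev by (intro add_mono) (simp_all add: emeasure_eq_measure2 ennreal_leI)
      also have "\<dots> = ennreal (2 * b / 2 ^ n)"
        by (simp add: b_def sum_nonneg flip: ennreal_plus)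
      finally show ?thesis .
    qed
    have "(\<lambda>n. 2 * b * (1 / 2) ^ n) \<longlonglongrightarrow> 2 * b * 0"
      by (intro tendsto_intros LIMSEQ_realpow_zero) auto
    then have "(\<lambda>n. ennreal (2 * b / 2 ^ n)) \<longlonglongrightarrow> ennreal 0"
      by (intro tendsto_ennrealI) (simp add: power_divide)
    then have "emeasure M {x\<in>space M. u x = c} \<le> ennreal 0"
      using le by (intro LIMSEQ_le_const) auto
    then show ?thesis by (auto intro: null_setsI)
  qed
  then show ?thesis using that[of u] by measurable
qed

section \<open>Uniform distribution of ranks and Ryff's map\<close>

text \<open>By totality, \<open>R\<close> and its converse cover the square of \<open>A\<close>. All
  sections of \<open>R\<close> are null, so by Fubini both have measure 0 in the product. This is
  applied to show that no rank is shared by a set of positive measure.\<close>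

lemma null_square:
  assumes "sigma_finite_measure M" and [measurable]: "A \<in> sets M"
    and [measurable]: "Measurable.pred (M \<Otimes>\<^sub>M M) (\<lambda>(x, y). R x y)"
    and null: "\<And>x. x \<in> A \<Longrightarrow> emeasure M {y\<in>A. R x y} = 0"
    and total: "\<And>x y. x \<in> A \<Longrightarrow> y \<in> A \<Longrightarrow> R x y \<or> R y x"
  shows "emeasure M A = 0"
proof -
  interpret sigma_finite_measure M by fact
  interpret pair_sigma_finite M M by standard
  let ?i = "\<lambda>x y. indicator {(x, y). x \<in> A \<and> y \<in> A \<and> R x y} (x, y) :: ennreal"
  have AM: "A \<subseteq> space M" by (rule sets.sets_into_space) fact
  have [measurable]: "(\<lambda>(x, y). ?i x y) \<in> borel_measurable (M \<Otimes>\<^sub>M M)"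
  proof -
    have "{z\<in>space (M \<Otimes>\<^sub>M M). fst z \<in> A \<and> snd z \<in> A \<and> (case z of (x, y) \<Rightarrow> R x y)} \<in> sets (M \<Otimes>\<^sub>M M)"
      by measurable
    also have "{z\<in>space (M \<Otimes>\<^sub>M M). fst z \<in> A \<and> snd z \<in> A \<and> (case z of (x, y) \<Rightarrow> R x y)}
      = {(x, y). x \<in> A \<and> y \<in> A \<and> R x y}"
      using AM by (auto simp: space_pair_measure)
    finally show ?thesis by simp
  qed
  have [measurable]: "(\<lambda>(x, y). ?i y x) \<in> borel_measurable (M \<Otimes>\<^sub>M M)"
    using measurable_pair_swap[of "\<lambda>(x, y). ?i x y" M M borel] by (simp add: case_prod_beta')
  have zero: "(\<integral>\<^sup>+y. ?i x y \<partial>M) = 0" for x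
  proof (cases "x \<in> A")
    case True
    have [measurable]: "Measurable.pred M (R x)"
      using measurable_compose[OF measurable_Pair1' assms(3), of x] True AM by auto
    have "{y\<in>A. R x y} = {y\<in>space M. y \<in> A \<and> R x y}" using AM by auto
    also have "\<dots> \<in> sets M" by measurable
    finally have [measurable]: "{y\<in>A. R x y} \<in> sets M" .
    have "(\<integral>\<^sup>+y. ?i x y \<partial>M) = (\<integral>\<^sup>+y. indicator {y\<in>A. R x y} y \<partial>M)"
      using True by (intro nn_integral_cong) (auto simp: indicator_def)
    then show ?thesis using null[OF True] by simp
  qed (auto simp: indicator_def)
  have "emeasure M A * emeasure M A = (\<integral>\<^sup>+x. \<integral>\<^sup>+y. indicator A x * indicator A y \<partial>M \<partial>M)"
    by (simp add: nn_integral_cmult nn_integral_multc)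
  also have "\<dots> \<le> (\<integral>\<^sup>+x. \<integral>\<^sup>+y. ?i x y + ?i y x \<partial>M \<partial>M)"
    using total by (intro nn_integral_mono) (auto simp: indicator_def)
  also have "\<dots> = (\<integral>\<^sup>+x. \<integral>\<^sup>+y. ?i y x \<partial>M \<partial>M)"
  proof (rule nn_integral_cong)
    fix x assume x: "x \<in> space M"
    have "(\<lambda>y. ?i x y) \<in> borel_measurable M" "(\<lambda>y. ?i y x) \<in> borel_measurable M"
      using measurable_compose[OF measurable_Pair1'[OF x, of M], of "\<lambda>(x, y). ?i x y" borel]
        measurable_compose[OF measurable_Pair1'[OF x, of M], of "\<lambda>(x, y). ?i y x" borel] by simp_all
    then have "(\<integral>\<^sup>+y. ?i x y + ?i y x \<partial>M) = (\<integral>\<^sup>+y. ?i x y \<partial>M) + (\<integral>\<^sup>+y. ?i y x \<partial>M)"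
      by (rule nn_integral_add)
    then show "(\<integral>\<^sup>+y. ?i x y + ?i y x \<partial>M) = (\<integral>\<^sup>+y. ?i y x \<partial>M)" by (simp only: zero add_0)
  qed
  also have "\<dots> = (\<integral>\<^sup>+y. \<integral>\<^sup>+x. ?i y x \<partial>M \<partial>M)"
    by (rule Fubini'[symmetric]) measurable
  also have "\<dots> = 0" by (simp add: zero)
  finally show ?thesis by simp
qed

text \<open>Since \<open>u\<close> breaks the ties of \<open>f\<close>, the rank of a point in the lexicographic order of \<open>(f, u)\<close> is
  uniformly distributed.\<close>

lemma emeasure_lexicographic_rank:
  assumes M: "sigma_finite_measure M"
    and [measurable]: "f \<in> borel_measurable M" "u \<in> borel_measurable M"
    and fin: "\<And>y::real. 0 < y \<Longrightarrow> emeasure M {x\<in>space M. y < f x} < \<infinity>"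
    and u: "\<And>c::real. {x\<in>space M. u x = c} \<in> null_sets M"
  defines "L \<equiv> \<lambda>x. {y\<in>space M. f x < f y \<or> f x = f y \<and> u x < u y}"
  defines "T \<equiv> \<lambda>x. emeasure M (L x)"
  shows "T \<in> borel_measurable M" "\<And>x. x \<in> space M \<Longrightarrow> 0 < f x \<Longrightarrow> T x < \<infinity>"
    "emeasure M {x\<in>space M. 0 < f x \<and> T x < t} = min t (emeasure M {x\<in>space M. 0 < f x})"
proof -
  interpret sigma_finite_measure M by fact
  have [measurable]: "L x \<in> sets M" for x unfolding L_def by measurable
  show [measurable]: "T \<in> borel_measurable M"
  proof -
    let ?Q = "{z\<in>space (M \<Otimes>\<^sub>M M). f (fst z) < f (snd z) \<or> f (fst z) = f (snd z) \<and> u (fst z) < u (snd z)}"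
    have "?Q \<in> sets (M \<Otimes>\<^sub>M M)" by measurable
    then have "(\<lambda>x. emeasure M (Pair x -` ?Q)) \<in> borel_measurable M" by (rule measurable_emeasure_Pair)
    moreover have "Pair x -` ?Q = L x" if "x \<in> space M" for x
      using that by (auto simp: L_def space_pair_measure)
    ultimately show ?thesis unfolding T_def by (subst measurable_cong[where g = "\<lambda>x. emeasure M (Pair x -` ?Q)"]) auto
  qed
  show fT: "T x < \<infinity>" if "x \<in> space M" "0 < f x" for x
  proof -
    have "T x \<le> emeasure M {y\<in>space M. f x / 2 < f y}"
      unfolding T_def L_def using that by (intro emeasure_mono) auto
    with fin[of "f x / 2"] that show ?thesis by (auto intro: le_less_trans)
  qed
  define Z where "Z = {x\<in>space M. 0 < f x}"
  have [measurable]: "Z \<in> sets M" unfolding Z_def by measurable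
  have ZM: "x \<in> Z \<Longrightarrow> x \<in> space M" for x by (simp add: Z_def)
  have LZ: "x \<in> Z \<Longrightarrow> L x \<subseteq> Z" for x by (auto simp: L_def Z_def)
  have sub1: "y \<in> L x \<Longrightarrow> L y \<subseteq> L x" for x y unfolding L_def by auto
  have sub2: "y \<in> space M \<Longrightarrow> y \<notin> L x \<Longrightarrow> L x \<subseteq> L y" for x y
    unfolding L_def by (auto simp: not_less)
  have T1: "y \<in> L x \<Longrightarrow> T y \<le> T x" for x y unfolding T_def by (intro emeasure_mono sub1) auto
  have T2: "y \<in> space M \<Longrightarrow> y \<notin> L x \<Longrightarrow> T x \<le> T y" for x y unfolding T_def by (intro emeasure_mono sub2) auto
  have pred [measurable]: "Measurable.pred (M \<Otimes>\<^sub>M M) (\<lambda>(x, y). \<not> (f x < f y \<or> f x = f y \<and> u x < u y))"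
    "Measurable.pred (M \<Otimes>\<^sub>M M) (\<lambda>(x, y). \<not> (f y < f x \<or> f y = f x \<and> u y < u x))"
    by measurable
  have fiber: "emeasure M {x\<in>Z. T x = c} = 0" for c
  proof -
    define C where "C = {x\<in>Z. T x = c}"
    have "C = {x\<in>space M. x \<in> Z \<and> T x = c}" by (auto simp: C_def ZM)
    then have [measurable]: "C \<in> sets M" by simp
    have CZ: "x \<in> C \<Longrightarrow> x \<in> Z" and CM: "x \<in> C \<Longrightarrow> x \<in> space M" and CT: "x \<in> C \<Longrightarrow> T x = c" for x
      by (auto simp: C_def Z_def)
    \<comment> \<open>For \<open>y\<close> in this set, its members that are not above
      \<open>y\<close> lie in \<open>L x0 - L y\<close>, a difference of two nested sets of the same
      finite measure. Not being above is a total relation, so \<open>null_square\<close>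
      applies.\<close>
    have top_null: "emeasure M (C \<inter> L x0) = 0" if x0: "x0 \<in> C" for x0
    proof (rule null_square[OF M _ pred(1)])
      fix y assume y: "y \<in> C \<inter> L x0"
      have "{z \<in> C \<inter> L x0. \<not> (f y < f z \<or> f y = f z \<and> u y < u z)} \<subseteq> L x0 - L y"
        by (auto simp: L_def)
      then have "emeasure M {z \<in> C \<inter> L x0. \<not> (f y < f z \<or> f y = f z \<and> u y < u z)} \<le> emeasure M (L x0 - L y)"
        by (intro emeasure_mono) auto
      also have "\<dots> = T x0 - T y"
        unfolding T_def using y fT[of y] CZ sub1 by (intro emeasure_Diff) (auto simp: T_def Z_def)
      also have "\<dots> = 0"
        using y x0 CT fT[of x0] CZ[OF x0] by (auto simp: Z_def ennreal_minus_eq_0)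
      finally show "emeasure M {z \<in> C \<inter> L x0. \<not> (f y < f z \<or> f y = f z \<and> u y < u z)} = 0" by simp
    qed auto
    \<comment> \<open>Now the sections consist of points above \<open>x\<close>, covered by
      \<open>top_null\<close>, and of points tied with \<open>x\<close>, which lie in a level set of
      \<open>u\<close>.\<close>
    have "emeasure M C = 0"
    proof (rule null_square[OF M _ pred(2)])
      fix x assume x: "x \<in> C"
      have "{y \<in> C. \<not> (f y < f x \<or> f y = f x \<and> u y < u x)} \<subseteq> (C \<inter> L x) \<union> {y\<in>space M. u y = u x}"
        by (auto simp: L_def CM)
      moreover have "(C \<inter> L x) \<union> {y\<in>space M. u y = u x} \<in> null_sets M"
        using top_null[OF x] u by (intro null_sets.Un) (auto intro: null_setsI)
      ultimately show "emeasure M {y \<in> C. \<not> (f y < f x \<or> f y = f x \<and> u y < u x)} = 0"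
        by (metis (no_types, lifting) emeasure_mono le_zero_eq null_setsD1 null_setsD2)
    qed auto
    then show ?thesis by (simp add: C_def)
  qed
  have [measurable]: "{x\<in>Z. T x < t} \<in> sets M" "{x\<in>Z. T x = t} \<in> sets M" for t
  proof -
    have "{x\<in>Z. T x < t} = {x\<in>space M. x \<in> Z \<and> T x < t}" "{x\<in>Z. T x = t} = {x\<in>space M. x \<in> Z \<and> T x = t}"
      by (auto simp: ZM)
    then show "{x\<in>Z. T x < t} \<in> sets M" "{x\<in>Z. T x = t} \<in> sets M" by simp_all
  qed
  have null_fiber: "{x\<in>Z. T x = t} \<in> null_sets M" for t using fiber by (intro null_setsI) auto
  \<comment> \<open>Up to the null fiber over \<open>T x\<close>, the points of smaller rank are
    exactly those of \<open>L x\<close>.\<close>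
  have self: "emeasure M {z\<in>Z. T z < T x} = T x" if x: "x \<in> Z" for x
  proof (rule antisym)
    have "{z\<in>Z. T z < T x} \<subseteq> L x" using T2 ZM by (auto simp: not_le[symmetric])
    then have "emeasure M {z\<in>Z. T z < T x} \<le> emeasure M (L x)" by (rule emeasure_mono) measurable
    then show "emeasure M {z\<in>Z. T z < T x} \<le> T x" by (simp add: T_def)
    have "L x \<subseteq> {z\<in>Z. T z < T x} \<union> {z\<in>Z. T z = T x}"
      using T1 LZ[OF x] by (auto simp: order_le_less)
    then have "emeasure M (L x) \<le> emeasure M ({z\<in>Z. T z < T x} \<union> {z\<in>Z. T z = T x})"
      by (rule emeasure_mono) measurable
    then have "T x \<le> emeasure M ({z\<in>Z. T z < T x} \<union> {z\<in>Z. T z = T x})" by (simp add: T_def)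
    also have "\<dots> = emeasure M {z\<in>Z. T z < T x}"
      by (intro emeasure_Un_null_set null_fiber) measurable
    finally show "T x \<le> emeasure M {z\<in>Z. T z < T x}" .
  qed
  have "emeasure M {x\<in>Z. T x < t} \<le> t"
  proof (cases "{x\<in>Z. T x < t} = {}")
    case False
    \<comment> \<open>The measure is known at attained ranks by \<open>self\<close>. The ranks below
      \<open>t\<close> are exhausted by a sequence of attained ones, up to the null fiber over their
      supremum.\<close>
    define S where "S = T ` {x\<in>Z. T x < t}"
    have "S \<noteq> {}" using False by (simp add: S_def)
    then obtain g :: "nat \<Rightarrow> ennreal" where g: "incseq g" "range g \<subseteq> S" "Sup S = Sup (range g)"
      using ennreal_Sup_countable_SUP by blast
    have "{x\<in>Z. T x < t} \<subseteq> (\<Union>n. {x\<in>Z. T x < g n}) \<union> {x\<in>Z. T x = Sup S}"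
    proof
      fix x assume x: "x \<in> {x\<in>Z. T x < t}"
      then have "T x \<le> Sup S" by (intro Sup_upper) (auto simp: S_def)
      moreover have "\<exists>n. T x < g n" if "T x < Sup S" using that g(3) by (auto simp: less_Sup_iff)
      ultimately show "x \<in> (\<Union>n. {x\<in>Z. T x < g n}) \<union> {x\<in>Z. T x = Sup S}" using x by (auto simp: order_le_less)
    qed
    then have "emeasure M {x\<in>Z. T x < t} \<le> emeasure M ((\<Union>n. {x\<in>Z. T x < g n}) \<union> {x\<in>Z. T x = Sup S})"
      by (rule emeasure_mono) auto
    also have "\<dots> = emeasure M (\<Union>n. {x\<in>Z. T x < g n})"
      by (intro emeasure_Un_null_set null_fiber) auto
    also have "\<dots> = (SUP n. emeasure M {x\<in>Z. T x < g n})"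
      using g(1) by (intro SUP_emeasure_incseq[symmetric]) (auto simp: incseq_def dest: less_le_trans)
    also have "\<dots> \<le> t"
    proof (rule SUP_least)
      fix n
      have "g n \<in> S" using g(2) by auto
      then show "emeasure M {x\<in>Z. T x < g n} \<le> t" using self by (auto simp: S_def)
    qed
    finally show ?thesis .
  next
    case True
    show ?thesis unfolding True by simp
  qed
  moreover have "emeasure M {x\<in>Z. T x < t} \<le> emeasure M Z" by (intro emeasure_mono) auto
  moreover have "t \<le> emeasure M {x\<in>Z. T x < t}" if "\<not> Z \<subseteq> {x\<in>Z. T x < t}"
  proof -
    \<comment> \<open>The same from above. Continuity from above requires finite measures, which
      hold because each \<open>g n\<close> is the rank of a point with
      \<open>0 < f x\<close>.\<close>
    define S where "S = T ` {x\<in>Z. t \<le> T x}"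
    have "S \<noteq> {}" using that by (auto simp: S_def not_less)
    then obtain g :: "nat \<Rightarrow> ennreal" where g: "antimono g" "range g \<subseteq> S" "Inf S = Inf (range g)"
      using ennreal_Inf_countable_INF by blast
    have gS: "g n \<in> S" for n using g(2) by auto
    have selfg: "emeasure M {x\<in>Z. T x < g n} = g n" and gfin: "g n < \<infinity>" for n
    proof -
      from gS[of n] obtain x where x: "x \<in> Z" "g n = T x" by (auto simp: S_def)
      show "emeasure M {x\<in>Z. T x < g n} = g n" unfolding x(2) by (rule self[OF x(1)])
      show "g n < \<infinity>" unfolding x(2) using x(1) by (intro fT) (auto simp: Z_def)
    qed
    have "t \<le> Inf S" by (intro Inf_greatest) (auto simp: S_def)
    also have "Inf S = (INF n. emeasure M {x\<in>Z. T x < g n})" unfolding g(3) selfg ..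
    also have "\<dots> = emeasure M (\<Inter>n. {x\<in>Z. T x < g n})"
    proof (rule INF_emeasure_decseq)
      show "decseq (\<lambda>n. {x\<in>Z. T x < g n})"
        using g(1) unfolding decseq_def monotone_def by (fast elim: less_le_trans)
      show "emeasure M {x\<in>Z. T x < g n} \<noteq> \<infinity>" for n using gfin[of n] by (simp add: selfg)
    qed auto
    also have "\<dots> \<le> emeasure M ({x\<in>Z. T x < t} \<union> {x\<in>Z. T x = Inf S})"
    proof (rule emeasure_mono)
      show "(\<Inter>n. {x\<in>Z. T x < g n}) \<subseteq> {x\<in>Z. T x < t} \<union> {x\<in>Z. T x = Inf S}"
      proof
        fix x assume x: "x \<in> (\<Inter>n. {x\<in>Z. T x < g n})"
        then have "T x \<le> Inf S" unfolding g(3) by (intro Inf_greatest) (auto intro: less_imp_le)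
        moreover have "Inf S \<le> T x" if "t \<le> T x" using that x by (intro Inf_lower) (auto simp: S_def)
        ultimately show "x \<in> {x\<in>Z. T x < t} \<union> {x\<in>Z. T x = Inf S}" using x by (auto simp: not_less[symmetric])
      qed
    qed auto
    also have "\<dots> = emeasure M {x\<in>Z. T x < t}"
      by (intro emeasure_Un_null_set null_fiber) auto
    finally show ?thesis .
  qed
  moreover have "{x\<in>Z. T x < t} = {x\<in>space M. 0 < f x \<and> T x < t}" by (auto simp: Z_def)
  ultimately show "emeasure M {x\<in>space M. 0 < f x \<and> T x < t} = min t (emeasure M {x\<in>space M. 0 < f x})"
    unfolding Z_def[symmetric] by (metis (no_types, lifting) antisym emeasure_mono min_absorb1 min_absorb2 min_def sets.sets_into_space \<open>\<And>t. {x \<in> Z. T x < t} \<in> sets M\<close>)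
qed

text \<open>The map is the lexicographic rank of \<open>\<bar>f\<bar>\<close>, with ties broken by
  an atomless function. The two inequalities place \<open>\<bar>f x\<bar>\<close> between the
  rearrangement at \<open>\<tau> x\<close> and its values to the left of \<open>\<tau> x\<close>.
  Points with \<open>f x = 0\<close> are left out because their rank may be infinite.\<close>

lemma nonatomic_Ryff:
  assumes M: "sigma_finite_measure M" and na: "nonatomic M"
    and [measurable]: "f \<in> borel_measurable M"
    and fin: "\<And>y. 0 < y \<Longrightarrow> emeasure M {x\<in>space M. y < \<bar>f x\<bar>} < \<infinity>"
  obtains \<tau> where "\<tau> \<in> borel_measurable M" "\<And>x. 0 \<le> \<tau> x"
    "\<And>x. x \<in> space M \<Longrightarrow> f x \<noteq> 0 \<Longrightarrow> rearr M f (\<tau> x) \<le> ennreal \<bar>f x\<bar>"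
    "\<And>x t. x \<in> space M \<Longrightarrow> f x \<noteq> 0 \<Longrightarrow> 0 \<le> t \<Longrightarrow> t < \<tau> x \<Longrightarrow> ennreal \<bar>f x\<bar> \<le> rearr M f t"
    "\<And>t. 0 \<le> t \<Longrightarrow> emeasure M {x\<in>space M. f x \<noteq> 0 \<and> \<tau> x < t} = min (ennreal t) (emeasure M {x\<in>space M. f x \<noteq> 0})"
proof -
  obtain u :: "'a \<Rightarrow> real" where u: "u \<in> borel_measurable M" "\<And>c. {x\<in>space M. u x = c} \<in> null_sets M"
    using nonatomic_imp_atomless_function[OF M na] by blast
  note [measurable] = u(1)
  define L where "L x = {y\<in>space M. \<bar>f x\<bar> < \<bar>f y\<bar> \<or> \<bar>f x\<bar> = \<bar>f y\<bar> \<and> u x < u y}" for x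
  define T where "T x = emeasure M (L x)" for x
  have [measurable]: "T \<in> borel_measurable M"
    and fT: "\<And>x. x \<in> space M \<Longrightarrow> 0 < \<bar>f x\<bar> \<Longrightarrow> T x < \<infinity>"
    and dT: "\<And>t. emeasure M {x\<in>space M. 0 < \<bar>f x\<bar> \<and> T x < t} = min t (emeasure M {x\<in>space M. 0 < \<bar>f x\<bar>})"
    unfolding T_def[abs_def] L_def
    using emeasure_lexicographic_rank[OF M _ u(1), of "\<lambda>x. \<bar>f x\<bar>"] fin u(2) by simp_all
  define \<tau> where "\<tau> x = enn2real (T x)" for x
  have \<tau>: "ennreal (\<tau> x) = T x" if "x \<in> space M" "f x \<noteq> 0" for x
    using fT[of x] that by (simp add: \<tau>_def)
  show ?thesis
  proof (rule that[of \<tau>])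
    show "\<tau> \<in> borel_measurable M" unfolding \<tau>_def[abs_def] by measurable
    show "0 \<le> \<tau> x" for x by (simp add: \<tau>_def)
    show "rearr M f (\<tau> x) \<le> ennreal \<bar>f x\<bar>" if "x \<in> space M" "f x \<noteq> 0" for x
      using that by (auto simp: rearr_le_iff \<tau> T_def L_def ennreal_less_iff intro!: emeasure_mono)
    show "ennreal \<bar>f x\<bar> \<le> rearr M f t" if x: "x \<in> space M" "f x \<noteq> 0" and t: "0 \<le> t" "t < \<tau> x" for x t
    proof (rule ccontr)
      assume "\<not> ?thesis"
      then have less: "rearr M f t < ennreal \<bar>f x\<bar>" by simp
      have "T x \<le> emeasure M {y\<in>space M. rearr M f t < ennreal \<bar>f y\<bar>}"
        unfolding T_def
      proof (rule emeasure_mono)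
        show "L x \<subseteq> {y\<in>space M. rearr M f t < ennreal \<bar>f y\<bar>}"
        proof
          fix y assume "y \<in> L x"
          then have y: "y \<in> space M" "\<bar>f x\<bar> \<le> \<bar>f y\<bar>" by (auto simp: L_def)
          from less ennreal_leI[OF y(2)] have "rearr M f t < ennreal \<bar>f y\<bar>" by (rule less_le_trans)
          with y(1) show "y \<in> {y\<in>space M. rearr M f t < ennreal \<bar>f y\<bar>}" by simp
        qed
      qed measurable
      also have "\<dots> \<le> ennreal t" using rearr_le_iff[of f M t "rearr M f t"] by simp
      finally show False using t x by (simp add: \<tau>[symmetric])
    qed
    show "emeasure M {x\<in>space M. f x \<noteq> 0 \<and> \<tau> x < t} = min (ennreal t) (emeasure M {x\<in>space M. f x \<noteq> 0})"
      if t: "0 \<le> t" for t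
    proof -
      have "{x\<in>space M. f x \<noteq> 0 \<and> \<tau> x < t} = {x\<in>space M. 0 < \<bar>f x\<bar> \<and> T x < ennreal t}"
      proof -
        have "T x < ennreal t \<longleftrightarrow> \<tau> x < t" if "x \<in> space M" "f x \<noteq> 0" for x
          unfolding \<tau>[OF that, symmetric] by (rule ennreal_less_iff) (simp add: \<tau>_def)
        then show ?thesis by auto
      qed
      then show ?thesis using dT by simp
    qed
  qed
qed

lemma nn_integral_Ryff:
  assumes [measurable]: "\<tau> \<in> borel_measurable M" "Z \<in> sets M" and \<tau>0: "\<And>x. 0 \<le> \<tau> x"
    and dist: "\<And>t. 0 \<le> t \<Longrightarrow> emeasure M {x\<in>Z. \<tau> x < t} = min (ennreal t) (emeasure M Z)"
    and [measurable]: "K \<in> borel_measurable borel"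
  shows "(\<integral>\<^sup>+x\<in>Z. K (\<tau> x) \<partial>M) = (\<integral>\<^sup>+t\<in>{t. 0 < t \<and> ennreal t < emeasure M Z}. K t \<partial>lborel)"
proof -
  \<comment> \<open>The sign change turns the sets where \<open>\<tau> x < t\<close> into open upper
    rays, on which \<open>measure_eqI_lessThan\<close> compares two measures.\<close>
  let ?N1 = "distr (density M (indicator Z)) borel (\<lambda>x. - \<tau> x)"
  let ?J = "{t::real. t < 0 \<and> ennreal (- t) < emeasure M Z}"
  let ?N2 = "density lborel (indicator ?J)"
  have N1: "emeasure ?N1 {a<..} = min (ennreal (- a)) (emeasure M Z)" for a
  proof -
    have "emeasure ?N1 {a<..} = emeasure (density M (indicator Z)) {x\<in>space M. \<tau> x < - a}"
      by (subst emeasure_distr) (auto intro!: arg_cong2[where f = emeasure])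
    also have "\<dots> = emeasure M (Z \<inter> {x\<in>space M. \<tau> x < - a})"
      by (intro emeasure_density_const[THEN trans, of _ _ 1] | subst emeasure_restricted)+ auto
    also have "Z \<inter> {x\<in>space M. \<tau> x < - a} = {x\<in>Z. \<tau> x < - a}"
      using sets.sets_into_space[OF assms(2)] by auto
    also have "emeasure M \<dots> = min (ennreal (- a)) (emeasure M Z)"
    proof (cases "0 \<le> - a")
      case False
      have "\<not> \<tau> x < - a" for x using \<tau>0[of x] False by linarith
      then have empty: "{x\<in>Z. \<tau> x < - a} = {}" by blast
      show ?thesis unfolding empty using False by (simp add: ennreal_neg)
    qed (simp add: dist)
    finally show ?thesis .
  qed
  have N2: "emeasure ?N2 {a<..} = min (ennreal (- a)) (emeasure M Z)" for a
  proof -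
    have "emeasure ?N2 {a<..} = emeasure lborel (?J \<inter> {a<..})"
      by (subst emeasure_restricted) auto
    also have "\<dots> = min (ennreal (- a)) (emeasure M Z)"
    proof (cases "emeasure M Z")
      case (real r)
      have "?J \<inter> {a<..} = {max a (- r)<..<0}" using real by (auto simp: ennreal_less_iff)
      moreover have "emeasure lborel {max a (- r)<..<0} = min (ennreal (- a)) (ennreal r)"
      proof (cases "- a \<le> r")
        case True
        then have "max a (- r) = a" by simp
        moreover have "min (ennreal (- a)) (ennreal r) = ennreal (- a)"
          using True by (intro min_absorb1 ennreal_leI)
        ultimately show ?thesis by (cases "a \<le> 0") (simp_all add: ennreal_neg)
      next
        case False
        then have "max a (- r) = - r" by simp
        moreover have "min (ennreal (- a)) (ennreal r) = ennreal r"
          using False by (intro min_absorb2 ennreal_leI) simp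
        ultimately show ?thesis using real by simp
      qed
      ultimately show ?thesis using real by simp
    next
      case top
      have "?J \<inter> {a<..} = {a<..<0}" using top by auto
      then show ?thesis using top by (cases "a \<le> 0") (auto simp: ennreal_neg)
    qed
    finally show ?thesis .
  qed
  have eq: "?N1 = ?N2"
  proof (rule measure_eqI_lessThan)
    show "emeasure ?N1 {a<..} < \<infinity>" for a unfolding N1 by (simp add: min_less_iff_disj)
    show "emeasure ?N1 {a<..} = emeasure ?N2 {a<..}" for a unfolding N1 N2 ..
  qed simp_all
  have "(\<integral>\<^sup>+x\<in>Z. K (\<tau> x) \<partial>M) = (\<integral>\<^sup>+s. K (- s) \<partial>?N1)"
    by (simp add: nn_integral_distr nn_integral_density mult.commute)
  also have "\<dots> = (\<integral>\<^sup>+s. indicator ?J s * K (- s) \<partial>lborel)"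
    unfolding eq by (simp add: nn_integral_density)
  also have "\<dots> = (\<integral>\<^sup>+t. indicator ?J (- t) * K t \<partial>lborel)"
    by (subst nn_integral_real_affine[of _ "- 1" 0]) auto
  also have "\<dots> = (\<integral>\<^sup>+t\<in>{t. 0 < t \<and> ennreal t < emeasure M Z}. K t \<partial>lborel)"
    by (intro nn_integral_cong) (auto simp: indicator_def)
  finally show ?thesis .
qed

section \<open>Testing the dual norm\<close>

lemma nn_integral_powr_from_0:
  assumes "0 < \<alpha>" "0 \<le> b"
  shows "(\<integral>\<^sup>+t\<in>{0<..b}. ennreal (t powr (\<alpha> - 1)) \<partial>lborel) = ennreal (b powr \<alpha> / \<alpha>)"
proof -
  have "((\<lambda>t. t powr (\<alpha> - 1)) has_integral (b powr \<alpha> / \<alpha>)) {0..b}"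
    using has_integral_powr_from_0[of "\<alpha> - 1" b] assms by simp
  then have "((\<lambda>t. if t \<in> {0..b} then t powr (\<alpha> - 1) else 0) has_integral (b powr \<alpha> / \<alpha>)) UNIV"
    by (simp only: has_integral_restrict_UNIV)
  then have "(\<integral>\<^sup>+t. ennreal (if t \<in> {0..b} then t powr (\<alpha> - 1) else 0) \<partial>lborel) = ennreal (b powr \<alpha> / \<alpha>)"
    by (intro nn_integral_has_integral_lborel) auto
  moreover have "(\<integral>\<^sup>+t\<in>{0<..b}. ennreal (t powr (\<alpha> - 1)) \<partial>lborel) =
    (\<integral>\<^sup>+t. ennreal (if t \<in> {0..b} then t powr (\<alpha> - 1) else 0) \<partial>lborel)"
    by (intro nn_integral_cong) (auto simp: indicator_def)
  ultimately show ?thesis by simp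
qed

text \<open>Up to \<open>t0\<close> the function dominates the constant \<open>\<phi> t0\<close>, so
  the bound comes from the functional of the indicator of that interval. For rearrangements it
  yields finite values at positive arguments and superlevel sets of finite measure.\<close>

lemma lorentz_fun_lower_bound:
  assumes p: "0 < p" and s: "1 \<le> s"
  obtains c where "0 < c" "\<And>\<phi> t0. (\<And>t. 0 < t \<Longrightarrow> t \<le> t0 \<Longrightarrow> \<phi> t0 \<le> \<phi> t) \<Longrightarrow> 0 < t0 \<Longrightarrow>
    \<phi> \<in> borel_measurable borel \<Longrightarrow> ennreal (c * t0 powr (1 / p)) * \<phi> t0 \<le> lorentz_fun p s \<phi>"
proof (cases s)
  case top
  show ?thesis by (rule that[of 1]) (auto simp: top lorentz_fun_top[simplified] intro!: SUP_upper)
next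
  case (real r)
  with s have r: "1 \<le> r" by (simp flip: ennreal_1)
  have "ennreal ((p / r) powr (1 / r) * t0 powr (1 / p)) * \<phi> t0 \<le> lorentz_fun p s \<phi>"
    if \<phi>: "\<And>t. 0 < t \<Longrightarrow> t \<le> t0 \<Longrightarrow> \<phi> t0 \<le> \<phi> t" and t0: "0 < t0" and [measurable]: "\<phi> \<in> borel_measurable borel" for \<phi> t0
  proof -
    have "ennreal (t0 powr (r / p) / (r / p)) * ennreal_powr (\<phi> t0) r =
       (\<integral>\<^sup>+t\<in>{0<..t0}. ennreal (t powr (r / p - 1)) \<partial>lborel) * ennreal_powr (\<phi> t0) r"
      using r p t0 by (subst nn_integral_powr_from_0) auto
    also have "\<dots> = (\<integral>\<^sup>+t. ennreal (t powr (r / p - 1)) * indicator {0<..t0} t * ennreal_powr (\<phi> t0) r \<partial>lborel)"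
      by (rule nn_integral_multc[symmetric]) measurable
    also have "\<dots> \<le> (\<integral>\<^sup>+t\<in>{0<..}. ennreal (t powr (r / p - 1)) * ennreal_powr (\<phi> t) r \<partial>lborel)"
      using \<phi> r by (intro nn_integral_mono) (auto simp: indicator_def intro!: mult_left_mono ennreal_powr_mono)
    finally have "ennreal_powr (ennreal (t0 powr (r / p) / (r / p)) * ennreal_powr (\<phi> t0) r) (1 / r) \<le> lorentz_fun p s \<phi>"
      unfolding real lorentz_fun_real[OF r] using r by (intro ennreal_powr_mono) auto
    also have "ennreal_powr (ennreal (t0 powr (r / p) / (r / p)) * ennreal_powr (\<phi> t0) r) (1 / r)
      = ennreal ((t0 powr (r / p) / (r / p)) powr (1 / r)) * \<phi> t0"
      using r p by (simp add: ennreal_powr_mult ennreal_powr_inverse ennreal_powr_ennreal)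
    also have "(t0 powr (r / p) / (r / p)) powr (1 / r) = (p / r) powr (1 / r) * t0 powr (1 / p)"
    proof -
      have "t0 powr (r / p) / (r / p) = (p / r) * t0 powr (r / p)" using r p by (simp add: field_simps)
      moreover have "((p / r) * t0 powr (r / p)) powr (1 / r) = (p / r) powr (1 / r) * (t0 powr (r / p)) powr (1 / r)"
        using r p by (intro powr_mult)
      moreover have "(t0 powr (r / p)) powr (1 / r) = t0 powr (1 / p)" using r by (simp add: powr_powr)
      ultimately show ?thesis by (simp only:)
    qed
    finally show ?thesis .
  qed
  then show ?thesis using that[of "(p / r) powr (1 / r)"] r p by auto
qed

lemma lorentz_space_rearr_finite:
  assumes f: "f \<in> lorentz_space M p s" and p: "1 < p" and s: "1 \<le> s"
  shows "0 < t \<Longrightarrow> rearr M f t < \<infinity>"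
    and "0 < y \<Longrightarrow> emeasure M {x\<in>space M. y < \<bar>f x\<bar>} < \<infinity>"
proof -
  have [measurable]: "f \<in> borel_measurable M" using f by (simp add: lorentz_space_def)
  obtain c where c: "0 < c" "\<And>\<phi> t0. (\<And>t. 0 < t \<Longrightarrow> t \<le> t0 \<Longrightarrow> \<phi> t0 \<le> \<phi> t) \<Longrightarrow> 0 < t0 \<Longrightarrow>
    \<phi> \<in> borel_measurable borel \<Longrightarrow> ennreal (c * t0 powr (1 / p)) * \<phi> t0 \<le> lorentz_fun p s \<phi>"
    using lorentz_fun_lower_bound[OF _ s, of p] p by auto
  have "lorentz_norm M p s f < top" using f by (simp add: lorentz_space_def)
  then obtain N where N: "lorentz_norm M p s f = ennreal N" "0 \<le> N" by (cases "lorentz_norm M p s f") auto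
  have le: "ennreal (c * t powr (1 / p)) * rearr M f t \<le> ennreal N" if "0 < t" for t
    using c(2)[of t "rearr M f"] that unfolding N(1)[symmetric] lorentz_norm_eq by (simp add: rearr_antimono)
  show fin: "rearr M f t < \<infinity>" if "0 < t" for t
  proof -
    have "rearr M f t \<noteq> top"
    proof
      assume "rearr M f t = top"
      then show False using le[OF that] that c(1) by (simp add: ennreal_mult_top top_unique)
    qed
    then show ?thesis by (simp add: less_top)
  qed
  show "emeasure M {x\<in>space M. y < \<bar>f x\<bar>} < \<infinity>" if y: "0 < y"
  proof -
    \<comment> \<open>Chosen so that \<open>N \<le> c * t powr (1 / p) * y\<close>; the lower bound
      then forces the rearrangement at \<open>t\<close> to be at most \<open>y\<close>. The summand
      1 keeps \<open>t\<close> positive if \<open>N = 0\<close>.\<close>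
    define t where "t = (N / (c * y)) powr p + 1"
    have t: "0 < t" by (simp add: t_def add_nonneg_pos)
    obtain z where z: "rearr M f t = ennreal z" "0 \<le> z" using fin[OF t] by (cases "rearr M f t") auto
    have "N / (c * y) = ((N / (c * y)) powr p) powr (1 / p)" using p N c y by (simp add: powr_powr)
    also have "\<dots> \<le> t powr (1 / p)" unfolding t_def using p by (intro powr_mono2) auto
    finally have 1: "N \<le> c * t powr (1 / p) * y" using c y by (simp add: field_simps)
    have "c * t powr (1 / p) * z \<le> N" using le[OF t] z N c by (simp add: ennreal_mult[symmetric])
    with 1 have "c * t powr (1 / p) * z \<le> c * t powr (1 / p) * y" by linarith
    then have "z \<le> y" using c t by simp
    then have "rearr M f t \<le> ennreal y" unfolding z(1) by (rule ennreal_leI)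
    then have "emeasure M {x\<in>space M. ennreal y < ennreal \<bar>f x\<bar>} \<le> ennreal t" by (simp add: rearr_le_iff)
    also have "{x\<in>space M. ennreal y < ennreal \<bar>f x\<bar>} = {x\<in>space M. y < \<bar>f x\<bar>}"
      using y by (simp add: ennreal_less_iff)
    finally show ?thesis by (auto intro: le_less_trans)
  qed
qed

lemma lorentz_space_rearr_real:
  assumes f: "f \<in> lorentz_space M p s" and p: "1 < p" and s: "1 \<le> s"
  obtains F :: "real \<Rightarrow> real" where "F \<in> borel_measurable borel" "\<And>t. 0 \<le> F t"
    "\<And>t. 0 < t \<Longrightarrow> rearr M f t = ennreal (F t)" "\<And>t t'. 0 < t \<Longrightarrow> t \<le> t' \<Longrightarrow> F t' \<le> F t"
    "(\<lambda>n. F (real n)) \<longlonglongrightarrow> 0"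
proof -
  have [measurable]: "f \<in> borel_measurable M" using f by (simp add: lorentz_space_def)
  define F where "F t = enn2real (rearr M f t)" for t
  have F: "rearr M f t = ennreal (F t)" if "0 < t" for t
    using lorentz_space_rearr_finite(1)[OF f p s that] by (simp add: F_def)
  have F0: "0 \<le> F t" for t by (simp add: F_def)
  have anti: "F t' \<le> F t" if "0 < t" "t \<le> t'" for t t'
    unfolding F_def using lorentz_space_rearr_finite(1)[OF f p s that(1)] that(2)
    by (intro enn2real_mono rearr_antimono) auto
  have "(\<lambda>n. F (real n)) \<longlonglongrightarrow> 0"
  proof (rule LIMSEQ_I)
    fix e :: real assume e: "0 < e"
    have "emeasure M {x\<in>space M. e / 2 < \<bar>f x\<bar>} < top"
      using lorentz_space_rearr_finite(2)[OF f p s, of "e / 2"] e by simp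
    then obtain N where N: "emeasure M {x\<in>space M. e / 2 < \<bar>f x\<bar>} < of_nat N"
      using ennreal_Ex_less_of_nat by blast
    have "norm (F (real n) - 0) < e" if n: "N + 1 \<le> n" for n
    proof -
      have "emeasure M {x\<in>space M. ennreal (e / 2) < ennreal \<bar>f x\<bar>} = emeasure M {x\<in>space M. e / 2 < \<bar>f x\<bar>}"
        using e by (intro arg_cong2[where f = emeasure]) (auto simp: ennreal_less_iff)
      also have "\<dots> \<le> of_nat N" using N by simp
      also have "\<dots> = ennreal (real N)" by (simp add: ennreal_of_nat_eq_real_of_nat)
      also have "\<dots> \<le> ennreal (real n)" using n by (intro ennreal_leI) simp
      finally have "rearr M f (real n) \<le> ennreal (e / 2)" by (simp add: rearr_le_iff)
      then have "F (real n) \<le> e / 2" using F[of "real n"] n e F0 by simp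
      then show ?thesis using e F0[of "real n"] by simp
    qed
    then show "\<exists>no. \<forall>n\<ge>no. norm (F (real n) - 0) < e" by blast
  qed
  moreover have "F \<in> borel_measurable borel" unfolding F_def[abs_def] by measurable
  ultimately show ?thesis using that[of F] F F0 anti by blast
qed

lemma powr_mult_self:
  fixes x :: real
  assumes "0 \<le> x" shows "x * x powr (a - 1) = x powr a"
  using assms powr_add[of x 1 "a - 1"] by (cases "x = 0") auto

lemma lorentz_space_Ryff:
  assumes M: "sigma_finite_measure M" and na: "nonatomic M" and p: "1 < p" and s: "1 \<le> s"
    and f: "f \<in> lorentz_space M p s"
  obtains \<tau> where "\<tau> \<in> borel_measurable M" "\<And>x. 0 \<le> \<tau> x"
    "\<And>x. x \<in> space M \<Longrightarrow> f x \<noteq> 0 \<Longrightarrow> rearr M f (\<tau> x) \<le> ennreal \<bar>f x\<bar>"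
    "\<And>x t. x \<in> space M \<Longrightarrow> f x \<noteq> 0 \<Longrightarrow> 0 \<le> t \<Longrightarrow> t < \<tau> x \<Longrightarrow> ennreal \<bar>f x\<bar> \<le> rearr M f t"
    "\<And>t. 0 \<le> t \<Longrightarrow> emeasure M {x\<in>space M. f x \<noteq> 0 \<and> \<tau> x < t} = min (ennreal t) (emeasure M {x\<in>space M. f x \<noteq> 0})"
proof (rule nonatomic_Ryff[OF M na])
  show "f \<in> borel_measurable M" using f by (simp add: lorentz_space_def)
qed (rule lorentz_space_rearr_finite(2)[OF f p s], assumption, rule that)

text \<open>The sign of \<open>f\<close> is moved into the test function, which is then scaled to
  norm 1. Hoelder's inequality has two roles: it makes the product integrable, so that the Bochner
  integral in the dual norm is the true one, and it forces the integral to be 0 if \<open>g\<close>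
  has norm 0 and cannot be scaled.\<close>

lemma nn_integral_le_dual_norm:
  assumes M: "sigma_finite_measure M" and p: "1 < p" and s: "1 \<le> s"
    and f: "f \<in> lorentz_space M p s"
    and [measurable]: "g \<in> borel_measurable M" and g0: "\<And>x. 0 \<le> g x"
    and fin: "lorentz_norm M (p / (p - 1)) (conj_exp s) g < \<infinity>"
  shows "(\<integral>\<^sup>+x. ennreal \<bar>f x\<bar> * ennreal (g x) \<partial>M)
    \<le> lorentz_dual_norm M p s f * lorentz_norm M (p / (p - 1)) (conj_exp s) g"
proof -
  have [measurable]: "f \<in> borel_measurable M" using f by (simp add: lorentz_space_def)
  let ?nrm = "lorentz_norm M (p / (p - 1)) (conj_exp s)"
  let ?I = "\<integral>\<^sup>+x. ennreal \<bar>f x\<bar> * ennreal (g x) \<partial>M"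
  obtain n where n: "?nrm g = ennreal n" "0 \<le> n" using fin by (cases "?nrm g") auto
  obtain F where F: "lorentz_norm M p s f = ennreal F" "0 \<le> F"
    using f by (cases "lorentz_norm M p s f") (auto simp: lorentz_space_def)
  have bound: "ennreal c * ?I \<le> ennreal F" if c: "0 < c" "c * n \<le> 1" for c
  proof -
    have "?nrm (\<lambda>x. c * g x) = ennreal (c * n)"
      using c n one_le_conj_exp[OF s] by (subst lorentz_norm_cmult) (auto simp: ennreal_mult)
    then have "?nrm (\<lambda>x. c * g x) \<le> 1" using c(2) by (simp add: ennreal_le_1)
    then have "(\<integral>\<^sup>+x. ennreal \<bar>f x\<bar> * ennreal \<bar>c * g x\<bar> \<partial>M) \<le> ennreal F"
      unfolding F(1)[symmetric] by (intro lorentz_Hoelder M p s) auto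
    also have "(\<integral>\<^sup>+x. ennreal \<bar>f x\<bar> * ennreal \<bar>c * g x\<bar> \<partial>M) = (\<integral>\<^sup>+x. ennreal c * (ennreal \<bar>f x\<bar> * ennreal (g x)) \<partial>M)"
      using g0 c by (intro nn_integral_cong) (simp add: abs_mult ennreal_mult mult_ac)
    also have "\<dots> = ennreal c * ?I" by (rule nn_integral_cmult) measurable
    finally show ?thesis .
  qed
  show ?thesis
  proof (cases "n = 0")
    case True
    have "?I = 0"
    proof (cases ?I)
      case top
      then show ?thesis using bound[of 1] True by (simp add: top_unique)
    next
      case (real i)
      show ?thesis
      proof (rule ccontr)
        assume "?I \<noteq> 0"
        with real have i: "0 < i" by (cases "i = 0") auto
        have "ennreal ((F / i + 1) * i) \<le> ennreal F"
          using bound[of "F / i + 1"] True real i F by (simp add: ennreal_mult add_nonneg_pos)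
        then have "(F / i + 1) * i \<le> F" using F by simp
        moreover have "(F / i + 1) * i = F + i" using i by (simp add: field_simps)
        ultimately show False using i by simp
      qed
    qed
    then show ?thesis by simp
  next
    case False
    with n have n0: "0 < n" by simp
    define g1 where "g1 x = (if f x < 0 then - 1 else 1) * ((1 / n) * g x)" for x
    have [measurable]: "g1 \<in> borel_measurable M" unfolding g1_def by measurable
    have abs_g1: "\<bar>g1 x\<bar> = \<bar>(1 / n) * g x\<bar>" for x by (simp add: g1_def abs_mult)
    have "?nrm g1 = ?nrm (\<lambda>x. (1 / n) * g x)"
      unfolding lorentz_norm_eq rearr_def abs_g1 ..
    also have "\<dots> = ennreal (1 / n) * ennreal n"
      using n0 n one_le_conj_exp[OF s] by (subst lorentz_norm_cmult) auto
    also have "\<dots> = 1" using n0 by (simp add: ennreal_mult[symmetric])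
    finally have nrm: "?nrm g1 = 1" .
    have fg1: "f x * g1 x = (1 / n) * (\<bar>f x\<bar> * g x)" for x by (simp add: g1_def)
    have nn: "(\<integral>\<^sup>+x. ennreal (f x * g1 x) \<partial>M) = ennreal (1 / n) * ?I"
      unfolding fg1 using n0 g0 by (subst nn_integral_cmult[symmetric]) (auto intro!: nn_integral_cong simp: ennreal_mult[symmetric])
    have "integrable M (\<lambda>x. f x * g1 x)"
    proof (rule integrableI_nonneg)
      show "(\<integral>\<^sup>+x. ennreal (f x * g1 x) \<partial>M) < \<infinity>"
        unfolding nn using bound[of "1 / n"] n0 by (auto intro: le_less_trans)
    qed (use n0 g0 in \<open>auto simp: fg1\<close>)
    then have "ennreal (\<integral>x. f x * g1 x \<partial>M) = ennreal (1 / n) * ?I"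
      unfolding nn[symmetric] using n0 g0 by (intro nn_integral_eq_integral[symmetric]) (auto simp: fg1)
    moreover have "ennreal (\<integral>x. f x * g1 x \<partial>M) \<le> lorentz_dual_norm M p s f"
      unfolding lorentz_dual_norm_def Let_def
      by (rule SUP_upper) (simp add: nrm lorentz_space_def)
    ultimately have "ennreal n * (ennreal (1 / n) * ?I) \<le> ennreal n * lorentz_dual_norm M p s f"
      by (intro mult_left_mono) auto
    moreover have "ennreal n * (ennreal (1 / n) * ?I) = ?I"
      using n0 by (simp add: mult.assoc[symmetric] ennreal_mult[symmetric])
    ultimately show ?thesis by (simp add: n mult.commute)
  qed
qed

text \<open>The test function is \<open>G\<close> composed with Ryff's map. Monotonicity of
  \<open>G\<close> makes its rearrangement at most \<open>G\<close>, and the rearrangement of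
  \<open>f\<close> at \<open>\<tau> x\<close> is at most \<open>\<bar>f x\<bar>\<close>.\<close>

lemma nn_integral_rearr_le_dual_norm:
  assumes M: "sigma_finite_measure M" and na: "nonatomic M" and p: "1 < p" and s: "1 \<le> s"
    and f: "f \<in> lorentz_space M p s"
    and [measurable]: "G \<in> borel_measurable borel"
    and G0: "\<And>t. 0 < t \<Longrightarrow> 0 \<le> G t" and anti: "\<And>t t'. 0 < t \<Longrightarrow> t \<le> t' \<Longrightarrow> G t' \<le> G t"
    and fin: "lorentz_fun (p / (p - 1)) (conj_exp s) (\<lambda>t. ennreal (G t)) < \<infinity>"
  shows "(\<integral>\<^sup>+t\<in>{0<..}. rearr M f t * ennreal (G t) \<partial>lborel)
    \<le> lorentz_dual_norm M p s f * lorentz_fun (p / (p - 1)) (conj_exp s) (\<lambda>t. ennreal (G t))"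
proof -
  have [measurable]: "f \<in> borel_measurable M" using f by (simp add: lorentz_space_def)
  obtain \<tau> where \<tau>: "\<tau> \<in> borel_measurable M" "\<And>x. 0 \<le> \<tau> x"
    "\<And>x. x \<in> space M \<Longrightarrow> f x \<noteq> 0 \<Longrightarrow> rearr M f (\<tau> x) \<le> ennreal \<bar>f x\<bar>"
    "\<And>x t. x \<in> space M \<Longrightarrow> f x \<noteq> 0 \<Longrightarrow> 0 \<le> t \<Longrightarrow> t < \<tau> x \<Longrightarrow> ennreal \<bar>f x\<bar> \<le> rearr M f t"
    "\<And>t. 0 \<le> t \<Longrightarrow> emeasure M {x\<in>space M. f x \<noteq> 0 \<and> \<tau> x < t} = min (ennreal t) (emeasure M {x\<in>space M. f x \<noteq> 0})"
    by (rule lorentz_space_Ryff[OF M na p s f]) (rule that)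
  note [measurable] = \<tau>(1)
  define Z where "Z = {x\<in>space M. f x \<noteq> 0}"
  have [measurable]: "Z \<in> sets M" unfolding Z_def by measurable
  \<comment> \<open>\<open>G\<close> is controlled only at positive arguments, hence the value 0
    where \<open>\<tau> x = 0\<close>.\<close>
  define g where "g x = (if f x \<noteq> 0 \<and> 0 < \<tau> x then G (\<tau> x) else 0)" for x
  have [measurable]: "g \<in> borel_measurable M" unfolding g_def by measurable
  have g0: "0 \<le> g x" for x using G0 by (simp add: g_def)
  have rg: "rearr M g t \<le> ennreal (G t)" if t: "0 < t" for t
  proof -
    have "{x\<in>space M. ennreal (G t) < ennreal \<bar>g x\<bar>} \<subseteq> {x\<in>space M. f x \<noteq> 0 \<and> \<tau> x < t}"
    proof
      fix x assume x: "x \<in> {x\<in>space M. ennreal (G t) < ennreal \<bar>g x\<bar>}"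
      then have less: "G t < g x" using G0[OF t] g0[of x] by (simp add: ennreal_less_iff)
      then have "g x \<noteq> 0" using G0[OF t] by auto
      then have x': "f x \<noteq> 0" "0 < \<tau> x" "g x = G (\<tau> x)" by (auto simp: g_def split: if_splits)
      then have "\<not> t \<le> \<tau> x" using less anti[OF t, of "\<tau> x"] by auto
      with x x' show "x \<in> {x\<in>space M. f x \<noteq> 0 \<and> \<tau> x < t}" by auto
    qed
    then have "emeasure M {x\<in>space M. ennreal (G t) < ennreal \<bar>g x\<bar>} \<le> emeasure M {x\<in>space M. f x \<noteq> 0 \<and> \<tau> x < t}"
      by (rule emeasure_mono) measurable
    also have "\<dots> \<le> ennreal t" using \<tau>(5)[of t] t by simp
    finally show ?thesis by (simp add: rearr_le_iff)
  qed
  have nrm: "lorentz_norm M (p / (p - 1)) (conj_exp s) g \<le> lorentz_fun (p / (p - 1)) (conj_exp s) (\<lambda>t. ennreal (G t))"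
    unfolding lorentz_norm_eq by (intro lorentz_fun_mono rg)
  define K where "K t = rearr M f t * ennreal (if 0 < t then G t else 0)" for t
  have [measurable]: "K \<in> borel_measurable borel" unfolding K_def by measurable
  have r0: "rearr M f t = 0" if "emeasure M Z \<le> ennreal t" for t
  proof -
    have "{x\<in>space M. 0 < ennreal \<bar>f x\<bar>} = Z" by (auto simp: Z_def)
    then have "rearr M f t \<le> 0"
      using that by (subst rearr_le_iff) simp_all
    then show ?thesis by simp
  qed
  have "(\<integral>\<^sup>+t\<in>{0<..}. rearr M f t * ennreal (G t) \<partial>lborel) = (\<integral>\<^sup>+t\<in>{t. 0 < t \<and> ennreal t < emeasure M Z}. K t \<partial>lborel)"
  proof (rule nn_integral_cong)
    fix t :: real
    show "rearr M f t * ennreal (G t) * indicator {0<..} t = K t * indicator {t. 0 < t \<and> ennreal t < emeasure M Z} t"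
    proof (cases "0 < t \<and> ennreal t < emeasure M Z")
      case False
      then consider "\<not> 0 < t" | "emeasure M Z \<le> ennreal t" using not_less by blast
      then show ?thesis
      proof cases
        case 2
        then show ?thesis unfolding K_def r0[OF 2] by simp
      qed simp
    qed (simp add: K_def)
  qed
  also have "\<dots> = (\<integral>\<^sup>+x\<in>Z. K (\<tau> x) \<partial>M)"
  proof (rule nn_integral_Ryff[symmetric])
    fix t :: real assume "0 \<le> t"
    have "{x\<in>Z. \<tau> x < t} = {x\<in>space M. f x \<noteq> 0 \<and> \<tau> x < t}" by (auto simp: Z_def)
    then show "emeasure M {x\<in>Z. \<tau> x < t} = min (ennreal t) (emeasure M Z)"
      using \<tau>(5)[OF \<open>0 \<le> t\<close>] by (simp add: Z_def)
  qed (use \<tau>(2) in measurable)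
  also have "\<dots> \<le> (\<integral>\<^sup>+x. ennreal \<bar>f x\<bar> * ennreal (g x) \<partial>M)"
    using \<tau>(3) by (intro nn_integral_mono) (auto simp: K_def g_def Z_def indicator_def intro!: mult_right_mono)
  also have "\<dots> \<le> lorentz_dual_norm M p s f * lorentz_norm M (p / (p - 1)) (conj_exp s) g"
    using nrm fin by (intro nn_integral_le_dual_norm M p s f g0) (auto intro: le_less_trans)
  also have "\<dots> \<le> lorentz_dual_norm M p s f * lorentz_fun (p / (p - 1)) (conj_exp s) (\<lambda>t. ennreal (G t))"
    by (intro mult_left_mono nrm) simp
  finally show ?thesis .
qed

section \<open>The range s at most p: Hoelder's extremal function\<close>

text \<open>The exponents \<open>1 / r\<close> and \<open>(r - 1) / r\<close> add up to 1, so one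
  power of \<open>X\<close> cancels; finiteness of \<open>X\<close> justifies the
  cancellation.\<close>

lemma ennreal_powr_conj_cancel:
  assumes r: "1 < r" and X: "X < \<infinity>" and le: "X \<le> D * ennreal_powr X (1 / (r / (r - 1)))"
  shows "ennreal_powr X (1 / r) \<le> D"
proof (cases D)
  case (real d)
  obtain x where x: "X = ennreal x" "0 \<le> x" using X by (cases X) auto
  show ?thesis
  proof (cases "x = 0")
    case False
    with x have x0: "0 < x" by simp
    have "x \<le> d * x powr ((r - 1) / r)"
      using le x real by (simp add: ennreal_powr_ennreal ennreal_mult[symmetric])
    moreover have "x = x powr (1 / r) * x powr ((r - 1) / r)"
      using x0 r by (simp add: powr_add[symmetric] add_divide_distrib[symmetric])
    ultimately have "x powr (1 / r) * x powr ((r - 1) / r) \<le> d * x powr ((r - 1) / r)" by simp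
    then have "x powr (1 / r) \<le> d" using x0 by simp
    then show ?thesis using x real by (simp add: ennreal_powr_ennreal ennreal_leI)
  qed (simp add: x)
qed simp

lemma conj_exponent_identities:
  fixes p r :: real
  assumes "1 < p" "1 < r"
  shows "(r / (r - 1)) / (p / (p - 1)) - 1 + (r / p - 1) * (r / (r - 1)) = r / p - 1"
    "(r - 1) * (r / (r - 1)) = r"
proof -
  define k where "k = r / (r - 1)"
  have k: "k * (r - 1) = r" using assms by (simp add: k_def)
  have "k / (p / (p - 1)) = k * (1 - 1 / p)" using assms by (simp add: field_simps)
  then have "k / (p / (p - 1)) - 1 + (r / p - 1) * k = (k * (r - 1)) / p - 1"
    using assms by (simp add: field_simps)
  then show "(r / (r - 1)) / (p / (p - 1)) - 1 + (r / p - 1) * (r / (r - 1)) = r / p - 1"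
    unfolding k unfolding k_def .
qed (use assms in simp)

text \<open>\<open>G\<close> is extremal in Hoelder's inequality: its product with \<open>F\<close>
  integrates to \<open>X\<close>, the r-th power of the norm, and for \<open>r > 1\<close> its own
  dual norm is \<open>X powr (1 - 1 / r)\<close>. The bound \<open>r \<le> p\<close> makes the power
  of \<open>t\<close> in \<open>G\<close> nonincreasing.\<close>

lemma lorentz_norm_le_dual_norm:
  assumes M: "sigma_finite_measure M" and na: "nonatomic M" and p: "1 < p"
    and r: "1 \<le> r" "r \<le> p" and f: "f \<in> lorentz_space M p (ennreal r)"
  shows "lorentz_norm M p (ennreal r) f \<le> lorentz_dual_norm M p (ennreal r) f"
proof -
  have s: "1 \<le> ennreal r" using r by (simp add: ennreal_ge_1)
  have [measurable]: "f \<in> borel_measurable M" using f by (simp add: lorentz_space_def)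
  obtain F :: "real \<Rightarrow> real" where F_meas: "F \<in> borel_measurable borel" and F0: "\<And>t. 0 \<le> F t"
    and F: "\<And>t. 0 < t \<Longrightarrow> rearr M f t = ennreal (F t)"
    and F_anti: "\<And>t t'. 0 < t \<Longrightarrow> t \<le> t' \<Longrightarrow> F t' \<le> F t"
    and "(\<lambda>n. F (real n)) \<longlonglongrightarrow> 0"
    by (rule lorentz_space_rearr_real[OF f p s]) (rule that)
  note [measurable] = F_meas
  define G where "G t = t powr (r / p - 1) * F t powr (r - 1)" for t
  have [measurable]: "G \<in> borel_measurable borel" unfolding G_def by measurable
  have G0: "0 \<le> G t" for t by (simp add: G_def)
  have G_anti: "G t' \<le> G t" if "0 < t" "t \<le> t'" for t t'
    unfolding G_def using that r p F0 F_anti[OF that]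
    by (intro mult_mono powr_mono2 powr_mono2') auto
  define X where "X = (\<integral>\<^sup>+t\<in>{0<..}. ennreal (t powr (r / p - 1) * F t powr r) \<partial>lborel)"
  have nrm: "lorentz_norm M p (ennreal r) f = ennreal_powr X (1 / r)"
    unfolding lorentz_norm_eq lorentz_fun_real[OF r(1)] X_def using F0 F
    by (intro arg_cong2[where f = ennreal_powr] nn_integral_cong)
      (auto simp: indicator_def ennreal_powr_ennreal ennreal_mult)
  then have "ennreal_powr X (1 / r) < \<infinity>" using f by (simp add: lorentz_space_def)
  then have X: "X < \<infinity>" by (auto simp: less_top[symmetric])
  have "rearr M f t * ennreal (G t) = ennreal (t powr (r / p - 1) * F t powr r)" if "0 < t" for t
    using F[OF that] F0 G0 by (simp add: ennreal_mult[symmetric] G_def powr_mult_self[OF F0, of _ r, symmetric] mult_ac)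
  then have XI: "(\<integral>\<^sup>+t\<in>{0<..}. rearr M f t * ennreal (G t) \<partial>lborel) = X"
    unfolding X_def by (intro nn_integral_cong) (auto simp: indicator_def)
  note test = nn_integral_rearr_le_dual_norm[OF M na p s f, of G, unfolded XI]
  show ?thesis
  proof (cases "r = 1")
    case True
    \<comment> \<open>For \<open>r = 1\<close> the second factor of \<open>G\<close> is 1 where
      \<open>F t\<close> is positive, and 0 where \<open>F t = 0\<close> because
      \<open>0 powr 0 = 0\<close>; the bound holds in both cases.\<close>
    have "ennreal (t powr (1 / (p / (p - 1)))) * ennreal (G t) \<le> 1" if t: "0 < t" for t
    proof -
      have "1 / (p / (p - 1)) + (1 / p - 1) = 0" using p by (simp add: field_simps)
      then have "t powr (1 / (p / (p - 1))) * t powr (1 / p - 1) = 1"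
        using t by (simp only: powr_add[symmetric]) simp
      then have "t powr (1 / (p / (p - 1))) * G t \<le> 1"
        using True by (auto simp: G_def)
      then show ?thesis using G0 by (simp add: ennreal_mult[symmetric] ennreal_le_1)
    qed
    then have le1: "lorentz_fun (p / (p - 1)) (conj_exp (ennreal r)) (\<lambda>t. ennreal (G t)) \<le> 1"
      using True by (auto simp: conj_exp_1 lorentz_fun_top[simplified] intro!: SUP_least)
    have "X \<le> lorentz_dual_norm M p (ennreal r) f * lorentz_fun (p / (p - 1)) (conj_exp (ennreal r)) (\<lambda>t. ennreal (G t))"
      using le1 by (intro test G0 G_anti) (auto intro: le_less_trans)
    also have "\<dots> \<le> lorentz_dual_norm M p (ennreal r) f * 1" by (intro mult_left_mono le1) simp
    finally show ?thesis using nrm True by simp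
  next
    case False
    with r have r1: "1 < r" by simp
    let ?q = "r / (r - 1)"
    have q: "1 \<le> ?q" using r1 by (simp add: field_simps)
    have "t powr (?q / (p / (p - 1)) - 1) * G t powr ?q = t powr (r / p - 1) * F t powr r" if "0 < t" for t
    proof -
      have "t powr (?q / (p / (p - 1)) - 1) * G t powr ?q
        = (t powr (?q / (p / (p - 1)) - 1) * t powr ((r / p - 1) * ?q)) * F t powr ((r - 1) * ?q)"
        using F0 by (simp add: G_def powr_mult powr_powr)
      then show ?thesis
        unfolding powr_add[symmetric] conj_exponent_identities[OF p r1] .
    qed
    then have nG: "lorentz_fun (p / (p - 1)) (conj_exp (ennreal r)) (\<lambda>t. ennreal (G t)) = ennreal_powr X (1 / ?q)"
      unfolding conj_exp_ennreal[OF r1] lorentz_fun_real[OF q] X_def using G0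
      by (intro arg_cong2[where f = ennreal_powr] nn_integral_cong)
        (auto simp: indicator_def ennreal_powr_ennreal ennreal_mult[symmetric])
    have "X \<le> lorentz_dual_norm M p (ennreal r) f * ennreal_powr X (1 / ?q)"
      unfolding nG[symmetric]
    proof (intro test G0 G_anti)
      show "lorentz_fun (p / (p - 1)) (conj_exp (ennreal r)) (\<lambda>t. ennreal (G t)) < \<infinity>"
        unfolding nG using X by (auto simp: ennreal_powr_def)
    qed auto
    then show ?thesis unfolding nrm by (rule ennreal_powr_conj_cancel[OF r1 X])
  qed
qed

section \<open>Level functions and majorization of finite sequences\<close>

lemma sum_lessThan_add:
  fixes g :: "nat \<Rightarrow> 'a::comm_monoid_add"
  shows "(\<Sum>i<m + k. g i) = (\<Sum>i<m. g i) + (\<Sum>i<k. g (m + i))"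
  by (induction k) (simp_all add: add.assoc)

text \<open>The last conjunct, a bound on the first slope, is only there to glue the two pieces in the induction step.\<close>

lemma ex_level_function:
  fixes a v :: "nat \<Rightarrow> real"
  assumes "\<And>i. i < n \<Longrightarrow> 0 \<le> a i" "\<And>i. i < n \<Longrightarrow> 0 < v i"
  shows "\<exists>r. (\<forall>i<n. 0 \<le> r i) \<and> (\<forall>i j. i \<le> j \<longrightarrow> j < n \<longrightarrow> r j \<le> r i)
    \<and> (\<forall>m\<le>n. (\<Sum>i<m. a i) \<le> (\<Sum>i<m. r i * v i)) \<and> (\<Sum>i<n. a i) = (\<Sum>i<n. r i * v i)
    \<and> (\<forall>m. Suc m < n \<longrightarrow> r (Suc m) < r m \<longrightarrow> (\<Sum>i<Suc m. a i) = (\<Sum>i<Suc m. r i * v i))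
    \<and> (\<forall>\<rho>. (\<forall>m\<le>n. (\<Sum>i<m. a i) \<le> \<rho> * (\<Sum>i<m. v i)) \<longrightarrow> (\<forall>i<n. r i \<le> \<rho>))"
  using assms
proof (induction n arbitrary: a v rule: less_induct)
  case (less n)
  show ?case
  proof (cases "n = 0")
    case False
    define A V where "A m = (\<Sum>i<m. a i)" and "V m = (\<Sum>i<m. v i)" for m
    have Vpos: "0 < V m" if "m \<in> {1..n}" for m
      unfolding V_def using that less.prems(2) by (intro sum_pos) (auto simp: lessThan_empty_iff)
    \<comment> \<open>The steepest chord from the origin to a point with coordinates
      \<open>V k\<close> and \<open>A k\<close> is the first edge of the least concave majorant, and
      \<open>m\<close> is its end. The other edges come from the induction hypothesis for the tail
      after \<open>m\<close>.\<close>
    have "\<exists>m\<in>{1..n}. \<forall>k\<in>{1..n}. A k / V k \<le> A m / V m"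
    proof -
      let ?F = "(\<lambda>k. A k / V k) ` {1..n}"
      have "Max ?F \<in> ?F" using False by (intro Max_in) auto
      then obtain m where "m \<in> {1..n}" "Max ?F = A m / V m" by auto
      then show ?thesis by (intro bexI[of _ m]) (auto intro!: Max_ge simp flip: \<open>Max ?F = A m / V m\<close>)
    qed
    then obtain m where m: "m \<in> {1..n}" "\<And>k. k \<in> {1..n} \<Longrightarrow> A k / V k \<le> A m / V m" by blast
    define \<rho> where "\<rho> = A m / V m"
    have \<rho>m: "A m = \<rho> * V m" using Vpos[OF m(1)] by (simp add: \<rho>_def)
    have \<rho>: "A k \<le> \<rho> * V k" if "k \<le> n" for k
    proof (cases "k = 0")
      case False
      then show ?thesis using m(2)[of k] Vpos[of k] that by (simp add: \<rho>_def divide_le_eq)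
    qed (simp add: A_def V_def)
    have \<rho>0: "0 \<le> \<rho>" unfolding \<rho>_def using Vpos[OF m(1)] less.prems(1) m(1)
      by (intro divide_nonneg_pos) (auto simp: A_def intro!: sum_nonneg)
    have "n - m < n" using m(1) by auto
    from less.IH[OF this, of "\<lambda>i. a (m + i)" "\<lambda>i. v (m + i)"] less.prems m(1)
    obtain r' where r': "\<And>i. i < n - m \<Longrightarrow> 0 \<le> r' i" "\<And>i j. i \<le> j \<Longrightarrow> j < n - m \<Longrightarrow> r' j \<le> r' i"
      "\<And>k. k \<le> n - m \<Longrightarrow> (\<Sum>i<k. a (m + i)) \<le> (\<Sum>i<k. r' i * v (m + i))"
      "(\<Sum>i<n - m. a (m + i)) = (\<Sum>i<n - m. r' i * v (m + i))"
      "\<And>k. Suc k < n - m \<Longrightarrow> r' (Suc k) < r' k \<Longrightarrow> (\<Sum>i<Suc k. a (m + i)) = (\<Sum>i<Suc k. r' i * v (m + i))"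
      "\<And>\<rho>. (\<forall>k\<le>n - m. (\<Sum>i<k. a (m + i)) \<le> \<rho> * (\<Sum>i<k. v (m + i))) \<Longrightarrow> \<forall>i<n - m. r' i \<le> \<rho>"
      by (auto simp del: sum.lessThan_Suc)
    have A_add: "A (m + k) = A m + (\<Sum>i<k. a (m + i))" and V_add: "V (m + k) = V m + (\<Sum>i<k. v (m + i))" for k
      by (simp_all add: A_def V_def sum_lessThan_add)
    \<comment> \<open>Slope \<open>\<rho>\<close> majorizes all prefixes, with equality at
      \<open>m\<close>, hence it majorizes the prefixes of the tail. The last conjunct of the
      induction hypothesis then keeps the slopes nonincreasing across \<open>m\<close>.\<close>
    have r'\<rho>: "r' i \<le> \<rho>" if "i < n - m" for i
    proof -
      have "(\<Sum>i<k. a (m + i)) \<le> \<rho> * (\<Sum>i<k. v (m + i))" if "k \<le> n - m" for k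
      proof -
        have "A (m + k) \<le> \<rho> * V (m + k)" using that m(1) by (intro \<rho>) auto
        then show ?thesis unfolding A_add V_add distrib_left \<rho>m by simp
      qed
      then show ?thesis using r'(6) that by blast
    qed
    define r where "r i = (if i < m then \<rho> else r' (i - m))" for i
    define R where "R k = (\<Sum>i<k. r i * v i)" for k
    have R1: "R k = \<rho> * V k" if "k \<le> m" for k
      using that by (auto simp: R_def V_def r_def sum_distrib_left intro!: sum.cong)
    have R2: "R (m + k) = A m + (\<Sum>i<k. r' i * v (m + i))" for k
      using R1[of m] \<rho>m by (simp add: R_def sum_lessThan_add r_def)
    have "(\<forall>i<n. 0 \<le> r i) \<and> (\<forall>i j. i \<le> j \<longrightarrow> j < n \<longrightarrow> r j \<le> r i)
      \<and> (\<forall>k\<le>n. A k \<le> R k) \<and> A n = R n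
      \<and> (\<forall>k. Suc k < n \<longrightarrow> r (Suc k) < r k \<longrightarrow> A (Suc k) = R (Suc k))
      \<and> (\<forall>\<rho>'. (\<forall>k\<le>n. A k \<le> \<rho>' * V k) \<longrightarrow> (\<forall>i<n. r i \<le> \<rho>'))"
    proof (intro conjI allI impI)
      fix i assume "i < n" then show "0 \<le> r i" using \<rho>0 r'(1) by (auto simp: r_def)
    next
      fix i j assume "i \<le> j" "j < n" then show "r j \<le> r i"
        using r'(2)[of "i - m" "j - m"] r'\<rho>[of "j - m"] by (auto simp: r_def)
    next
      fix k assume k: "k \<le> n"
      show "A k \<le> R k"
      proof (cases "k \<le> m")
        case True then show ?thesis using \<rho>[OF k] R1 by simp
      next
        case False
        then have "A (m + (k - m)) \<le> R (m + (k - m))"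
          unfolding A_add R2 using r'(3)[of "k - m"] k by simp
        then show ?thesis using False by simp
      qed
    next
      have "A (m + (n - m)) = R (m + (n - m))" unfolding A_add R2 using r'(4) by simp
      then show "A n = R n" using m(1) by simp
    next
      fix k assume k: "Suc k < n" "r (Suc k) < r k"
      consider "Suc k < m" | "Suc k = m" | "m \<le> k" by linarith
      then show "A (Suc k) = R (Suc k)"
      proof cases
        case 1 then show ?thesis using k by (simp add: r_def)
      next
        case 2 then show ?thesis using R1[of m] \<rho>m by simp
      next
        case 3
        then have "A (m + Suc (k - m)) = R (m + Suc (k - m))"
          unfolding A_add R2 using k r'(5)[of "k - m"] by (simp add: r_def Suc_diff_le)
        then show ?thesis using 3 by simp
      qed
    next
      fix \<rho>' i assume \<rho>': "\<forall>k\<le>n. A k \<le> \<rho>' * V k" and i: "i < n"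
      have "\<rho> \<le> \<rho>'" using \<rho>' m(1) Vpos[OF m(1)] by (simp add: \<rho>_def divide_le_eq)
      moreover have "r' (i - m) \<le> \<rho>" if "\<not> i < m" using that i by (intro r'\<rho>) linarith
      ultimately show "r i \<le> \<rho>'" by (simp add: r_def) linarith
    qed
    then show ?thesis unfolding A_def V_def R_def by blast
  qed simp
qed

text \<open>At a first drop after cell \<open>k\<close>, equality of the prefix sums makes
  \<open>\<alpha>\<close> equal to \<open>r 0\<close> times the mean of \<open>v\<close> over the
  cells up to \<open>k\<close>. The next prefix makes \<open>\<alpha>\<close> smaller than
  \<open>r 0 * v (Suc k)\<close>, which is at most that product because \<open>v\<close> is
  nonincreasing.\<close>

lemma level_function_constant:
  fixes a v r :: "nat \<Rightarrow> real"
  assumes L: "L \<le> n" and a: "\<And>i. i < L \<Longrightarrow> a i = \<alpha>" and r0: "\<And>i. i < n \<Longrightarrow> 0 \<le> r i"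
    and v: "\<And>i j. i \<le> j \<Longrightarrow> v j \<le> v i" "\<And>i. 0 < v i"
    and r: "\<And>i j. i \<le> j \<Longrightarrow> j < n \<Longrightarrow> r j \<le> r i"
    and le: "\<And>m. m \<le> n \<Longrightarrow> (\<Sum>i<m. a i) \<le> (\<Sum>i<m. r i * v i)"
    and eq: "\<And>m. Suc m < n \<Longrightarrow> r (Suc m) < r m \<Longrightarrow> (\<Sum>i<Suc m. a i) = (\<Sum>i<Suc m. r i * v i)"
    and i: "i < L"
  shows "r i = r 0"
  using i
proof (induction i rule: less_induct)
  case (less i)
  show ?case
  proof (cases i)
    case (Suc k)
    have k: "r j = r 0" if "j \<le> k" for j
      using that less.prems Suc by (intro less.IH) linarith+
    have kn: "Suc k < n" "Suc k < L" using less.prems L Suc by auto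
    show ?thesis
    proof (rule ccontr)
      assume "r i \<noteq> r 0"
      then have lt: "r (Suc k) < r k" using r[of k "Suc k"] kn k[of k] Suc by auto
      let ?V = "\<Sum>i<Suc k. v i"
      have rs: "(\<Sum>i<Suc k. r i * v i) = r 0 * ?V"
        unfolding sum_distrib_left
      proof (rule sum.cong)
        fix i assume "i \<in> {..<Suc k}"
        then show "r i * v i = r 0 * v i" using k[of i] by simp
      qed simp
      have as: "(\<Sum>i<Suc k. a i) = real (Suc k) * \<alpha>"
      proof -
        have "(\<Sum>i<Suc k. a i) = (\<Sum>i<Suc k. \<alpha>)"
        proof (rule sum.cong)
          fix i assume "i \<in> {..<Suc k}"
          then show "a i = \<alpha>" using kn(2) by (intro a) simp
        qed simp
        then show ?thesis by simp
      qed
      have e: "real (Suc k) * \<alpha> = r 0 * ?V" using eq[OF kn(1) lt] rs as by metis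
      have "(\<Sum>i<Suc (Suc k). a i) \<le> (\<Sum>i<Suc (Suc k). r i * v i)" using kn by (intro le) auto
      then have "\<alpha> \<le> r (Suc k) * v (Suc k)"
        using e rs as a[of "Suc k"] kn(2) unfolding sum.lessThan_Suc[of _ "Suc k"] by linarith
      also have "\<dots> < r 0 * v (Suc k)" using lt k[of k] v(2) by simp
      finally have lt2: "\<alpha> < r 0 * v (Suc k)" .
      have "real (Suc k) * v (Suc k) \<le> ?V"
        using sum_bounded_below[of "{..<Suc k}" "v (Suc k)" v] v(1) by simp
      moreover have "0 < r 0" using lt k[of k] r0[of "Suc k"] kn by simp
      ultimately have "real (Suc k) * (r 0 * v (Suc k)) \<le> r 0 * ?V" by (simp only: mult.left_commute mult_le_cancel_left_pos)
      moreover have "real (Suc k) * \<alpha> < real (Suc k) * (r 0 * v (Suc k))" using lt2 by simp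
      ultimately show False using e by linarith
    qed
  qed simp
qed

text \<open>Summation by parts: the prefix sums of \<open>b - a\<close> vanish wherever
  \<open>c\<close> changes. For \<open>c\<close> a function of the slopes, it allows a sequence to
  be exchanged with its level function in the pairing with \<open>c\<close>.\<close>

lemma sum_mult_eq_of_prefix_sums:
  fixes a b c :: "nat \<Rightarrow> real"
  assumes "\<And>m. Suc m < n \<Longrightarrow> c (Suc m) \<noteq> c m \<Longrightarrow> (\<Sum>i<Suc m. a i) = (\<Sum>i<Suc m. b i)"
    and "(\<Sum>i<n. a i) = (\<Sum>i<n. b i)"
  shows "(\<Sum>i<n. a i * c i) = (\<Sum>i<n. b i * c i)"
proof (cases n)
  case (Suc k)
  define d where "d i = b i - a i" for i
  have D: "c (Suc m) = c m \<or> (\<Sum>i<Suc m. d i) = 0" if "Suc m < n" for m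
  proof (cases "c (Suc m) = c m")
    case False
    then show ?thesis using assms(1)[OF that] by (simp add: d_def sum_subtractf del: sum.lessThan_Suc)
  qed simp
  have "(\<Sum>i<Suc m. d i * c i) = (\<Sum>i<Suc m. d i) * c m" if "m < n" for m
    using that
  proof (induction m)
    case (Suc m)
    have "(\<Sum>i<Suc (Suc m). d i * c i) = (\<Sum>i<Suc m. d i) * c m + d (Suc m) * c (Suc m)"
      using Suc by simp
    also have "(\<Sum>i<Suc m. d i) * c m = (\<Sum>i<Suc m. d i) * c (Suc m)"
      using D[of m] Suc by (auto simp del: sum.lessThan_Suc)
    finally show ?case by (simp add: algebra_simps)
  qed simp
  from this[of k] have "(\<Sum>i<n. d i * c i) = (\<Sum>i<n. d i) * c k" using Suc by simp
  also have "(\<Sum>i<n. d i) = 0" using assms(2) by (simp add: d_def sum_subtractf)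
  finally show ?thesis by (simp add: d_def left_diff_distrib sum_subtractf)
qed simp

section \<open>Rado's theorem and rounding of convex weights\<close>

text \<open>The transfers of Muirhead and Hardy-Littlewood-Polya. At the first place
  \<open>k\<close> where \<open>a\<close> exceeds \<open>b\<close>, some earlier place
  \<open>i\<close> has a surplus; moving \<open>\<delta>\<close> from \<open>i\<close> to
  \<open>k\<close> replaces \<open>b\<close> by a convex combination of \<open>b\<close> and
  \<open>b\<close> composed with a transposition. Each transfer reduces the number of places where
  the sequences differ. The conclusion is an inequality because the total sums may differ.\<close>

lemma majorized_le_convex_permutations:
  fixes a b :: "nat \<Rightarrow> real"
  assumes a: "\<And>i j. i \<le> j \<Longrightarrow> j < n \<Longrightarrow> a j \<le> a i"
    and le: "\<And>m. m \<le> n \<Longrightarrow> (\<Sum>i<m. a i) \<le> (\<Sum>i<m. b i)"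
  shows "\<exists>w. (\<forall>\<sigma>. 0 \<le> w \<sigma>) \<and> (\<Sum>\<sigma>\<in>{\<sigma>. \<sigma> permutes {..<n}}. w \<sigma>) = (1::real)
    \<and> (\<forall>i<n. a i \<le> (\<Sum>\<sigma>\<in>{\<sigma>. \<sigma> permutes {..<n}}. w \<sigma> * b (\<sigma> i)))"
  using le
proof (induction "card {i\<in>{..<n}. a i \<noteq> b i}" arbitrary: b rule: less_induct)
  case less
  let ?P = "{\<sigma>. \<sigma> permutes {..<n}}"
  have finP: "finite ?P" by (simp add: finite_permutations)
  show ?case
  proof (cases "\<forall>i<n. a i \<le> b i")
    case True
    have id: "(id :: nat \<Rightarrow> nat) \<in> ?P" by (simp add: permutes_id)
    have "(\<Sum>\<sigma>\<in>?P. (if \<sigma> = id then 1 else 0) * b (\<sigma> i)) = (\<Sum>\<sigma>\<in>?P. if \<sigma> = id then b i else 0)" for i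
      by (intro sum.cong) auto
    then show ?thesis
      using True id finP by (intro exI[of _ "\<lambda>\<sigma>. if \<sigma> = id then 1 else 0"]) (simp add: sum.delta)
  next
    case False
    define k where "k = (LEAST k. k < n \<and> b k < a k)"
    have "\<exists>k. k < n \<and> b k < a k" using False by (auto simp: not_le)
    from LeastI_ex[OF this] have k: "k < n" "b k < a k" by (auto simp: k_def)
    have below: "a j \<le> b j" if "j < k" for j
      using not_less_Least[of j "\<lambda>k. k < n \<and> b k < a k"] that k(1) by (force simp: k_def[symmetric])
    have "\<exists>i<k. a i < b i"
    proof (rule ccontr)
      assume "\<not> ?thesis"
      then have "b i \<le> a i" if "i < k" for i using that by (meson not_le)
      then have "(\<Sum>i<k. b i) \<le> (\<Sum>i<k. a i)" by (intro sum_mono) simp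
      moreover have "(\<Sum>i<Suc k. a i) \<le> (\<Sum>i<Suc k. b i)" using less.prems k(1) by (intro less.prems) simp
      ultimately show False using k(2) by simp
    qed
    then obtain i where i: "i < k" "a i < b i" by blast
    \<comment> \<open>The largest transfer that overshoots neither \<open>a i\<close> nor
      \<open>a k\<close>; at one of the two places it produces equality.\<close>
    define \<delta> where "\<delta> = min (b i - a i) (a k - b k)"
    have \<delta>: "0 < \<delta>" "\<delta> \<le> b i - a i" "\<delta> \<le> a k - b k" using i k by (auto simp: \<delta>_def)
    have aik: "a k \<le> a i" using a i k by simp
    define \<theta> where "\<theta> = \<delta> / (b i - b k)"
    have gap: "\<delta> \<le> b i - b k" "0 < b i - b k" using \<delta> aik i k by linarith+
    then have \<theta>: "0 \<le> \<theta>" "\<theta> \<le> 1" using \<delta>(1) by (auto simp: \<theta>_def)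
    have \<theta>gap: "\<theta> * (b i - b k) = \<delta>" using gap by (simp add: \<theta>_def)
    define b' where "b' j = (if j = i then b i - \<delta> else if j = k then b k + \<delta> else b j)" for j
    let ?t = "Transposition.transpose i k"
    have b'_eq: "b' j = (1 - \<theta>) * b j + \<theta> * b (?t j)" for j
    proof -
      have "b i - \<delta> = (1 - \<theta>) * b i + \<theta> * b k" "b k + \<delta> = (1 - \<theta>) * b k + \<theta> * b i"
        unfolding \<theta>gap[symmetric] by (simp_all add: algebra_simps)
      then show ?thesis using i(1) by (auto simp: b'_def transpose_def algebra_simps)
    qed
    have prefix: "(\<Sum>j<m. a j) \<le> (\<Sum>j<m. b' j)" if m: "m \<le> n" for m
    proof -
      consider "m \<le> i" | "i < m" "m \<le> k" | "k < m" by linarith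
      then show ?thesis
      proof cases
        case 1
        then have "(\<Sum>j<m. b' j) = (\<Sum>j<m. b j)" using i by (intro sum.cong) (auto simp: b'_def)
        then show ?thesis using less.prems m by simp
      next
        case 2
        show ?thesis using 2 below i \<delta> by (intro sum_mono) (auto simp: b'_def)
      next
        case 3
        have "(\<Sum>j<m. b' j) = (\<Sum>j<m. b j + ((if j = i then - \<delta> else 0) + (if j = k then \<delta> else 0)))"
          using i(1) by (intro sum.cong) (auto simp: b'_def)
        also have "\<dots> = (\<Sum>j<m. b j)"
          using 3 i(1) by (simp add: sum.distrib sum.delta)
        finally show ?thesis using less.prems m by simp
      qed
    qed
    have "{j\<in>{..<n}. a j \<noteq> b' j} \<subset> {j\<in>{..<n}. a j \<noteq> b j}"
    proof (rule psubsetI)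
      show "{j\<in>{..<n}. a j \<noteq> b' j} \<subseteq> {j\<in>{..<n}. a j \<noteq> b j}" using i k by (auto simp: b'_def)
      have "a i = b' i \<or> a k = b' k" using i(1) by (auto simp: b'_def \<delta>_def min_def)
      then show "{j\<in>{..<n}. a j \<noteq> b' j} \<noteq> {j\<in>{..<n}. a j \<noteq> b j}"
      proof
        assume "a i = b' i"
        moreover have "i \<in> {j\<in>{..<n}. a j \<noteq> b j}" using i k by auto
        ultimately show ?thesis by blast
      next
        assume "a k = b' k"
        moreover have "k \<in> {j\<in>{..<n}. a j \<noteq> b j}" using i k by auto
        ultimately show ?thesis by blast
      qed
    qed
    then have "card {j\<in>{..<n}. a j \<noteq> b' j} < card {j\<in>{..<n}. a j \<noteq> b j}"
      by (intro psubset_card_mono) auto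
    from less.hyps[OF this] prefix obtain w where w: "\<And>\<sigma>. 0 \<le> w \<sigma>" "(\<Sum>\<sigma>\<in>?P. w \<sigma>) = (1::real)"
      "\<And>i. i < n \<Longrightarrow> a i \<le> (\<Sum>\<sigma>\<in>?P. w \<sigma> * b' (\<sigma> i))" by blast
    have t: "?t permutes {..<n}" using i k by (intro permutes_swap_id) auto
    \<comment> \<open>Reindexing moves the transposition from \<open>b\<close> into the permutation,
      so the average \<open>b'\<close> leads to new weights \<open>w'\<close> for \<open>b\<close>
      itself.\<close>
    have re: "(\<Sum>\<sigma>\<in>?P. w (?t \<circ> \<sigma>) * g \<sigma>) = (\<Sum>\<sigma>\<in>?P. w \<sigma> * g (?t \<circ> \<sigma>))" for g :: "(nat \<Rightarrow> nat) \<Rightarrow> real"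
    proof -
      have "(\<Sum>\<sigma>\<in>?P. w \<sigma> * g (?t \<circ> \<sigma>)) = (\<Sum>\<sigma>\<in>?P. w (?t \<circ> \<sigma>) * g (?t \<circ> (?t \<circ> \<sigma>)))"
        by (rule setum_permutations_compose_left[OF t])
      then show ?thesis by (simp add: o_assoc)
    qed
    define w' where "w' \<sigma> = (1 - \<theta>) * w \<sigma> + \<theta> * w (?t \<circ> \<sigma>)" for \<sigma>
    have "(\<Sum>\<sigma>\<in>?P. w' \<sigma>) = (1 - \<theta>) * (\<Sum>\<sigma>\<in>?P. w \<sigma>) + \<theta> * (\<Sum>\<sigma>\<in>?P. w (?t \<circ> \<sigma>) * 1)"
      by (simp add: w'_def sum.distrib sum_distrib_left)
    also have "\<dots> = 1" unfolding re using w(2) by simp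
    finally have "(\<Sum>\<sigma>\<in>?P. w' \<sigma>) = 1" .
    moreover have "(\<Sum>\<sigma>\<in>?P. w \<sigma> * b' (\<sigma> i)) = (\<Sum>\<sigma>\<in>?P. w' \<sigma> * b (\<sigma> i))" for i
    proof -
      have "(\<Sum>\<sigma>\<in>?P. w' \<sigma> * b (\<sigma> i)) = (1 - \<theta>) * (\<Sum>\<sigma>\<in>?P. w \<sigma> * b (\<sigma> i)) + \<theta> * (\<Sum>\<sigma>\<in>?P. w (?t \<circ> \<sigma>) * b (\<sigma> i))"
        by (simp only: w'_def distrib_right sum.distrib sum_distrib_left mult.assoc)
      also have "\<dots> = (\<Sum>\<sigma>\<in>?P. w \<sigma> * b' (\<sigma> i))"
        unfolding re[of "\<lambda>\<sigma>. b (\<sigma> i)"] b'_eq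
        by (simp add: sum.distrib sum_distrib_left distrib_left mult.left_commute)
      finally show ?thesis ..
    qed
    moreover have "0 \<le> w' \<sigma>" for \<sigma> using w(1) \<theta> by (simp add: w'_def)
    ultimately show ?thesis using w(3) by (intro exI[of _ w']) simp
  qed
qed

text \<open>In a list of length \<open>Q\<close>, each \<open>x\<close> is repeated as often as the
  integer part of \<open>Q * w x\<close> tells. The rounding loses at most one copy of each
  \<open>x\<close>, at cost \<open>B\<close>. For \<open>s = \<infinity>\<close> every block has
  weights of its own, while the number and the weights of the functions must be common to all
  blocks; equal weights achieve this.\<close>

lemma convex_combination_le_uniform:
  fixes w :: "'a \<Rightarrow> real"
  assumes S: "finite S" and w: "\<And>x. x \<in> S \<Longrightarrow> 0 \<le> w x" "(\<Sum>x\<in>S. w x) = 1" and Q: "0 < (Q::nat)"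
  shows "\<exists>\<rho>. (\<forall>q<Q. \<rho> q \<in> S) \<and> (\<forall>y B. (\<forall>x\<in>S. 0 \<le> y x \<and> y x \<le> B) \<longrightarrow>
    (\<Sum>x\<in>S. w x * y x) \<le> ((\<Sum>q<Q. y (\<rho> q)) + real (card S) * B) / real Q)"
proof -
  obtain x0 where x0: "x0 \<in> S" using w(2) by (cases "S = {}") auto
  define c where "c x = nat \<lfloor>real Q * w x\<rfloor>" for x
  have c: "real (c x) \<le> real Q * w x" "real Q * w x \<le> real (c x) + 1" if "x \<in> S" for x
    using w(1)[OF that] by (auto simp: c_def of_nat_nat)
  define P where "P = (SIGMA x:S. {..<c x})"
  have finP: "finite P" using S by (simp add: P_def)
  have "real (card P) = (\<Sum>x\<in>S. real (c x))" using S by (simp add: P_def)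
  also have "\<dots> \<le> (\<Sum>x\<in>S. real Q * w x)" using c by (intro sum_mono) auto
  also have "\<dots> = real Q" using w(2) by (simp add: sum_distrib_left[symmetric])
  finally have "card P \<le> card {..<Q}" by simp
  then obtain e where e: "e ` P \<subseteq> {..<Q}" "inj_on e P"
    using card_le_inj[OF finP] by (metis finite_lessThan)
  \<comment> \<open>Places of the list left over receive an arbitrary element, which is harmless
    because \<open>y\<close> is nonnegative.\<close>
  define \<rho> where "\<rho> q = (if q \<in> e ` P then fst (inv_into P e q) else x0)" for q
  have \<rho>S: "\<rho> q \<in> S" for q
  proof (cases "q \<in> e ` P")
    case True
    then have "inv_into P e q \<in> P" by (rule inv_into_into)
    with True show ?thesis by (auto simp: \<rho>_def P_def)
  qed (simp add: \<rho>_def x0)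
  have "(\<Sum>x\<in>S. w x * y x) \<le> ((\<Sum>q<Q. y (\<rho> q)) + real (card S) * B) / real Q"
    if y: "\<forall>x\<in>S. 0 \<le> y x \<and> y x \<le> B" for y B
  proof -
    have "real Q * (\<Sum>x\<in>S. w x * y x) = (\<Sum>x\<in>S. (real Q * w x) * y x)" by (simp add: sum_distrib_left mult.assoc)
    also have "\<dots> \<le> (\<Sum>x\<in>S. (real (c x) + 1) * y x)" using y c by (intro sum_mono mult_right_mono) auto
    also have "\<dots> = (\<Sum>x\<in>S. real (c x) * y x) + (\<Sum>x\<in>S. y x)" by (simp add: sum.distrib distrib_right)
    also have "(\<Sum>x\<in>S. real (c x) * y x) = (\<Sum>x\<in>S. \<Sum>i<c x. y x)" by simp
    also have "\<dots> = (\<Sum>z\<in>P. y (fst z))" unfolding P_def using S by (subst sum.Sigma) (auto simp: case_prod_beta)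
    also have "\<dots> = (\<Sum>z\<in>P. y (\<rho> (e z)))" using e(2) by (intro sum.cong) (auto simp: \<rho>_def)
    also have "\<dots> = (\<Sum>q\<in>e ` P. y (\<rho> q))" using e(2) by (simp add: sum.reindex)
    also have "\<dots> \<le> (\<Sum>q<Q. y (\<rho> q))" using e(1) y \<rho>S by (intro sum_mono2) auto
    also have "(\<Sum>x\<in>S. y x) \<le> real (card S) * B" using sum_bounded_above[of S y B] y by simp
    finally show ?thesis using Q by (simp add: le_divide_eq mult.commute)
  qed
  with \<rho>S show ?thesis by blast
qed

section \<open>Permuting cells\<close>

lemma rearr_le_of_permuted_cells:
  fixes A :: "'i \<Rightarrow> 'a set" and J :: "'i \<Rightarrow> real set"
  assumes I: "countable I" and [measurable]: "h \<in> borel_measurable M"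
    and A: "\<And>i. i \<in> I \<Longrightarrow> A i \<in> sets M" "disjoint_family_on A I"
    and J: "\<And>i. i \<in> I \<Longrightarrow> J i \<in> sets lborel" "disjoint_family_on J I"
    and \<sigma>: "inj_on \<sigma> I" "\<sigma> ` I \<subseteq> I"
    and AJ: "\<And>i. i \<in> I \<Longrightarrow> emeasure M (A i) \<le> emeasure lborel (J (\<sigma> i))"
    and cover: "\<And>x. x \<in> space M \<Longrightarrow> h x \<noteq> 0 \<Longrightarrow> \<exists>i\<in>I. x \<in> A i \<and> \<bar>h x\<bar> \<le> b (\<sigma> i)"
    and bH: "\<And>i t. i \<in> I \<Longrightarrow> t \<in> J i \<Longrightarrow> 0 < t \<and> b i \<le> H t"
    and H: "\<And>t t'. 0 < t \<Longrightarrow> t \<le> t' \<Longrightarrow> H t' \<le> H t" "\<And>t. 0 < t \<Longrightarrow> 0 \<le> H t" and t: "0 < t"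
  shows "rearr M h t \<le> ennreal (H t)"
proof -
  define E where "E = {i\<in>I. H t < b (\<sigma> i)}"
  have E: "countable E" "E \<subseteq> I" using I by (auto simp: E_def intro: countable_subset)
  have "{x\<in>space M. ennreal (H t) < ennreal \<bar>h x\<bar>} \<subseteq> (\<Union>i\<in>E. A i)"
  proof
    fix x assume x: "x \<in> {x\<in>space M. ennreal (H t) < ennreal \<bar>h x\<bar>}"
    then have less: "H t < \<bar>h x\<bar>" using H(2)[OF t] by (simp add: ennreal_less_iff)
    then have "h x \<noteq> 0" using H(2)[OF t] by auto
    with cover x obtain i where "i \<in> I" "x \<in> A i" "\<bar>h x\<bar> \<le> b (\<sigma> i)" by blast
    with less show "x \<in> (\<Union>i\<in>E. A i)" by (auto simp: E_def)
  qed
  then have "emeasure M {x\<in>space M. ennreal (H t) < ennreal \<bar>h x\<bar>} \<le> emeasure M (\<Union>i\<in>E. A i)"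
    using A E by (intro emeasure_mono sets.countable_UN') auto
  also have "\<dots> = (\<integral>\<^sup>+i. emeasure M (A i) \<partial>count_space E)"
    using A E by (intro emeasure_UN_countable) (auto intro: disjoint_family_on_mono)
  also have "\<dots> \<le> (\<integral>\<^sup>+i. emeasure lborel (J (\<sigma> i)) \<partial>count_space E)"
    using AJ E by (intro nn_integral_mono) auto
  also have "\<dots> = emeasure lborel (\<Union>i\<in>E. J (\<sigma> i))"
  proof (rule emeasure_UN_countable[symmetric])
    show "disjoint_family_on (\<lambda>i. J (\<sigma> i)) E"
      unfolding disjoint_family_on_def
    proof (intro ballI impI)
      fix i j assume ij: "i \<in> E" "j \<in> E" "i \<noteq> j"
      then have "\<sigma> i \<in> I" "\<sigma> j \<in> I" "\<sigma> i \<noteq> \<sigma> j" using E \<sigma> by (auto dest: inj_onD)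
      then show "J (\<sigma> i) \<inter> J (\<sigma> j) = {}" using J(2) by (auto simp: disjoint_family_on_def)
    qed
  qed (use E J \<sigma> in auto)
  also have "\<dots> \<le> emeasure lborel {0<..<t}"
  proof (rule emeasure_mono)
    show "(\<Union>i\<in>E. J (\<sigma> i)) \<subseteq> {0<..<t}"
    proof
      fix z assume "z \<in> (\<Union>i\<in>E. J (\<sigma> i))"
      then obtain i where i: "i \<in> I" "H t < b (\<sigma> i)" "z \<in> J (\<sigma> i)" by (auto simp: E_def)
      then have z: "0 < z" "b (\<sigma> i) \<le> H z" using bH[of "\<sigma> i" z] \<sigma>(2) by auto
      have "\<not> t \<le> z" using H(1)[OF t, of z] z i by auto
      with z show "z \<in> {0<..<t}" by simp
    qed
  qed simp
  finally show ?thesis using t by (simp add: rearr_le_iff)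
qed

text \<open>In general only an inequality, since the interval may extend beyond the measure of the
  support of \<open>f\<close>.\<close>

lemma emeasure_Ryff_cell:
  assumes [measurable]: "\<tau> \<in> borel_measurable M" "f \<in> borel_measurable M" and \<tau>0: "\<And>x. 0 \<le> \<tau> x"
    and dist: "\<And>t. 0 \<le> t \<Longrightarrow> emeasure M {x\<in>space M. (f x::real) \<noteq> 0 \<and> \<tau> x < t} = min (ennreal t) (emeasure M {x\<in>space M. f x \<noteq> 0})"
    and ab: "a \<le> b"
  shows "emeasure M {x\<in>space M. f x \<noteq> 0 \<and> a < \<tau> x \<and> \<tau> x \<le> b} \<le> ennreal (b - a)"
proof -
  define Z where "Z = {x\<in>space M. f x \<noteq> 0}"
  have [measurable]: "Z \<in> sets M" unfolding Z_def by measurable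
  have "emeasure M {x\<in>space M. f x \<noteq> 0 \<and> a < \<tau> x \<and> \<tau> x \<le> b}
    = (\<integral>\<^sup>+x. indicator {x\<in>space M. f x \<noteq> 0 \<and> a < \<tau> x \<and> \<tau> x \<le> b} x \<partial>M)"
    by (rule nn_integral_indicator[symmetric]) measurable
  also have "\<dots> = (\<integral>\<^sup>+x\<in>Z. indicator {a<..b} (\<tau> x) \<partial>M)"
    by (intro nn_integral_cong) (auto simp: Z_def indicator_def)
  also have "\<dots> = (\<integral>\<^sup>+t\<in>{t. 0 < t \<and> ennreal t < emeasure M Z}. indicator {a<..b} t \<partial>lborel)"
  proof (rule nn_integral_Ryff)
    fix t :: real assume "0 \<le> t"
    have "{x\<in>Z. \<tau> x < t} = {x\<in>space M. f x \<noteq> 0 \<and> \<tau> x < t}" by (auto simp: Z_def)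
    then show "emeasure M {x\<in>Z. \<tau> x < t} = min (ennreal t) (emeasure M Z)"
      using dist[OF \<open>0 \<le> t\<close>] by (simp add: Z_def)
  qed (use \<tau>0 in measurable)
  also have "\<dots> \<le> (\<integral>\<^sup>+t. indicator {a<..b} t \<partial>lborel)"
    by (intro nn_integral_mono) (auto simp: indicator_def)
  also have "\<dots> = ennreal (b - a)" using ab by simp
  finally show ?thesis .
qed

lemma lorentz_decomp_le_sum3:
  assumes "f \<in> borel_measurable M" "finite I"
    and "f1 \<in> lorentz_space M p s" "f2 \<in> lorentz_space M p s"
    and h: "\<And>i. i \<in> I \<Longrightarrow> h i \<in> lorentz_space M p s"
    and le: "\<And>x. x \<in> space M \<Longrightarrow> \<bar>f x\<bar> \<le> \<bar>f1 x\<bar> + \<bar>f2 x\<bar> + (\<Sum>i\<in>I. \<bar>h i x\<bar>)"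
  shows "lorentz_decomp_norm M p s f
    \<le> lorentz_norm M p s f1 + lorentz_norm M p s f2 + (\<Sum>i\<in>I. lorentz_norm M p s (h i))"
proof -
  define k where "k j = (case j of None \<Rightarrow> f1 | Some None \<Rightarrow> f2 | Some (Some i) \<Rightarrow> h i)" for j
  let ?K = "insert None (insert (Some None) ((\<lambda>i. Some (Some i)) ` I))"
  have inj: "inj_on (\<lambda>i. Some (Some i)) I" by (auto simp: inj_on_def)
  have sum: "(\<Sum>j\<in>?K. G (k j)) = G f1 + G f2 + (\<Sum>i\<in>I. G (h i))" for G :: "('a \<Rightarrow> real) \<Rightarrow> 'z::comm_monoid_add"
    using assms(2) by (subst sum.insert, simp, force, subst sum.insert, simp, force)
      (simp add: sum.reindex[OF inj] k_def add.assoc)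
  have "lorentz_decomp_norm M p s f \<le> (\<Sum>j\<in>?K. lorentz_norm M p s (k j))"
  proof (rule lorentz_decomp_le_sum)
    show "AE x in M. \<bar>f x\<bar> \<le> (\<Sum>j\<in>?K. \<bar>k j x\<bar>)"
      using le sum[of "\<lambda>g. \<bar>g _\<bar>"] by (intro AE_I2) simp
  qed (use assms in \<open>auto simp: k_def\<close>)
  then show ?thesis unfolding sum .
qed

section \<open>Step functions on equal cells and the power weight\<close>

text \<open>The cells contain their right ends, where a nonincreasing function takes its smallest
  value on the cell. Subtracting 1 from the ceiling makes the indices start at 0.\<close>

definition cell_step :: "real \<Rightarrow> nat \<Rightarrow> (nat \<Rightarrow> real) \<Rightarrow> real \<Rightarrow> real" where
  "cell_step \<delta> n c t = (if 0 < t \<and> t \<le> real n * \<delta> then c (nat \<lceil>t / \<delta>\<rceil> - 1) else 0)"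

lemma cell_index_iff:
  assumes "0 < \<delta>"
  shows "real l * \<delta> < t \<and> t \<le> (real l + 1) * \<delta> \<longleftrightarrow> 0 < t \<and> nat \<lceil>t / \<delta>\<rceil> - 1 = l"
proof -
  have "real l * \<delta> < t \<and> t \<le> (real l + 1) * \<delta> \<longleftrightarrow> real l < t / \<delta> \<and> t / \<delta> \<le> real l + 1"
    using assms by (simp add: field_simps)
  also have "\<dots> \<longleftrightarrow> \<lceil>t / \<delta>\<rceil> = int l + 1" by (subst ceiling_eq_iff) auto
  also have "\<dots> \<longleftrightarrow> 0 < t / \<delta> \<and> nat \<lceil>t / \<delta>\<rceil> - 1 = l"
    by (auto simp: nat_eq_iff) linarith+
  also have "0 < t / \<delta> \<longleftrightarrow> 0 < t" using assms by (simp add: field_simps)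
  finally show ?thesis .
qed

lemma cell_index_less:
  assumes "0 < \<delta>" "0 < t" shows "t \<le> real n * \<delta> \<longleftrightarrow> nat \<lceil>t / \<delta>\<rceil> - 1 < n"
proof -
  have "t \<le> real n * \<delta> \<longleftrightarrow> t / \<delta> \<le> real n" using assms by (simp add: field_simps)
  also have "\<dots> \<longleftrightarrow> \<lceil>t / \<delta>\<rceil> \<le> int n" by (simp add: ceiling_le_iff)
  also have "\<dots> \<longleftrightarrow> nat \<lceil>t / \<delta>\<rceil> - 1 < n"
  proof -
    have "0 < t / \<delta>" using assms by simp
    then have "0 < \<lceil>t / \<delta>\<rceil>" by linarith
    then show ?thesis by linarith
  qed
  finally show ?thesis .
qed

lemma cell_step_eq:
  assumes "0 < \<delta>" "l < n" "real l * \<delta> < t" "t \<le> (real l + 1) * \<delta>"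
  shows "cell_step \<delta> n c t = c l"
  using cell_index_iff[OF assms(1), of l t] cell_index_less[OF assms(1), of t n] assms
  by (simp add: cell_step_def)

lemma borel_measurable_cell_step [measurable]: "cell_step \<delta> n c \<in> borel_measurable borel"
  unfolding cell_step_def[abs_def] by measurable

lemma cell_step_antimono:
  assumes \<delta>: "0 < \<delta>" and c: "\<And>i j. i \<le> j \<Longrightarrow> j < n \<Longrightarrow> c j \<le> c i" "\<And>i. i < n \<Longrightarrow> 0 \<le> c i"
    and t: "0 < t" "t \<le> t'"
  shows "cell_step \<delta> n c t' \<le> cell_step \<delta> n c t"
proof -
  have mono: "nat \<lceil>t / \<delta>\<rceil> - 1 \<le> nat \<lceil>t' / \<delta>\<rceil> - 1"
    using t \<delta> by (intro diff_le_mono nat_mono ceiling_mono divide_right_mono) auto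
  show ?thesis
    using c mono t cell_index_less[OF \<delta>, of t n] cell_index_less[OF \<delta>, of t' n]
    by (auto simp: cell_step_def)
qed

lemma cell_step_nonneg:
  assumes "0 < \<delta>" "\<And>i. i < n \<Longrightarrow> 0 \<le> c i" shows "0 \<le> cell_step \<delta> n c t"
  using assms cell_index_less[OF assms(1), of t n] by (auto simp: cell_step_def)

lemma nn_integral_cell_step:
  assumes \<delta>: "0 < \<delta>" and [measurable]: "g \<in> borel_measurable borel"
  shows "(\<integral>\<^sup>+t\<in>{0<..}. ennreal (cell_step \<delta> n c t) * g t \<partial>lborel)
    = (\<Sum>l<n. ennreal (c l) * (\<integral>\<^sup>+t\<in>{real l * \<delta><..(real l + 1) * \<delta>}. g t \<partial>lborel))"
proof -
  have "(\<integral>\<^sup>+t\<in>{0<..}. ennreal (cell_step \<delta> n c t) * g t \<partial>lborel)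
    = (\<integral>\<^sup>+t. (\<Sum>l<n. ennreal (c l) * (g t * indicator {real l * \<delta><..(real l + 1) * \<delta>} t)) \<partial>lborel)"
  proof (rule nn_integral_cong)
    fix t :: real
    define k where "k = nat \<lceil>t / \<delta>\<rceil> - 1"
    have ind: "indicator {real l * \<delta><..(real l + 1) * \<delta>} t = (if 0 < t \<and> k = l then 1 else 0 :: ennreal)" for l
      using cell_index_iff[OF \<delta>, of l t] by (auto simp: k_def indicator_def)
    show "ennreal (cell_step \<delta> n c t) * g t * indicator {0<..} t
      = (\<Sum>l<n. ennreal (c l) * (g t * indicator {real l * \<delta><..(real l + 1) * \<delta>} t))"
    proof (cases "0 < t")
      case True
      have "(\<Sum>l<n. ennreal (c l) * (g t * indicator {real l * \<delta><..(real l + 1) * \<delta>} t))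
        = (\<Sum>l<n. if k = l then ennreal (c l) * g t else 0)"
        unfolding ind using True by (intro sum.cong) auto
      also have "\<dots> = ennreal (cell_step \<delta> n c t) * g t"
        using True cell_index_less[OF \<delta> True, of n] by (simp add: cell_step_def k_def)
      finally show ?thesis using True by simp
    qed (simp add: ind)
  qed
  also have "\<dots> = (\<Sum>l<n. ennreal (c l) * (\<integral>\<^sup>+t\<in>{real l * \<delta><..(real l + 1) * \<delta>}. g t \<partial>lborel))"
    by (subst nn_integral_sum) (auto simp: nn_integral_cmult)
  finally show ?thesis .
qed

text \<open>The left side is a lower sum: by monotonicity \<open>a l\<close> bounds the
  rearrangement from below on all of cell \<open>l\<close>.\<close>

lemma sum_le_nn_integral_rearr_cell_step:
  assumes \<delta>: "0 < \<delta>" and c: "\<And>l. l < n \<Longrightarrow> 0 \<le> c l" and a0: "\<And>l. l < n \<Longrightarrow> 0 \<le> a l"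
    and a: "\<And>l. l < n \<Longrightarrow> ennreal (a l) \<le> rearr M f ((real l + 1) * \<delta>)"
  shows "ennreal (\<Sum>l<n. \<delta> * a l * c l) \<le> (\<integral>\<^sup>+t\<in>{0<..}. rearr M f t * ennreal (cell_step \<delta> n c t) \<partial>lborel)"
proof -
  have "ennreal (\<Sum>l<n. \<delta> * a l * c l) = (\<Sum>l<n. ennreal (\<delta> * a l * c l))"
    using \<delta> c a0 by (intro sum_ennreal[symmetric]) auto
  also have "\<dots> \<le> (\<Sum>l<n. ennreal (c l) * (\<integral>\<^sup>+t\<in>{real l * \<delta><..(real l + 1) * \<delta>}. rearr M f t \<partial>lborel))"
  proof (rule sum_mono)
    fix l assume "l \<in> {..<n}"
    then have l: "l < n" by simp
    have "ennreal (\<delta> * a l * c l) = ennreal (c l) * (ennreal (a l) * ennreal \<delta>)"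
      using \<delta> c[OF l] a0[OF l] by (simp add: ennreal_mult[symmetric] mult_ac)
    also have "ennreal (a l) * ennreal \<delta> = (\<integral>\<^sup>+t\<in>{real l * \<delta><..(real l + 1) * \<delta>}. ennreal (a l) \<partial>lborel)"
      using \<delta> by (subst nn_integral_cmult_indicator) (auto simp: algebra_simps)
    also have "\<dots> \<le> (\<integral>\<^sup>+t\<in>{real l * \<delta><..(real l + 1) * \<delta>}. rearr M f t \<partial>lborel)"
      using order_trans[OF a[OF l] rearr_antimono] by (intro nn_integral_mono) (auto simp: indicator_def)
    finally show "ennreal (\<delta> * a l * c l) \<le> ennreal (c l) * (\<integral>\<^sup>+t\<in>{real l * \<delta><..(real l + 1) * \<delta>}. rearr M f t \<partial>lborel)"
      by (simp add: mult_left_mono)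
  qed
  also have "\<dots> = (\<integral>\<^sup>+t\<in>{0<..}. ennreal (cell_step \<delta> n c t) * rearr M f t \<partial>lborel)"
    by (rule nn_integral_cell_step[symmetric, OF \<delta>]) simp
  finally show ?thesis by (simp add: mult.commute)
qed

lemma nn_integral_powr_Ioc:
  assumes \<alpha>: "0 < \<alpha>" and ab: "0 \<le> a" "a \<le> b"
  shows "(\<integral>\<^sup>+t\<in>{a<..b}. ennreal (t powr (\<alpha> - 1)) \<partial>lborel) = ennreal (b powr \<alpha> / \<alpha> - a powr \<alpha> / \<alpha>)"
proof -
  let ?I = "\<lambda>S::real set. \<integral>\<^sup>+t\<in>S. ennreal (t powr (\<alpha> - 1)) \<partial>lborel"
  have "?I {0<..b} = (\<integral>\<^sup>+t. ennreal (t powr (\<alpha> - 1)) * indicator {0<..a} t + ennreal (t powr (\<alpha> - 1)) * indicator {a<..b} t \<partial>lborel)"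
    using ab by (intro nn_integral_cong) (auto simp: indicator_def)
  also have "\<dots> = ?I {0<..a} + ?I {a<..b}" by (rule nn_integral_add) auto
  finally have "ennreal (b powr \<alpha> / \<alpha>) = ennreal (a powr \<alpha> / \<alpha>) + ?I {a<..b}"
    using nn_integral_powr_from_0[OF \<alpha>] ab by simp
  then have "?I {a<..b} = ennreal (b powr \<alpha> / \<alpha>) - ennreal (a powr \<alpha> / \<alpha>)"
    by (simp add: ennreal_add_diff_cancel_left)
  then show ?thesis using \<alpha> by (simp add: ennreal_minus)
qed

lemma powr_Ioc_bounds:
  fixes \<alpha> a b :: real
  assumes \<alpha>: "0 < \<alpha>" "\<alpha> \<le> 1" and ab: "0 < a" "a \<le> b"
  shows "(b - a) * b powr (\<alpha> - 1) \<le> b powr \<alpha> / \<alpha> - a powr \<alpha> / \<alpha>"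
    and "b powr \<alpha> / \<alpha> - a powr \<alpha> / \<alpha> \<le> (b - a) * a powr (\<alpha> - 1)"
proof -
  let ?I = "\<integral>\<^sup>+t\<in>{a<..b}. ennreal (t powr (\<alpha> - 1)) \<partial>lborel"
  have mono: "a powr \<alpha> / \<alpha> \<le> b powr \<alpha> / \<alpha>" using \<alpha> ab by (intro divide_right_mono powr_mono2) auto
  have const: "(\<integral>\<^sup>+t\<in>{a<..b}. ennreal c \<partial>lborel) = ennreal ((b - a) * c)" if "0 \<le> c" for c
    using that ab by (subst nn_integral_cmult_indicator) (auto simp: ennreal_mult[symmetric] mult.commute)
  have "ennreal ((b - a) * b powr (\<alpha> - 1)) \<le> ?I"
    unfolding const[OF powr_ge_zero, symmetric] using \<alpha> ab
    by (intro nn_integral_mono) (auto simp: indicator_def intro!: ennreal_leI powr_mono2')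
  then show "(b - a) * b powr (\<alpha> - 1) \<le> b powr \<alpha> / \<alpha> - a powr \<alpha> / \<alpha>"
    using mono ab \<alpha> by (simp add: nn_integral_powr_Ioc)
  have "?I \<le> ennreal ((b - a) * a powr (\<alpha> - 1))"
    unfolding const[OF powr_ge_zero, symmetric] using \<alpha> ab
    by (intro nn_integral_mono) (auto simp: indicator_def intro!: ennreal_leI powr_mono2')
  then show "b powr \<alpha> / \<alpha> - a powr \<alpha> / \<alpha> \<le> (b - a) * a powr (\<alpha> - 1)"
    using mono ab \<alpha> by (simp add: nn_integral_powr_Ioc)
qed

text \<open>The integral of the weight over a cell is compared with the cell length times the weight
  at the right end. For \<open>l \<ge> 1\<close> the ratio is at most \<open>(l + 1) / l\<close>.
  Near 0 it need not be close to 1, but summed over the first \<open>L\<close> cells the error is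
  the integral over a single cell, negligible against the total. By homogeneity \<open>L\<close>
  does not depend on \<open>\<delta>\<close>, which can therefore be chosen after
  \<open>L\<close>.\<close>

lemma ex_cell_weight_bound:
  fixes \<alpha> \<epsilon> :: real
  assumes \<alpha>: "0 < \<alpha>" "\<alpha> \<le> 1" and \<epsilon>: "0 < \<epsilon>"
  obtains L :: nat where "1 \<le> L"
    "\<And>\<delta>. 0 < \<delta> \<Longrightarrow> (\<Sum>l<L. ((real l + 1) * \<delta>) powr \<alpha> / \<alpha> - (real l * \<delta>) powr \<alpha> / \<alpha>)
      \<le> (1 + \<epsilon>) * (\<delta> * (\<Sum>l<L. ((real l + 1) * \<delta>) powr (\<alpha> - 1)))"
    "\<And>\<delta> l. 0 < \<delta> \<Longrightarrow> L \<le> l \<Longrightarrow> ((real l + 1) * \<delta>) powr \<alpha> / \<alpha> - (real l * \<delta>) powr \<alpha> / \<alpha>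
      \<le> (1 + \<epsilon>) * (\<delta> * ((real l + 1) * \<delta>) powr (\<alpha> - 1))"
proof -
  \<comment> \<open>The first entry makes \<open>1 / l \<le> \<epsilon>\<close> for
    \<open>l \<ge> L\<close>. The second gives
    \<open>1 + \<epsilon> \<le> \<epsilon> * real L powr \<alpha>\<close>, so that the first cell
    contributes only a small part of the integral over \<open>L\<close> cells.\<close>
  define L where "L = nat \<lceil>max (1 / \<epsilon>) (((1 + \<epsilon>) / \<epsilon>) powr (1 / \<alpha>))\<rceil> + 1"
  have "max (1 / \<epsilon>) (((1 + \<epsilon>) / \<epsilon>) powr (1 / \<alpha>)) \<le> real L" unfolding L_def by linarith
  then have L1: "1 / \<epsilon> \<le> real L" and L2: "((1 + \<epsilon>) / \<epsilon>) powr (1 / \<alpha>) \<le> real L" by auto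
  have L: "1 \<le> L" by (simp add: L_def)
  have "(((1 + \<epsilon>) / \<epsilon>) powr (1 / \<alpha>)) powr \<alpha> \<le> real L powr \<alpha>"
    using L2 \<alpha> by (intro powr_mono2) auto
  then have "(1 + \<epsilon>) / \<epsilon> \<le> real L powr \<alpha>" using \<alpha> \<epsilon> by (simp add: powr_powr)
  then have L\<alpha>: "1 + \<epsilon> \<le> \<epsilon> * real L powr \<alpha>" using \<epsilon> by (simp add: field_simps)
  show ?thesis
  proof (rule that[OF L])
    fix \<delta> :: real assume \<delta>: "0 < \<delta>"
    define U where "U l = (real l * \<delta>) powr \<alpha> / \<alpha>" for l
    have U_Suc: "((real l + 1) * \<delta>) powr \<alpha> / \<alpha> = U (Suc l)" for l by (simp add: U_def add.commute)
    have tel: "(\<Sum>l<L. U (Suc l) - U l) = U L"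
      unfolding sum_lessThan_telescope by (simp add: U_def)
    \<comment> \<open>The weight at the right end of a cell dominates its mean over the following
      cell, so the sum of the right-end values misses only the first cell.\<close>
    have "U L - U 1 \<le> U (Suc L) - U 1"
      unfolding U_def using \<alpha> \<delta> by (intro diff_right_mono divide_right_mono powr_mono2) auto
    also have "\<dots> = (\<Sum>l<L. U (Suc (Suc l)) - U (Suc l))"
      using sum_lessThan_telescope[of "\<lambda>l. U (Suc l)" L] by simp
    also have "\<dots> \<le> (\<Sum>l<L. \<delta> * ((real l + 1) * \<delta>) powr (\<alpha> - 1))"
    proof (rule sum_mono)
      fix l
      have "U (Suc (Suc l)) - U (Suc l) \<le> ((real l + 2) * \<delta> - (real l + 1) * \<delta>) * ((real l + 1) * \<delta>) powr (\<alpha> - 1)"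
        using powr_Ioc_bounds(2)[OF \<alpha>, of "(real l + 1) * \<delta>" "(real l + 2) * \<delta>"] \<delta>
        by (simp add: U_def add.commute add_pos_nonneg)
      also have "(real l + 2) * \<delta> - (real l + 1) * \<delta> = \<delta>" by (simp add: algebra_simps)
      finally show "U (Suc (Suc l)) - U (Suc l) \<le> \<delta> * ((real l + 1) * \<delta>) powr (\<alpha> - 1)" .
    qed
    finally have 1: "U L - U 1 \<le> \<delta> * (\<Sum>l<L. ((real l + 1) * \<delta>) powr (\<alpha> - 1))"
      by (simp add: sum_distrib_left)
    define K where "K = \<delta> powr \<alpha> / \<alpha>"
    have "U L = real L powr \<alpha> * K" "U 1 = K"
      using \<delta> by (simp_all add: U_def powr_mult K_def)
    then have "(1 + \<epsilon>) * (U L - U 1) - U L = (\<epsilon> * real L powr \<alpha> - (1 + \<epsilon>)) * K"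
      by (simp add: algebra_simps)
    moreover have "0 \<le> \<dots>" using L\<alpha> \<alpha> by (intro mult_nonneg_nonneg) (auto simp: K_def)
    ultimately have "U L \<le> (1 + \<epsilon>) * (U L - U 1)" by linarith
    also have "\<dots> \<le> (1 + \<epsilon>) * (\<delta> * (\<Sum>l<L. ((real l + 1) * \<delta>) powr (\<alpha> - 1)))"
      using \<epsilon> by (intro mult_left_mono 1) auto
    finally show "(\<Sum>l<L. ((real l + 1) * \<delta>) powr \<alpha> / \<alpha> - (real l * \<delta>) powr \<alpha> / \<alpha>)
      \<le> (1 + \<epsilon>) * (\<delta> * (\<Sum>l<L. ((real l + 1) * \<delta>) powr (\<alpha> - 1)))"
      unfolding U_Suc U_def[symmetric] tel .
  next
    fix \<delta> :: real and l :: nat assume \<delta>: "0 < \<delta>" and l: "L \<le> l"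
    then have l1: "1 \<le> real l" using L by simp
    have "((real l + 1) * \<delta>) powr \<alpha> / \<alpha> - (real l * \<delta>) powr \<alpha> / \<alpha>
      \<le> ((real l + 1) * \<delta> - real l * \<delta>) * (real l * \<delta>) powr (\<alpha> - 1)"
      using powr_Ioc_bounds(2)[OF \<alpha>, of "real l * \<delta>" "(real l + 1) * \<delta>"] \<delta> l1 by simp
    also have "(real l + 1) * \<delta> - real l * \<delta> = \<delta>" by (simp add: algebra_simps)
    also have "(real l * \<delta>) powr (\<alpha> - 1) \<le> (1 + \<epsilon>) * ((real l + 1) * \<delta>) powr (\<alpha> - 1)"
    proof -
      have "(real l + 1) / real l = 1 + 1 / real l" using l1 by (simp add: field_simps)
      moreover have "1 / real l \<le> \<epsilon>"
      proof -
        have "1 / \<epsilon> \<le> real l" using L1 l by linarith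
        then show ?thesis using \<epsilon> l1 by (simp add: field_simps)
      qed
      ultimately have x: "(real l + 1) / real l \<le> 1 + \<epsilon>" by simp
      have "((real l + 1) / real l) powr (1 - \<alpha>) \<le> ((real l + 1) / real l) powr 1"
        using \<alpha> l1 by (intro powr_mono) auto
      then have x2: "((real l + 1) / real l) powr (1 - \<alpha>) \<le> 1 + \<epsilon>" using x l1 by simp
      have "(real l * \<delta>) powr (\<alpha> - 1) = ((real l + 1) / real l) powr (1 - \<alpha>) * ((real l + 1) * \<delta>) powr (\<alpha> - 1)"
      proof -
        have "((real l + 1) / real l) powr (1 - \<alpha>) = (real l / (real l + 1)) powr (\<alpha> - 1)"
        proof -
          have "((real l + 1) / real l) powr (1 - \<alpha>) = inverse (real l / (real l + 1)) powr (- (\<alpha> - 1))" by simp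
          then show ?thesis using l1 by (simp only: powr_minus inverse_powr) simp
        qed
        then have "((real l + 1) / real l) powr (1 - \<alpha>) * ((real l + 1) * \<delta>) powr (\<alpha> - 1)
          = (real l / (real l + 1) * ((real l + 1) * \<delta>)) powr (\<alpha> - 1)"
          using l1 \<delta> by (subst powr_mult) auto
        also have "real l / (real l + 1) * ((real l + 1) * \<delta>) = real l * \<delta>" using l1 by simp
        finally show ?thesis by simp
      qed
      then show ?thesis using x2 by (simp add: mult_right_mono)
    qed
    finally show "((real l + 1) * \<delta>) powr \<alpha> / \<alpha> - (real l * \<delta>) powr \<alpha> / \<alpha>
      \<le> (1 + \<epsilon>) * (\<delta> * ((real l + 1) * \<delta>) powr (\<alpha> - 1))"
      using \<delta> by (simp add: mult.left_commute)
  qed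
qed

text \<open>Dominated convergence for the r-th powers. It serves to discard the parts of
  \<open>f\<close> where \<open>\<tau>\<close> is very small or very large, and it is the step that
  breaks down for \<open>s = \<infinity>\<close>.\<close>

lemma lorentz_fun_eventually_small:
  fixes F :: "real \<Rightarrow> real" and g :: "nat \<Rightarrow> real \<Rightarrow> real"
  assumes r: "1 \<le> r" and [measurable]: "F \<in> borel_measurable borel" "\<And>n. g n \<in> borel_measurable borel"
    and g: "\<And>n t. 0 < t \<Longrightarrow> 0 \<le> g n t" "\<And>t. 0 < t \<Longrightarrow> (\<lambda>n. g n t) \<longlonglongrightarrow> 0"
    and le: "\<And>n t. 0 < t \<Longrightarrow> g n t \<le> F t"
    and fin: "lorentz_fun p (ennreal r) (\<lambda>t. ennreal (F t)) < \<infinity>" and \<epsilon>: "0 < \<epsilon>"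
  shows "\<forall>\<^sub>F n in sequentially. lorentz_fun p (ennreal r) (\<lambda>t. ennreal (g n t)) \<le> ennreal \<epsilon>"
proof -
  define u where "u h t = ennreal (t powr (r / p - 1)) * ennreal_powr (ennreal (h t)) r * indicator {0<..} t" for h :: "real \<Rightarrow> real" and t
  have [measurable]: "u h \<in> borel_measurable borel" if [measurable]: "h \<in> borel_measurable borel" for h
    unfolding u_def[abs_def] by simp
  have nrm: "lorentz_fun p (ennreal r) (\<lambda>t. ennreal (h t)) = ennreal_powr (\<integral>\<^sup>+t. u h t \<partial>lborel) (1 / r)" for h
    unfolding lorentz_fun_real[OF r] u_def ..
  have "(\<lambda>n. \<integral>\<^sup>+t. u (g n) t \<partial>lborel) \<longlonglongrightarrow> (\<integral>\<^sup>+t. 0 \<partial>(lborel :: real measure))"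
  proof (rule nn_integral_dominated_convergence[where w = "u F"])
    show "(\<integral>\<^sup>+t. u F t \<partial>lborel) < \<infinity>"
      using fin unfolding nrm by (auto simp: less_top[symmetric])
    show "AE t in lborel. u (g n) t \<le> u F t" for n
      unfolding u_def using le r by (intro AE_I2) (auto simp: indicator_def intro!: mult_left_mono ennreal_powr_mono ennreal_leI)
    have "(\<lambda>n. u (g n) t) \<longlonglongrightarrow> 0" for t
    proof (cases "0 < t")
      case True
      have "(\<lambda>n. g n t powr r) \<longlonglongrightarrow> 0"
        using r g True by (intro tendsto_zero_powrI[where b = r] tendsto_const) auto
      then have "(\<lambda>n. ennreal (t powr (r / p - 1) * g n t powr r)) \<longlonglongrightarrow> ennreal (t powr (r / p - 1) * 0)"
        by (intro tendsto_ennrealI tendsto_mult tendsto_const)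
      then show ?thesis using True g(1)[OF True]
        by (simp add: u_def ennreal_powr_ennreal ennreal_mult[symmetric])
    qed (simp add: u_def)
    then show "AE t in lborel. (\<lambda>n. u (g n) t) \<longlonglongrightarrow> 0" by simp
  qed auto
  then have "(\<lambda>n. \<integral>\<^sup>+t. u (g n) t \<partial>lborel) \<longlonglongrightarrow> 0" by simp
  then have "\<forall>\<^sub>F n in sequentially. (\<integral>\<^sup>+t. u (g n) t \<partial>lborel) < ennreal (\<epsilon> powr r)"
    by (rule order_tendstoD(2)) (use \<epsilon> in simp)
  then show ?thesis
  proof eventually_elim
    case (elim n)
    have "ennreal_powr (\<integral>\<^sup>+t. u (g n) t \<partial>lborel) (1 / r) \<le> ennreal_powr (ennreal (\<epsilon> powr r)) (1 / r)"
      using elim r by (intro ennreal_powr_mono) auto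
    also have "\<dots> = ennreal \<epsilon>" using \<epsilon> r by (simp add: ennreal_powr_ennreal powr_powr)
    finally show ?case unfolding nrm .
  qed
qed

lemma cell_step_cases:
  assumes "0 < \<delta>" "0 < t" "t \<le> real n * \<delta>"
  obtains l where "l < n" "real l * \<delta> < t" "t \<le> (real l + 1) * \<delta>" "cell_step \<delta> n c t = c l"
proof -
  define l where "l = nat \<lceil>t / \<delta>\<rceil> - 1"
  have "l < n" using cell_index_less[OF assms(1,2), of n] assms(3) by (simp add: l_def)
  moreover have "real l * \<delta> < t" "t \<le> (real l + 1) * \<delta>"
    using cell_index_iff[OF assms(1), of l t] assms(2) by (auto simp: l_def)
  ultimately show ?thesis using that cell_step_eq[OF assms(1)] by blast
qed

lemma disjoint_family_on_cells:
  assumes "0 < \<delta>"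
  shows "disjoint_family_on (\<lambda>l. {real l * \<delta><..(real l + 1) * \<delta>}) I"
  unfolding disjoint_family_on_def using cell_index_iff[OF assms] by fastforce

section \<open>The case \<open>p < s < \<infinity>\<close>\<close>

text \<open>The function \<open>t powr (\<alpha> - 1)\<close> below is the weight of the space \<open>L(p', s')\<close>. It is singular at \<open>0\<close>, so that
  its value at the right end of a cell is a poor substitute for its mean on the first cells; \<open>f*\<close>
  is therefore made constant on the first \<open>L\<close> cells, which makes the level function constant there as well.\<close>

lemma lorentz_decomp_le_dual_norm_gt:
  assumes M: "sigma_finite_measure M" and na: "nonatomic M" and p: "1 < p" and r: "p < r"
    and f: "f \<in> lorentz_space M p (ennreal r)"
  shows "lorentz_decomp_norm M p (ennreal r) f \<le> lorentz_dual_norm M p (ennreal r) f"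
proof (rule ennreal_le_epsilon)
  fix e :: real
  assume top: "lorentz_dual_norm M p (ennreal r) f < top" and e: "0 < e"
  obtain d where d: "lorentz_dual_norm M p (ennreal r) f = ennreal d" "0 \<le> d"
    using top by (cases "lorentz_dual_norm M p (ennreal r) f") auto
  \<comment> \<open>The total error will be \<open>\<epsilon> + \<epsilon>\<close> from two
    discarded parts and \<open>\<epsilon> * d\<close> from the discretization.\<close>
  define \<epsilon> where "\<epsilon> = e / (d + 2)"
  have \<epsilon>: "0 < \<epsilon>" using e d by (simp add: \<epsilon>_def)
  have e_eq: "\<epsilon> + \<epsilon> + (1 + \<epsilon>) * d = d + e"
  proof -
    have "\<epsilon> * (d + 2) = e" using d by (simp add: \<epsilon>_def)
    then show ?thesis by (simp add: algebra_simps)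
  qed
  have [measurable]: "f \<in> borel_measurable M" using f by (simp add: lorentz_space_def)
  have r1: "1 < r" using p r by simp
  have s: "1 \<le> ennreal r" using r1 by (simp add: ennreal_ge_1)
  define q where "q = r / (r - 1)"
  have q: "1 \<le> q" using r1 by (simp add: q_def field_simps)
  \<comment> \<open>\<open>t powr (\<alpha> - 1)\<close> is the weight in the integral for the dual
    norm; since \<open>r\<close> exceeds \<open>p\<close>, \<open>\<alpha> \<le> 1\<close> and the
    weight is nonincreasing.\<close>
  define \<alpha> where "\<alpha> = q / (p / (p - 1))"
  have \<alpha>0: "0 < \<alpha>" using q p by (simp add: \<alpha>_def)
  have \<alpha>1: "\<alpha> \<le> 1"
  proof -
    have "\<alpha> = (r * (p - 1)) / ((r - 1) * p)" using p r1 by (simp add: \<alpha>_def q_def)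
    also have "\<dots> \<le> 1" using p r r1 by (subst divide_le_eq_1_pos) (auto simp: algebra_simps)
    finally show ?thesis .
  qed
  have exp1: "(r - 1) * q = r" using r1 by (simp add: q_def)
  \<comment> \<open>By this identity the integrand for the norm of \<open>H\<close> below equals the
    one for the dual norm of the test function: both are the step function of
    \<open>\<rho> l powr r\<close> times \<open>t powr (\<alpha> - 1)\<close>.\<close>
  have exp2: "r / p - 1 + (\<alpha> - 1) * r = \<alpha> - 1"
  proof -
    have "\<alpha> = q * (1 - 1 / p)" using p by (simp add: \<alpha>_def field_simps)
    then have "\<alpha> * (r - 1) = ((r - 1) * q) * (1 - 1 / p)" by (simp only: mult_ac)
    then have "(\<alpha> - 1) * (r - 1) = ((r - 1) * q) * (1 - 1 / p) - (r - 1)"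
      by (simp only: left_diff_distrib mult_1)
    also have "\<dots> = 1 - r / p" unfolding exp1 by (simp add: algebra_simps)
    finally show ?thesis by (simp add: algebra_simps)
  qed
  obtain F :: "real \<Rightarrow> real" where F: "F \<in> borel_measurable borel" "\<And>t. 0 \<le> F t"
    "\<And>t. 0 < t \<Longrightarrow> rearr M f t = ennreal (F t)" "\<And>t t'. 0 < t \<Longrightarrow> t \<le> t' \<Longrightarrow> F t' \<le> F t"
    "(\<lambda>n. F (real n)) \<longlonglongrightarrow> 0"
    by (rule lorentz_space_rearr_real[OF f p s]) (rule that)
  note [measurable] = F(1)
  obtain \<tau> where \<tau>: "\<tau> \<in> borel_measurable M" "\<And>x. 0 \<le> \<tau> x"
    "\<And>x. x \<in> space M \<Longrightarrow> f x \<noteq> 0 \<Longrightarrow> rearr M f (\<tau> x) \<le> ennreal \<bar>f x\<bar>"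
    "\<And>x t. x \<in> space M \<Longrightarrow> f x \<noteq> 0 \<Longrightarrow> 0 \<le> t \<Longrightarrow> t < \<tau> x \<Longrightarrow> ennreal \<bar>f x\<bar> \<le> rearr M f t"
    "\<And>t. 0 \<le> t \<Longrightarrow> emeasure M {x\<in>space M. f x \<noteq> 0 \<and> \<tau> x < t} = min (ennreal t) (emeasure M {x\<in>space M. f x \<noteq> 0})"
    by (rule lorentz_space_Ryff[OF M na p s f]) (rule that)
  note [measurable] = \<tau>(1)
  have f_le: "\<bar>f x\<bar> \<le> F t" if "x \<in> space M" "f x \<noteq> 0" "0 < t" "t < \<tau> x" for x t
    using \<tau>(4)[of x t] F(3)[of t] F(2)[of t] that by simp
  have finF: "lorentz_fun p (ennreal r) (\<lambda>t. ennreal (F t)) < \<infinity>"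
  proof -
    have "lorentz_fun p (ennreal r) (\<lambda>t. ennreal (F t)) \<le> lorentz_norm M p (ennreal r) f"
      unfolding lorentz_norm_eq by (intro lorentz_fun_mono) (simp add: F(3))
    with f show ?thesis by (auto simp: lorentz_space_def intro: le_less_trans)
  qed
  have "\<forall>\<^sub>F n in sequentially. lorentz_fun p (ennreal r) (\<lambda>t. ennreal (if t < 1 / real n then F t else 0)) \<le> ennreal \<epsilon>"
  proof (rule lorentz_fun_eventually_small[OF _ F(1) _ _ _ _ finF \<epsilon>])
    fix t :: real assume t: "0 < t"
    obtain N where N: "1 / t < real N" using reals_Archimedean2 by blast
    have "\<forall>\<^sub>F n in sequentially. (if t < 1 / real n then F t else 0) = 0"
      using eventually_ge_at_top[of "N + 1"]
    proof eventually_elim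
      case (elim n)
      then have "1 / t < real n" "0 < real n" using N by linarith+
      then show ?case using t by (auto simp: field_simps)
    qed
    then show "(\<lambda>n. if t < 1 / real n then F t else 0) \<longlonglongrightarrow> 0" by (rule tendsto_eventually)
  qed (use r1 F(2) in auto)
  moreover have "\<forall>\<^sub>F n in sequentially. lorentz_fun p (ennreal r) (\<lambda>t. ennreal (min (F t) (F (real n)))) \<le> ennreal \<epsilon>"
  proof (rule lorentz_fun_eventually_small[OF _ F(1) _ _ _ _ finF \<epsilon>])
    fix t :: real
    show "(\<lambda>n. min (F t) (F (real n))) \<longlonglongrightarrow> 0"
      using tendsto_min[OF tendsto_const[of "F t"] F(5)] F(2)[of t] by (simp add: min_absorb2)
  qed (use r1 F(2) in auto)
  ultimately have "\<forall>\<^sub>F n in sequentially. 0 < n \<and>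
      lorentz_fun p (ennreal r) (\<lambda>t. ennreal (if t < 1 / real n then F t else 0)) \<le> ennreal \<epsilon> \<and>
      lorentz_fun p (ennreal r) (\<lambda>t. ennreal (min (F t) (F (real n)))) \<le> ennreal \<epsilon>"
    using eventually_gt_at_top[of 0] by eventually_elim auto
  then obtain n0 where n0: "0 < n0"
      "lorentz_fun p (ennreal r) (\<lambda>t. ennreal (if t < 1 / real n0 then F t else 0)) \<le> ennreal \<epsilon>"
      "lorentz_fun p (ennreal r) (\<lambda>t. ennreal (min (F t) (F (real n0)))) \<le> ennreal \<epsilon>"
    by (auto simp: eventually_sequentially)
  obtain L :: nat where L: "1 \<le> L"
    "\<And>\<delta>. 0 < \<delta> \<Longrightarrow> (\<Sum>l<L. ((real l + 1) * \<delta>) powr \<alpha> / \<alpha> - (real l * \<delta>) powr \<alpha> / \<alpha>)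
      \<le> (1 + \<epsilon>) * (\<delta> * (\<Sum>l<L. ((real l + 1) * \<delta>) powr (\<alpha> - 1)))"
    "\<And>\<delta> l. 0 < \<delta> \<Longrightarrow> L \<le> l \<Longrightarrow> ((real l + 1) * \<delta>) powr \<alpha> / \<alpha> - (real l * \<delta>) powr \<alpha> / \<alpha>
      \<le> (1 + \<epsilon>) * (\<delta> * ((real l + 1) * \<delta>) powr (\<alpha> - 1))"
    by (rule ex_cell_weight_bound[OF \<alpha>0 \<alpha>1 \<epsilon>]) (rule that)
  define \<eta> where "\<eta> = 1 / real n0"
  \<comment> \<open>For \<open>\<tau> x \<ge> \<eta>\<close> the cell of
    \<open>\<tau> x - \<delta>\<close> has an index \<open>l\<close> with
    \<open>L \<le> Suc l\<close>, where \<open>a\<close> is not flattened; the factor 2 absorbs the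
    shift by \<open>\<delta>\<close>. The flattening thus touches only the discarded part.\<close>
  define \<delta> where "\<delta> = \<eta> / (2 * real L)"
  have \<eta>: "0 < \<eta>" using n0 by (simp add: \<eta>_def)
  have \<delta>: "0 < \<delta>" using \<eta> L(1) by (simp add: \<delta>_def)
  have \<delta>\<eta>: "\<eta> = 2 * real L * \<delta>" using L(1) by (simp add: \<delta>_def)
  define n where "n = nat \<lceil>real n0 / \<delta>\<rceil> + L"
  have nL: "L \<le> n" by (simp add: n_def)
  have n\<delta>: "real n0 \<le> real n * \<delta>"
  proof -
    have "real n0 / \<delta> \<le> real n" unfolding n_def by linarith
    then show ?thesis using \<delta> by (simp add: field_simps)
  qed
  define a where "a l = F (real (max (Suc l) L) * \<delta>)" for l
  define v where "v l = ((real l + 1) * \<delta>) powr (\<alpha> - 1)" for l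
  define u where "u l = ((real l + 1) * \<delta>) powr \<alpha> / \<alpha> - (real l * \<delta>) powr \<alpha> / \<alpha>" for l
  have a0: "0 \<le> a l" for l by (simp add: a_def F)
  have a_anti: "a j \<le> a i" if "i \<le> j" for i j
    unfolding a_def using that \<delta> L(1) by (intro F(4)) (auto intro!: mult_right_mono)
  have v0: "0 < v l" for l using \<delta> by (simp add: v_def)
  have v_anti: "v j \<le> v i" if "i \<le> j" for i j
    unfolding v_def using that \<delta> \<alpha>1 by (intro powr_mono2') auto
  have u0: "0 \<le> u l" for l
    unfolding u_def using \<delta> \<alpha>0 by (auto intro!: divide_right_mono powr_mono2 mult_right_mono)
  have "\<exists>\<rho>. (\<forall>i<n. 0 \<le> \<rho> i) \<and> (\<forall>i j. i \<le> j \<longrightarrow> j < n \<longrightarrow> \<rho> j \<le> \<rho> i)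
    \<and> (\<forall>m\<le>n. (\<Sum>i<m. a i) \<le> (\<Sum>i<m. \<rho> i * v i)) \<and> (\<Sum>i<n. a i) = (\<Sum>i<n. \<rho> i * v i)
    \<and> (\<forall>m. Suc m < n \<longrightarrow> \<rho> (Suc m) < \<rho> m \<longrightarrow> (\<Sum>i<Suc m. a i) = (\<Sum>i<Suc m. \<rho> i * v i))"
    using ex_level_function[of n a v] a0 v0 by blast
  then obtain \<rho> where \<rho>: "\<And>i. i < n \<Longrightarrow> 0 \<le> \<rho> i" "\<And>i j. i \<le> j \<Longrightarrow> j < n \<Longrightarrow> \<rho> j \<le> \<rho> i"
    "\<And>m. m \<le> n \<Longrightarrow> (\<Sum>i<m. a i) \<le> (\<Sum>i<m. \<rho> i * v i)" "(\<Sum>i<n. a i) = (\<Sum>i<n. \<rho> i * v i)"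
    "\<And>m. Suc m < n \<Longrightarrow> \<rho> (Suc m) < \<rho> m \<Longrightarrow> (\<Sum>i<Suc m. a i) = (\<Sum>i<Suc m. \<rho> i * v i)"
    by (auto simp del: sum.lessThan_Suc)
  have \<rho>_const: "\<rho> i = \<rho> 0" if i: "i < L" for i
  proof (rule level_function_constant[OF nL _ \<rho>(1) v_anti v0 \<rho>(2,3,5) i])
    show "a i = F (real L * \<delta>)" if "i < L" for i using that by (simp add: a_def max_absorb2 Suc_le_eq)
  qed
  \<comment> \<open>The Hoelder extremal for the level function. \<open>X\<close> is their pairing
    with the weight taken at right ends, \<open>Y\<close> the same sum with the exact integrals of
    the weight; the choice of \<open>L\<close> and the constancy of \<open>\<rho>\<close> on the
    first \<open>L\<close> cells bound \<open>Y\<close> by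
    \<open>(1 + \<epsilon>) * X\<close>.\<close>
  define c where "c l = \<rho> l powr (r - 1)" for l
  define X where "X = (\<Sum>l<n. \<rho> l powr r * (\<delta> * v l))"
  define Y where "Y = (\<Sum>l<n. \<rho> l powr r * u l)"
  have Y0: "0 \<le> Y" unfolding Y_def by (intro sum_nonneg mult_nonneg_nonneg u0) auto
  have YX: "Y \<le> (1 + \<epsilon>) * X"
  proof -
    have split: "(\<Sum>l<n. g l) = (\<Sum>l<L. g l) + (\<Sum>l\<in>{L..<n}. g l)" for g :: "nat \<Rightarrow> real"
      using nL by (simp add: lessThan_atLeast0 sum.atLeastLessThan_concat)
    have const: "(\<Sum>l<L. \<rho> l powr r * g l) = \<rho> 0 powr r * (\<Sum>l<L. g l)" for g :: "nat \<Rightarrow> real"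
      unfolding sum_distrib_left
    proof (rule sum.cong)
      fix l assume "l \<in> {..<L}"
      then have "\<rho> l = \<rho> 0" by (intro \<rho>_const) simp
      then show "\<rho> l powr r * g l = \<rho> 0 powr r * g l" by (rule arg_cong)
    qed simp
    have "(\<Sum>l<L. \<rho> l powr r * u l) \<le> \<rho> 0 powr r * ((1 + \<epsilon>) * (\<delta> * (\<Sum>l<L. v l)))"
      unfolding const u_def v_def by (intro mult_left_mono L(2) \<delta>) simp
    also have "\<dots> = (1 + \<epsilon>) * (\<Sum>l<L. \<rho> l powr r * (\<delta> * v l))"
      unfolding const by (simp add: sum_distrib_left mult.left_commute)
    finally have 1: "(\<Sum>l<L. \<rho> l powr r * u l) \<le> (1 + \<epsilon>) * (\<Sum>l<L. \<rho> l powr r * (\<delta> * v l))" .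
    have 2: "(\<Sum>l\<in>{L..<n}. \<rho> l powr r * u l) \<le> (1 + \<epsilon>) * (\<Sum>l\<in>{L..<n}. \<rho> l powr r * (\<delta> * v l))"
      unfolding sum_distrib_left
    proof (rule sum_mono)
      fix l assume "l \<in> {L..<n}"
      then have "u l \<le> (1 + \<epsilon>) * (\<delta> * v l)" unfolding u_def v_def by (intro L(3) \<delta>) simp
      then have "\<rho> l powr r * u l \<le> \<rho> l powr r * ((1 + \<epsilon>) * (\<delta> * v l))" by (intro mult_left_mono) auto
      then show "\<rho> l powr r * u l \<le> (1 + \<epsilon>) * (\<rho> l powr r * (\<delta> * v l))" by (simp only: mult.left_commute)
    qed
    show ?thesis unfolding X_def Y_def split using 1 2 by (simp add: distrib_left)
  qed
  \<comment> \<open>\<open>c\<close> changes only where \<open>\<rho>\<close> drops, and there the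
    prefix sums of \<open>a\<close> and of the level function coincide, so the pairing can be
    computed with \<open>a\<close>, that is, with \<open>f\<close>.\<close>
  have X_eq: "X = (\<Sum>l<n. \<delta> * a l * c l)"
  proof -
    have "(\<Sum>l<n. a l * c l) = (\<Sum>l<n. (\<rho> l * v l) * c l)"
    proof (rule sum_mult_eq_of_prefix_sums)
      fix m assume m: "Suc m < n" "c (Suc m) \<noteq> c m"
      then have "\<rho> (Suc m) \<noteq> \<rho> m" by (auto simp: c_def)
      then show "(\<Sum>i<Suc m. a i) = (\<Sum>i<Suc m. \<rho> i * v i)"
        using \<rho>(2)[of m "Suc m"] m by (intro \<rho>(5)) auto
    qed (rule \<rho>(4))
    then have "(\<Sum>l<n. \<delta> * a l * c l) = (\<Sum>l<n. \<delta> * ((\<rho> l * v l) * c l))"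
      by (simp add: sum_distrib_left[symmetric] mult.assoc)
    also have "\<dots> = X"
      unfolding X_def
    proof (rule sum.cong)
      fix l assume "l \<in> {..<n}"
      then have "\<rho> l * c l = \<rho> l powr r" unfolding c_def using \<rho>(1) by (intro powr_mult_self) simp
      then show "\<delta> * ((\<rho> l * v l) * c l) = \<rho> l powr r * (\<delta> * v l)"
        by (metis mult.assoc mult.commute)
    qed simp
    finally show ?thesis ..
  qed
  have c0: "0 \<le> c l" for l by (simp add: c_def)
  have step0: "0 \<le> cell_step \<delta> n c t" for t using \<delta> c0 by (intro cell_step_nonneg)
  have step_int: "(\<integral>\<^sup>+t\<in>{0<..}. ennreal (cell_step \<delta> n (\<lambda>l. \<rho> l powr r) t) * ennreal (t powr (\<alpha> - 1)) \<partial>lborel) = ennreal Y"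
  proof -
    have "(\<integral>\<^sup>+t\<in>{0<..}. ennreal (cell_step \<delta> n (\<lambda>l. \<rho> l powr r) t) * ennreal (t powr (\<alpha> - 1)) \<partial>lborel)
      = (\<Sum>l<n. ennreal (\<rho> l powr r) * (\<integral>\<^sup>+t\<in>{real l * \<delta><..(real l + 1) * \<delta>}. ennreal (t powr (\<alpha> - 1)) \<partial>lborel))"
      by (rule nn_integral_cell_step[OF \<delta>]) measurable
    also have "\<dots> = (\<Sum>l<n. ennreal (\<rho> l powr r * u l))"
    proof (rule sum.cong)
      fix l
      have "(\<integral>\<^sup>+t\<in>{real l * \<delta><..(real l + 1) * \<delta>}. ennreal (t powr (\<alpha> - 1)) \<partial>lborel) = ennreal (u l)"
        unfolding u_def using \<delta> by (intro nn_integral_powr_Ioc \<alpha>0) auto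
      then show "ennreal (\<rho> l powr r) * (\<integral>\<^sup>+t\<in>{real l * \<delta><..(real l + 1) * \<delta>}. ennreal (t powr (\<alpha> - 1)) \<partial>lborel)
        = ennreal (\<rho> l powr r * u l)" using u0 by (simp add: ennreal_mult)
    qed simp
    also have "\<dots> = ennreal Y" unfolding Y_def by (intro sum_ennreal mult_nonneg_nonneg u0) auto
    finally show ?thesis .
  qed
  have step_powr: "cell_step \<delta> n g t powr k = cell_step \<delta> n (\<lambda>l. g l powr k) t" for g k t
    by (simp add: cell_step_def)
  have G_norm: "lorentz_fun (p / (p - 1)) (conj_exp (ennreal r)) (\<lambda>t. ennreal (cell_step \<delta> n c t)) = ennreal_powr (ennreal Y) (1 / q)"
  proof -
    have "ennreal (t powr (q / (p / (p - 1)) - 1)) * ennreal_powr (ennreal (cell_step \<delta> n c t)) q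
      = ennreal (cell_step \<delta> n (\<lambda>l. \<rho> l powr r) t) * ennreal (t powr (\<alpha> - 1))" for t
    proof -
      have "cell_step \<delta> n c t powr q = cell_step \<delta> n (\<lambda>l. \<rho> l powr r) t"
        unfolding step_powr c_def powr_powr exp1 ..
      then show ?thesis unfolding \<alpha>_def[symmetric] using step0[of t]
        by (simp add: ennreal_powr_ennreal mult.commute)
    qed
    then show ?thesis
      unfolding conj_exp_ennreal[OF r1] q_def[symmetric] lorentz_fun_real[OF q] step_int[symmetric] by simp
  qed
  \<comment> \<open>The level function with the exact weight instead of its right-end value. It is
    nonincreasing, lies above the cell values \<open>b\<close> introduced below, and its norm is a
    power of \<open>Y\<close>.\<close>
  define H where "H t = cell_step \<delta> n \<rho> t * t powr (\<alpha> - 1)" for t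
  have \<rho>step0: "0 \<le> cell_step \<delta> n \<rho> t" for t using \<delta> \<rho>(1) by (intro cell_step_nonneg)
  have H0: "0 \<le> H t" for t unfolding H_def using \<rho>step0 by simp
  have H_anti: "H t' \<le> H t" if "0 < t" "t \<le> t'" for t t'
    unfolding H_def using that \<alpha>1 \<rho> \<rho>step0 \<delta> by (intro mult_mono cell_step_antimono powr_mono2') auto
  have H_norm: "lorentz_fun p (ennreal r) (\<lambda>t. ennreal (H t)) = ennreal_powr (ennreal Y) (1 / r)"
  proof -
    have "ennreal (t powr (r / p - 1)) * ennreal_powr (ennreal (H t)) r
      = ennreal (cell_step \<delta> n (\<lambda>l. \<rho> l powr r) t) * ennreal (t powr (\<alpha> - 1))" if t: "0 < t" for t
    proof -
      have "t powr (r / p - 1) * H t powr r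
        = cell_step \<delta> n \<rho> t powr r * (t powr (r / p - 1) * t powr ((\<alpha> - 1) * r))"
        using \<rho>step0[of t] by (simp add: H_def powr_mult powr_powr)
      also have "\<dots> = cell_step \<delta> n (\<lambda>l. \<rho> l powr r) t * t powr (\<alpha> - 1)"
        unfolding step_powr powr_add[symmetric] exp2 ..
      finally have "t powr (r / p - 1) * H t powr r = cell_step \<delta> n (\<lambda>l. \<rho> l powr r) t * t powr (\<alpha> - 1)" .
      moreover have "0 \<le> cell_step \<delta> n (\<lambda>l. \<rho> l powr r) t" using \<delta> by (intro cell_step_nonneg) auto
      ultimately show ?thesis using H0[of t] by (simp add: ennreal_powr_ennreal ennreal_mult[symmetric])
    qed
    then have "(\<integral>\<^sup>+t\<in>{0<..}. ennreal (t powr (r / p - 1)) * ennreal_powr (ennreal (H t)) r \<partial>lborel) = ennreal Y"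
      unfolding step_int[symmetric] by (intro nn_integral_cong) (auto simp: indicator_def)
    then show ?thesis using r1 by (simp add: lorentz_fun_real)
  qed
  \<comment> \<open>\<open>Y \<le> (1 + \<epsilon>) * X\<close>, and testing the dual norm with the
    step function of \<open>c\<close> bounds \<open>X\<close> by \<open>d * Y powr (1 / q)\<close>;
    cancelling leaves a bound for the norm of \<open>H\<close>.\<close>
  have Y_le: "ennreal_powr (ennreal Y) (1 / r) \<le> ennreal ((1 + \<epsilon>) * d)"
  proof (rule ennreal_powr_conj_cancel[OF r1])
    have "ennreal X \<le> (\<integral>\<^sup>+t\<in>{0<..}. rearr M f t * ennreal (cell_step \<delta> n c t) \<partial>lborel)"
      unfolding X_eq
    proof (rule sum_le_nn_integral_rearr_cell_step[OF \<delta> c0 a0])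
      fix l
      have "a l \<le> F ((real l + 1) * \<delta>)"
        unfolding a_def using \<delta> by (intro F(4)) (auto intro!: mult_right_mono)
      then show "ennreal (a l) \<le> rearr M f ((real l + 1) * \<delta>)"
        using \<delta> by (subst F(3)) (auto intro!: ennreal_leI)
    qed
    also have "\<dots> \<le> ennreal d * ennreal_powr (ennreal Y) (1 / q)"
      unfolding d(1)[symmetric] G_norm[symmetric]
    proof (rule nn_integral_rearr_le_dual_norm[OF M na p s f _ step0])
      show "lorentz_fun (p / (p - 1)) (conj_exp (ennreal r)) (\<lambda>t. ennreal (cell_step \<delta> n c t)) < \<infinity>"
        unfolding G_norm using Y0 by (simp add: ennreal_powr_ennreal)
      show "cell_step \<delta> n c t' \<le> cell_step \<delta> n c t" if "0 < t" "t \<le> t'" for t t'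
        using that \<delta> c0 r1 \<rho> by (intro cell_step_antimono) (auto simp: c_def intro!: powr_mono2)
    qed measurable
    finally have "ennreal (1 + \<epsilon>) * ennreal X \<le> ennreal (1 + \<epsilon>) * (ennreal d * ennreal_powr (ennreal Y) (1 / q))"
      by (rule mult_left_mono) simp
    moreover have "ennreal Y \<le> ennreal (1 + \<epsilon>) * ennreal X"
    proof -
      have "ennreal (1 + \<epsilon>) * ennreal X = ennreal ((1 + \<epsilon>) * X)"
        using \<epsilon> by (intro ennreal_mult'[symmetric]) simp
      then show ?thesis using YX by (simp only: ennreal_leI)
    qed
    moreover have "ennreal (1 + \<epsilon>) * (ennreal d * ennreal_powr (ennreal Y) (1 / q)) = ennreal ((1 + \<epsilon>) * d) * ennreal_powr (ennreal Y) (1 / q)"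
      using \<epsilon> d by (simp add: ennreal_mult mult.assoc)
    ultimately show "ennreal Y \<le> ennreal ((1 + \<epsilon>) * d) * ennreal_powr (ennreal Y) (1 / (r / (r - 1)))"
      unfolding q_def by (metis order_trans)
  qed simp
  define b where "b l = \<rho> l * v l" for l
  have b0: "l < n \<Longrightarrow> 0 \<le> b l" for l using \<rho>(1) v0[of l] by (simp add: b_def)
  let ?P = "{\<sigma>. \<sigma> permutes {..<n}}"
  obtain w where w: "\<And>\<sigma>. 0 \<le> w \<sigma>" "(\<Sum>\<sigma>\<in>?P. w \<sigma>) = (1::real)"
    "\<And>i. i < n \<Longrightarrow> a i \<le> (\<Sum>\<sigma>\<in>?P. w \<sigma> * b (\<sigma> i))"
    using majorized_le_convex_permutations[of n a b] a_anti \<rho>(3) unfolding b_def by blast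
  \<comment> \<open>Permutations of weight 0 are dropped, because \<open>lorentz_norm_cmult\<close>
    concerns nonzero factors.\<close>
  define P where "P = {\<sigma>\<in>?P. 0 < w \<sigma>}"
  have finP: "finite P" unfolding P_def by (intro finite_subset[OF _ finite_permutations[of "{..<n}"]]) auto
  have sumP: "(\<Sum>\<sigma>\<in>P. w \<sigma> * g \<sigma>) = (\<Sum>\<sigma>\<in>?P. w \<sigma> * g \<sigma>)" for g
    unfolding P_def using w(1) by (intro sum.mono_neutral_left finite_permutations) (auto simp: less_le)
  \<comment> \<open>A shift by one cell: for \<open>\<tau> x\<close> in cell \<open>l + 1\<close>,
    \<open>\<bar>f x\<bar>\<close> is at most \<open>F\<close> at the left end of that cell. This is
    the right end of cell \<open>l\<close>, where \<open>F\<close> has the value \<open>a l\<close>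
    as soon as \<open>L \<le> Suc l\<close>. Cell 0 falls into the discarded part.\<close>
  define k where "k \<sigma> x = (if f x \<noteq> 0 then cell_step \<delta> n (\<lambda>l. b (\<sigma> l)) (\<tau> x - \<delta>) else 0)" for \<sigma> x
  have [measurable]: "k \<sigma> \<in> borel_measurable M" for \<sigma> unfolding k_def by measurable
  have perm: "\<sigma> l < n" if "\<sigma> \<in> P" "l < n" for \<sigma> l
    using permutes_in_image[of \<sigma> "{..<n}" l] that by (auto simp: P_def)
  have k0: "0 \<le> k \<sigma> x" if "\<sigma> \<in> P" for \<sigma> x
    unfolding k_def using \<delta> b0 perm[OF that] by (auto intro!: cell_step_nonneg)
  define A where "A l = {x\<in>space M. f x \<noteq> 0 \<and> (real l + 1) * \<delta> < \<tau> x \<and> \<tau> x \<le> (real l + 2) * \<delta>}" for l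
  have A_iff: "x \<in> A l \<longleftrightarrow> x \<in> space M \<and> f x \<noteq> 0 \<and> real l * \<delta> < \<tau> x - \<delta> \<and> \<tau> x - \<delta> \<le> (real l + 1) * \<delta>" for x l
    unfolding A_def by (auto simp: algebra_simps)
  have k_rearr: "rearr M (k \<sigma>) t \<le> ennreal (H t)" if \<sigma>: "\<sigma> \<in> P" and t: "0 < t" for \<sigma> t
  proof (rule rearr_le_of_permuted_cells[where I = "{..<n}" and A = A and b = b and \<sigma> = \<sigma>
        and J = "\<lambda>l. {real l * \<delta><..(real l + 1) * \<delta>}"])
    have p: "\<sigma> permutes {..<n}" using \<sigma> by (simp add: P_def)
    show "inj_on \<sigma> {..<n}" using permutes_inj[OF p] by (rule inj_on_subset) simp
    show "\<sigma> ` {..<n} \<subseteq> {..<n}" using permutes_image[OF p] by simp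
    show "A l \<in> sets M" for l unfolding A_def by measurable
    show "disjoint_family_on A {..<n}"
      unfolding disjoint_family_on_def
    proof (intro ballI impI)
      fix i j :: nat assume ij: "i \<noteq> j"
      show "A i \<inter> A j = {}"
        using cell_index_iff[OF \<delta>, of i] cell_index_iff[OF \<delta>, of j] ij by (force simp: A_iff)
    qed
    show "disjoint_family_on (\<lambda>l. {real l * \<delta><..(real l + 1) * \<delta>}) {..<n}"
      by (rule disjoint_family_on_cells[OF \<delta>])
    show "emeasure M (A l) \<le> emeasure lborel {real (\<sigma> l) * \<delta><..(real (\<sigma> l) + 1) * \<delta>}" for l
    proof -
      have "emeasure M (A l) \<le> ennreal ((real l + 2) * \<delta> - (real l + 1) * \<delta>)"
        unfolding A_def using \<delta> by (intro emeasure_Ryff_cell \<tau>(2,5)) (auto simp: mult_right_mono)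
      also have "\<dots> = emeasure lborel {real (\<sigma> l) * \<delta><..(real (\<sigma> l) + 1) * \<delta>}"
        using \<delta> by (simp add: algebra_simps)
      finally show ?thesis .
    qed
    show "\<exists>l\<in>{..<n}. x \<in> A l \<and> \<bar>k \<sigma> x\<bar> \<le> b (\<sigma> l)" if x: "x \<in> space M" "k \<sigma> x \<noteq> 0" for x
    proof -
      have x': "f x \<noteq> 0" "k \<sigma> x = cell_step \<delta> n (\<lambda>l. b (\<sigma> l)) (\<tau> x - \<delta>)"
        "0 < \<tau> x - \<delta>" "\<tau> x - \<delta> \<le> real n * \<delta>"
        using x(2) by (auto simp: k_def cell_step_def split: if_splits)
      obtain l where l: "l < n" "real l * \<delta> < \<tau> x - \<delta>" "\<tau> x - \<delta> \<le> (real l + 1) * \<delta>" "k \<sigma> x = b (\<sigma> l)"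
        using cell_step_cases[OF \<delta> x'(3,4), of "\<lambda>l. b (\<sigma> l)"] x'(2) by metis
      then show ?thesis using x x'(1) k0[OF \<sigma>, of x] by (intro bexI[of _ l]) (auto simp: A_iff)
    qed
    show "0 < t \<and> b l \<le> H t" if l: "l \<in> {..<n}" and t: "t \<in> {real l * \<delta><..(real l + 1) * \<delta>}" for l t
    proof
      have ln: "l < n" using l by simp
      have t': "real l * \<delta> < t" "t \<le> (real l + 1) * \<delta>" using t by auto
      have "0 \<le> real l * \<delta>" using \<delta> by simp
      with t' show "0 < t" by linarith
      then have "v l \<le> t powr (\<alpha> - 1)" unfolding v_def using t' \<alpha>1 by (intro powr_mono2') auto
      then show "b l \<le> H t"
        unfolding b_def H_def cell_step_eq[OF \<delta> ln t'] using \<rho>(1)[OF ln] by (rule mult_left_mono)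
    qed
  qed (use t H0 H_anti in auto)
  have k_norm: "lorentz_norm M p (ennreal r) (k \<sigma>) \<le> ennreal ((1 + \<epsilon>) * d)" if "\<sigma> \<in> P" for \<sigma>
  proof -
    have "lorentz_norm M p (ennreal r) (k \<sigma>) \<le> lorentz_fun p (ennreal r) (\<lambda>t. ennreal (H t))"
      unfolding lorentz_norm_eq by (intro lorentz_fun_mono k_rearr that)
    also have "\<dots> \<le> ennreal ((1 + \<epsilon>) * d)" unfolding H_norm by (rule Y_le)
    finally show ?thesis .
  qed
  define h where "h \<sigma> x = w \<sigma> * k \<sigma> x" for \<sigma> x
  have h_norm: "lorentz_norm M p (ennreal r) (h \<sigma>) \<le> ennreal (w \<sigma>) * ennreal ((1 + \<epsilon>) * d)" if \<sigma>: "\<sigma> \<in> P" for \<sigma>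
  proof -
    have "lorentz_norm M p (ennreal r) (h \<sigma>) = ennreal \<bar>w \<sigma>\<bar> * lorentz_norm M p (ennreal r) (k \<sigma>)"
      unfolding h_def using \<sigma> s by (intro lorentz_norm_cmult) (auto simp: P_def)
    then show ?thesis using w(1)[of \<sigma>] k_norm[OF \<sigma>] by (simp add: mult_left_mono)
  qed
  define f1 where "f1 x = (if \<tau> x < \<eta> then f x else 0)" for x
  define f2 where "f2 x = (if real n0 < \<tau> x then f x else 0)" for x
  have [measurable]: "f1 \<in> borel_measurable M" "f2 \<in> borel_measurable M"
    unfolding f1_def f2_def by measurable
  have f1: "lorentz_norm M p (ennreal r) f1 \<le> ennreal \<epsilon>"
  proof -
    have "rearr M f1 t \<le> ennreal (if t < 1 / real n0 then F t else 0)" if t: "0 < t" for t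
    proof (cases "t < \<eta>")
      case True
      have "rearr M f1 t \<le> rearr M f t" by (rule rearr_mono_AE) (auto simp: f1_def)
      then show ?thesis using True F(3)[OF t] by (simp add: \<eta>_def)
    next
      case False
      have "emeasure M {x\<in>space M. 0 < ennreal \<bar>f1 x\<bar>} \<le> emeasure M {x\<in>space M. f x \<noteq> 0 \<and> \<tau> x < \<eta>}"
        by (intro emeasure_mono) (auto simp: f1_def)
      also have "\<dots> \<le> ennreal \<eta>" using \<tau>(5)[of \<eta>] \<eta> by simp
      also have "\<dots> \<le> ennreal t" using False by (intro ennreal_leI) simp
      finally have "rearr M f1 t \<le> 0" by (subst rearr_le_iff) simp_all
      then show ?thesis by simp
    qed
    then have "lorentz_norm M p (ennreal r) f1 \<le> lorentz_fun p (ennreal r) (\<lambda>t. ennreal (if t < 1 / real n0 then F t else 0))"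
      unfolding lorentz_norm_eq by (rule lorentz_fun_mono)
    with n0(2) show ?thesis by (rule order_trans[rotated])
  qed
  have f2: "lorentz_norm M p (ennreal r) f2 \<le> ennreal \<epsilon>"
  proof -
    have "rearr M f2 t \<le> ennreal (min (F t) (F (real n0)))" if t: "0 < t" for t
    proof -
      have 1: "rearr M f2 t \<le> ennreal (F t)"
        unfolding F(3)[OF t, symmetric] by (rule rearr_mono_AE) (auto simp: f2_def)
      have "\<bar>f2 x\<bar> \<le> F (real n0)" if "x \<in> space M" for x
        using f_le[OF that, of "real n0"] n0(1) F(2)[of "real n0"] by (cases "f x = 0") (auto simp: f2_def)
      then have empty: "{x\<in>space M. ennreal (F (real n0)) < ennreal \<bar>f2 x\<bar>} = {}"
        using F(2) by (auto simp: ennreal_less_iff not_less)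
      have 2: "rearr M f2 t \<le> ennreal (F (real n0))"
        using rearr_le_iff[of f2 M t "ennreal (F (real n0))"] unfolding empty by simp
      show ?thesis using 1 2 by (simp add: min_def)
    qed
    then have "lorentz_norm M p (ennreal r) f2 \<le> lorentz_fun p (ennreal r) (\<lambda>t. ennreal (min (F t) (F (real n0))))"
      unfolding lorentz_norm_eq by (rule lorentz_fun_mono)
    with n0(3) show ?thesis by (rule order_trans[rotated])
  qed
  have "lorentz_decomp_norm M p (ennreal r) f
    \<le> lorentz_norm M p (ennreal r) f1 + lorentz_norm M p (ennreal r) f2 + (\<Sum>\<sigma>\<in>P. lorentz_norm M p (ennreal r) (h \<sigma>))"
  proof (rule lorentz_decomp_le_sum3[OF _ finP])
    show "f1 \<in> lorentz_space M p (ennreal r)" "f2 \<in> lorentz_space M p (ennreal r)"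
      using f1 f2 by (auto simp: lorentz_space_def intro: le_less_trans)
    show "h \<sigma> \<in> lorentz_space M p (ennreal r)" if "\<sigma> \<in> P" for \<sigma>
    proof -
      have "ennreal (w \<sigma>) * ennreal ((1 + \<epsilon>) * d) < \<infinity>" by (simp add: ennreal_mult_less_top)
      with h_norm[OF that] have "lorentz_norm M p (ennreal r) (h \<sigma>) < \<infinity>" by (rule le_less_trans)
      then show ?thesis unfolding lorentz_space_def h_def by simp
    qed
    fix x assume x: "x \<in> space M"
    have nn: "0 \<le> (\<Sum>\<sigma>\<in>P. \<bar>h \<sigma> x\<bar>)" by (intro sum_nonneg) simp
    show "\<bar>f x\<bar> \<le> \<bar>f1 x\<bar> + \<bar>f2 x\<bar> + (\<Sum>\<sigma>\<in>P. \<bar>h \<sigma> x\<bar>)"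
    proof (cases "f x = 0 \<or> \<tau> x < \<eta> \<or> real n0 < \<tau> x")
      case True
      then show ?thesis using nn by (auto simp: f1_def f2_def)
    next
      case False
      then have fx: "f x \<noteq> 0" "\<eta> \<le> \<tau> x" "\<tau> x \<le> real n0" by auto
      have L1: "1 \<le> real L" using L(1) by simp
      have L\<delta>: "\<delta> \<le> real L * \<delta>" using mult_right_mono[OF L1, of \<delta>] \<delta> by simp
      have t0: "0 < \<tau> x - \<delta>" "\<tau> x - \<delta> \<le> real n * \<delta>"
        using fx \<delta>\<eta> L\<delta> \<delta> n\<delta> by linarith+
      obtain l where l: "l < n" "real l * \<delta> < \<tau> x - \<delta>" "\<tau> x - \<delta> \<le> (real l + 1) * \<delta>"
        using cell_step_cases[OF \<delta> t0] by metis
      have "2 * real L * \<delta> \<le> (real l + 2) * \<delta>" using fx \<delta>\<eta> l(3) by (simp add: algebra_simps)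
      then have "2 * real L \<le> real l + 2" using \<delta> by simp
      then have lL: "L \<le> Suc l" using L1 by linarith
      have lt: "real (Suc l) * \<delta> < \<tau> x" using l(2) by (simp add: algebra_simps)
      have "\<bar>f x\<bar> \<le> F (real (Suc l) * \<delta>)" using \<delta> by (intro f_le x fx lt) simp
      also have "\<dots> = a l" using lL by (simp add: a_def max_absorb1)
      also have "\<dots> \<le> (\<Sum>\<sigma>\<in>P. w \<sigma> * b (\<sigma> l))" unfolding sumP by (rule w(3)[OF l(1)])
      also have "\<dots> = (\<Sum>\<sigma>\<in>P. \<bar>h \<sigma> x\<bar>)"
      proof (rule sum.cong)
        fix \<sigma> assume \<sigma>: "\<sigma> \<in> P"
        have "k \<sigma> x = b (\<sigma> l)" using fx(1) cell_step_eq[OF \<delta> l] by (simp add: k_def)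
        then show "w \<sigma> * b (\<sigma> l) = \<bar>h \<sigma> x\<bar>" using w(1)[of \<sigma>] k0[OF \<sigma>, of x] by (simp add: h_def)
      qed simp
      finally show ?thesis by simp
    qed
  qed simp
  also have "\<dots> \<le> ennreal \<epsilon> + ennreal \<epsilon> + (\<Sum>\<sigma>\<in>P. ennreal (w \<sigma>) * ennreal ((1 + \<epsilon>) * d))"
    by (intro add_mono f1 f2 sum_mono h_norm)
  also have "(\<Sum>\<sigma>\<in>P. ennreal (w \<sigma>) * ennreal ((1 + \<epsilon>) * d)) = ennreal ((1 + \<epsilon>) * d)"
  proof -
    have "(\<Sum>\<sigma>\<in>P. ennreal (w \<sigma>)) = ennreal (\<Sum>\<sigma>\<in>P. w \<sigma>)" using w(1) by (intro sum_ennreal) auto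
    also have "(\<Sum>\<sigma>\<in>P. w \<sigma>) = 1" using sumP[of "\<lambda>_. 1"] w(2) by simp
    finally show ?thesis by (simp add: sum_distrib_right[symmetric])
  qed
  also have "ennreal \<epsilon> + ennreal \<epsilon> + ennreal ((1 + \<epsilon>) * d) = ennreal (\<epsilon> + \<epsilon> + (1 + \<epsilon>) * d)"
    using \<epsilon> d by (simp add: ennreal_plus[symmetric] del: ennreal_plus)
  also have "\<dots> = lorentz_dual_norm M p (ennreal r) f + ennreal e"
    unfolding e_eq d(1) using d(2) e by (simp add: ennreal_plus)
  finally show "lorentz_decomp_norm M p (ennreal r) f \<le> lorentz_dual_norm M p (ennreal r) f + ennreal e" .
qed

section \<open>The case \<open>s = \<infinity>\<close>\<close>

text \<open>The prefix sums of a nonincreasing sequence are concave and so lie above their chord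
  from the origin. This transfers a majorization at \<open>k\<close> to shorter prefixes.\<close>

lemma sum_lessThan_chord:
  fixes b :: "nat \<Rightarrow> real"
  assumes b: "\<And>i j. i \<le> j \<Longrightarrow> j < k \<Longrightarrow> b j \<le> b i" and m: "m \<le> k"
  shows "real m * (\<Sum>l<k. b l) \<le> real k * (\<Sum>l<m. b l)"
proof (cases "m < k")
  case True
  have split: "(\<Sum>l<k. b l) = (\<Sum>l<m. b l) + (\<Sum>l<k - m. b (m + l))"
    using sum_lessThan_add[of b m "k - m"] m by simp
  have "(\<Sum>l<k - m. b (m + l)) \<le> (\<Sum>l<k - m. b m)" by (intro sum_mono b) auto
  then have 1: "(\<Sum>l<k - m. b (m + l)) \<le> (real k - real m) * b m" using m by (simp add: of_nat_diff)
  have "(\<Sum>l<m. b m) \<le> (\<Sum>l<m. b l)" using True by (intro sum_mono b) auto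
  then have 2: "real m * b m \<le> (\<Sum>l<m. b l)" by simp
  have "real m * (\<Sum>l<k. b l) \<le> real m * (\<Sum>l<m. b l) + (real k - real m) * (real m * b m)"
    unfolding split using mult_left_mono[OF 1, of "real m"] by (simp add: algebra_simps)
  also have "\<dots> \<le> real m * (\<Sum>l<m. b l) + (real k - real m) * (\<Sum>l<m. b l)"
    using m by (intro add_left_mono mult_left_mono 2) simp
  finally show ?thesis by (simp add: algebra_simps)
qed (use m in simp)

text \<open>The test function is the indicator of the interval from 0 to \<open>m * T\<close>. The
  right side is \<open>d\<close> times its norm in L(p', 1), which is the integral of
  \<open>t powr (- 1 / p)\<close> over that interval.\<close>

lemma lorentz_dual_norm_top_prefix:
  assumes M: "sigma_finite_measure M" and na: "nonatomic M" and p: "1 < p"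
    and f: "f \<in> lorentz_space M p \<infinity>"
    and d: "lorentz_dual_norm M p \<infinity> f = ennreal d" "0 \<le> d"
    and T: "0 < T" and a: "\<And>l. 0 \<le> a l" "\<And>l. ennreal (a l) \<le> rearr M f ((real l + 1) * T)"
  shows "T * (\<Sum>l<m. a l) \<le> d * ((real m * T) powr (1 - 1 / p) / (1 - 1 / p))"
proof -
  let ?G = "cell_step T m (\<lambda>_. 1)"
  have \<alpha>: "0 < 1 - 1 / p" using p by simp
  have exp: "1 / (p / (p - 1)) = 1 - 1 / p" using p by (simp add: field_simps)
  have one: "conj_exp \<infinity> = ennreal 1" using conj_exp_infinity by simp
  have G_norm: "lorentz_fun (p / (p - 1)) (conj_exp \<infinity>) (\<lambda>t. ennreal (?G t))
    = ennreal ((real m * T) powr (1 - 1 / p) / (1 - 1 / p))"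
  proof -
    have "lorentz_fun (p / (p - 1)) (conj_exp \<infinity>) (\<lambda>t. ennreal (?G t))
      = (\<integral>\<^sup>+t\<in>{0<..}. ennreal (t powr (1 - 1 / p - 1)) * ennreal (?G t) \<partial>lborel)"
      unfolding one lorentz_fun_real[OF order_refl] exp by simp
    also have "\<dots> = (\<integral>\<^sup>+t\<in>{0<..real m * T}. ennreal (t powr (1 - 1 / p - 1)) \<partial>lborel)"
      by (intro nn_integral_cong) (auto simp: cell_step_def indicator_def)
    also have "\<dots> = ennreal ((real m * T) powr (1 - 1 / p) / (1 - 1 / p))"
      using T by (intro nn_integral_powr_from_0 \<alpha>) simp
    finally show ?thesis .
  qed
  have "ennreal (\<Sum>l<m. T * a l * 1) \<le> (\<integral>\<^sup>+t\<in>{0<..}. rearr M f t * ennreal (?G t) \<partial>lborel)"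
    by (rule sum_le_nn_integral_rearr_cell_step[OF T _ a]) simp
  also have "\<dots> \<le> ennreal d * ennreal ((real m * T) powr (1 - 1 / p) / (1 - 1 / p))"
    unfolding d(1)[symmetric] G_norm[symmetric]
  proof (rule nn_integral_rearr_le_dual_norm[OF M na p _ f])
    show "lorentz_fun (p / (p - 1)) (conj_exp \<infinity>) (\<lambda>t. ennreal (?G t)) < \<infinity>" unfolding G_norm by simp
  qed (use T in \<open>auto intro!: cell_step_nonneg cell_step_antimono\<close>)
  also have "\<dots> = ennreal (d * ((real m * T) powr (1 - 1 / p) / (1 - 1 / p)))"
    using d(2) \<alpha> by (intro ennreal_mult[symmetric]) auto
  finally have "ennreal (\<Sum>l<m. T * a l * 1) \<le> ennreal (d * ((real m * T) powr (1 - 1 / p) / (1 - 1 / p)))" .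
  then have "(\<Sum>l<m. T * a l * 1) \<le> d * ((real m * T) powr (1 - 1 / p) / (1 - 1 / p))"
    using d(2) \<alpha> by (subst (asm) ennreal_le_iff) auto
  then show ?thesis by (simp add: sum_distrib_left)
qed

text \<open>One geometric block, cut into cells of length \<open>T\<close>. As the block starts at
  \<open>T\<close>, the majorant lacks the mass that \<open>t powr (\<alpha> - 1)\<close> has near
  0. For prefixes of length at least \<open>k\<close> the inner factor \<open>\<kappa>\<close> makes
  up for it; shorter prefixes follow from the constancy of \<open>a\<close> there. The outer
  \<open>\<kappa>\<close> pays for rounding to equal weights. The conditions on \<open>k\<close>,
  \<open>n\<close> and \<open>Q\<close> do not involve \<open>T\<close>, so the same numbers serve
  all blocks.\<close>

lemma weak_type_block:
  fixes a :: "nat \<Rightarrow> real" and T \<alpha> \<kappa> d R :: real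
  assumes \<alpha>: "0 < \<alpha>" "\<alpha> \<le> 1" and T: "0 < T" and d: "0 \<le> d" and \<kappa>: "1 < \<kappa>" and Q: "0 < Q"
    and k: "2 \<le> k" "k \<le> n" "(2 / real k) powr \<alpha> \<le> 1 - 1 / \<kappa>"
    and R: "R = (2 / (real n + 1)) powr (\<alpha> - 1)" "fact n * R \<le> (\<kappa> - 1) * real Q"
    and a: "\<And>l. l < k \<Longrightarrow> a l = a 0" "\<And>i j. i \<le> j \<Longrightarrow> a j \<le> a i"
    and prefix: "\<And>m. T * (\<Sum>l<m. a l) \<le> d * ((real m * T) powr \<alpha> / \<alpha>)"
  shows "\<exists>\<rho>. (\<forall>q<Q. \<rho> q permutes {..<n}) \<and> (\<forall>l<n. a l \<le> \<kappa> / real Q * (\<Sum>q<Q. \<kappa> * d * ((real (\<rho> q l) + 2) * T) powr (\<alpha> - 1)))"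
proof -
  define b where "b l = \<kappa> * d * ((real l + 2) * T) powr (\<alpha> - 1)" for l
  have b0: "0 \<le> b l" for l using \<kappa> d by (simp add: b_def)
  have b_anti: "b j \<le> b i" if "i \<le> j" for i j
    unfolding b_def using that \<kappa> d T \<alpha> by (intro mult_left_mono powr_mono2') auto
  have large: "(\<Sum>l<m. a l) \<le> (\<Sum>l<m. b l)" if m: "k \<le> m" for m
  proof -
    define U where "U l = ((real l + 2) * T) powr \<alpha> / \<alpha>" for l
    define K where "K = T powr \<alpha> / \<alpha>"
    have K: "0 \<le> K" using \<alpha> by (simp add: K_def)
    have m0: "0 < real m" using m k by simp
    have "U m - U 0 = (\<Sum>l<m. U (Suc l) - U l)" by (rule sum_lessThan_telescope[symmetric])
    also have "\<dots> \<le> (\<Sum>l<m. T * ((real l + 2) * T) powr (\<alpha> - 1))"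
    proof (rule sum_mono)
      fix l
      have "U (Suc l) - U l \<le> ((real (Suc l) + 2) * T - (real l + 2) * T) * ((real l + 2) * T) powr (\<alpha> - 1)"
        unfolding U_def using T by (intro powr_Ioc_bounds(2) \<alpha>) (auto simp: add_nonneg_pos)
      also have "(real (Suc l) + 2) * T - (real l + 2) * T = T" by (simp add: algebra_simps)
      finally show "U (Suc l) - U l \<le> T * ((real l + 2) * T) powr (\<alpha> - 1)" .
    qed
    also have "\<dots> = T * (\<Sum>l<m. ((real l + 2) * T) powr (\<alpha> - 1))" by (simp add: sum_distrib_left)
    finally have 1: "U m - U 0 \<le> T * (\<Sum>l<m. ((real l + 2) * T) powr (\<alpha> - 1))" .
    have "(real m * T) powr \<alpha> / \<alpha> \<le> U m"
      unfolding U_def using T \<alpha> by (intro divide_right_mono powr_mono2) auto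
    then have "real m powr \<alpha> * K \<le> U m" using T by (simp add: powr_mult K_def)
    moreover have "U 0 = 2 powr \<alpha> * K" using T by (simp add: U_def powr_mult K_def)
    ultimately have 2: "(real m powr \<alpha> - 2 powr \<alpha>) * K \<le> U m - U 0" by (simp add: algebra_simps)
    have "(2 / real m) powr \<alpha> \<le> (2 / real k) powr \<alpha>"
      using m k \<alpha> by (intro powr_mono2 divide_left_mono) auto
    then have "2 powr \<alpha> / real m powr \<alpha> \<le> 1 - 1 / \<kappa>" using k(3) m0 by (simp add: powr_divide)
    then have "2 powr \<alpha> \<le> (1 - 1 / \<kappa>) * real m powr \<alpha>" using m0 by (simp add: divide_le_eq)
    then have "real m powr \<alpha> / \<kappa> \<le> real m powr \<alpha> - 2 powr \<alpha>" by (simp add: algebra_simps)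
    then have "real m powr \<alpha> \<le> \<kappa> * (real m powr \<alpha> - 2 powr \<alpha>)" using \<kappa> by (simp add: field_simps)
    then have "real m powr \<alpha> * K \<le> \<kappa> * (real m powr \<alpha> - 2 powr \<alpha>) * K" using K by (rule mult_right_mono)
    also have "\<dots> \<le> \<kappa> * (U m - U 0)" using 2 \<kappa> by (simp add: mult.assoc)
    also have "\<dots> \<le> \<kappa> * (T * (\<Sum>l<m. ((real l + 2) * T) powr (\<alpha> - 1)))" using \<kappa> by (intro mult_left_mono 1) simp
    finally have 3: "real m powr \<alpha> * K \<le> \<kappa> * (T * (\<Sum>l<m. ((real l + 2) * T) powr (\<alpha> - 1)))" .
    have "T * (\<Sum>l<m. a l) \<le> d * (real m powr \<alpha> * K)"
      using prefix[of m] T by (simp add: powr_mult K_def)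
    also have "\<dots> \<le> d * (\<kappa> * (T * (\<Sum>l<m. ((real l + 2) * T) powr (\<alpha> - 1))))"
      using d by (intro mult_left_mono 3)
    also have "\<dots> = T * (\<Sum>l<m. b l)" unfolding b_def sum_distrib_left[symmetric] by (simp add: mult_ac)
    finally show ?thesis using T by simp
  qed
  have "(\<Sum>l<m. a l) \<le> (\<Sum>l<m. b l)" for m
  proof (cases "k \<le> m")
    case False
    \<comment> \<open>Up to \<open>k\<close> the prefix sums of \<open>a\<close> are linear and
      those of \<open>b\<close> concave, so the comparison at \<open>k\<close> carries over to
      \<open>m\<close>.\<close>
    have const: "(\<Sum>l<j. a l) = real j * a 0" if "j \<le> k" for j
    proof -
      have "(\<Sum>l<j. a l) = (\<Sum>l<j. a 0)" using that by (intro sum.cong a) auto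
      then show ?thesis by simp
    qed
    have "real k * (\<Sum>l<m. a l) = real m * (\<Sum>l<k. a l)" using False by (simp add: const)
    also have "\<dots> \<le> real m * (\<Sum>l<k. b l)" by (intro mult_left_mono large) auto
    also have "\<dots> \<le> real k * (\<Sum>l<m. b l)" using False b_anti by (intro sum_lessThan_chord) auto
    finally show ?thesis using k by simp
  qed (rule large)
  note maj = this
  let ?P = "{\<sigma>. \<sigma> permutes {..<n}}"
  have finP: "finite ?P" by (simp add: finite_permutations)
  obtain w where w: "\<And>\<sigma>. 0 \<le> w \<sigma>" "(\<Sum>\<sigma>\<in>?P. w \<sigma>) = (1::real)"
    "\<And>i. i < n \<Longrightarrow> a i \<le> (\<Sum>\<sigma>\<in>?P. w \<sigma> * b (\<sigma> i))"
    using majorized_le_convex_permutations[of n a b] a(2) maj by blast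
  obtain \<rho> where \<rho>: "\<And>q. q < Q \<Longrightarrow> \<rho> q \<in> ?P" "\<And>y B. (\<forall>x\<in>?P. 0 \<le> y x \<and> y x \<le> B) \<Longrightarrow>
    (\<Sum>x\<in>?P. w x * y x) \<le> ((\<Sum>q<Q. y (\<rho> q)) + real (card ?P) * B) / real Q"
    using convex_combination_le_uniform[OF finP w(1,2) Q] by blast
  have "a l \<le> \<kappa> / real Q * (\<Sum>q<Q. b (\<rho> q l))" if l: "l < n" for l
  proof -
    have card: "real (card ?P) = fact n" using card_permutations[of "{..<n}" n] by simp
    \<comment> \<open>\<open>R\<close> is the ratio of the largest to the smallest value of
      \<open>b\<close>. The rounding error, at most \<open>fact n * b 0\<close>, is therefore
      absorbed by \<open>\<kappa> - 1\<close> times a sum of \<open>Q\<close> values of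
      \<open>b\<close>.\<close>
    have "b 0 \<le> R * b (n - 1)"
    proof -
      have n: "1 \<le> n" using l by simp
      have "2 * T = 2 / (real n + 1) * ((real (n - 1) + 2) * T)" using n by (simp add: of_nat_diff field_simps)
      then have "(2 * T) powr (\<alpha> - 1) = R * ((real (n - 1) + 2) * T) powr (\<alpha> - 1)"
        unfolding R(1) using T by (metis powr_mult)
      then show ?thesis by (simp add: b_def)
    qed
    then have "fact n * b 0 \<le> fact n * (R * b (n - 1))" by (intro mult_left_mono) auto
    also have "\<dots> \<le> (\<kappa> - 1) * real Q * b (n - 1)"
      using R(2) b0[of "n - 1"] by (simp only: mult.assoc[symmetric]) (rule mult_right_mono)
    also have "\<dots> = (\<kappa> - 1) * (\<Sum>q<Q. b (n - 1))" by simp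
    also have "\<dots> \<le> (\<kappa> - 1) * (\<Sum>q<Q. b (\<rho> q l))"
    proof (intro mult_left_mono sum_mono b_anti)
      fix q assume "q \<in> {..<Q}"
      then have "\<rho> q permutes {..<n}" using \<rho>(1) by simp
      then have "\<rho> q l < n" using permutes_in_image[of "\<rho> q" "{..<n}" l] l by simp
      then show "\<rho> q l \<le> n - 1" by simp
    qed (use \<kappa> in simp)
    finally have "fact n * b 0 \<le> (\<kappa> - 1) * (\<Sum>q<Q. b (\<rho> q l))" .
    then have 1: "(\<Sum>q<Q. b (\<rho> q l)) + fact n * b 0 \<le> \<kappa> * (\<Sum>q<Q. b (\<rho> q l))" by (simp add: algebra_simps)
    have "a l \<le> (\<Sum>\<sigma>\<in>?P. w \<sigma> * b (\<sigma> l))" by (rule w(3)[OF l])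
    also have "\<dots> \<le> ((\<Sum>q<Q. b (\<rho> q l)) + real (card ?P) * b 0) / real Q"
      using b0 b_anti by (intro \<rho>(2)) auto
    also have "\<dots> \<le> (\<kappa> * (\<Sum>q<Q. b (\<rho> q l))) / real Q"
      unfolding card by (intro divide_right_mono 1) simp
    finally show ?thesis by simp
  qed
  then show ?thesis using \<rho>(1) unfolding b_def by blast
qed

text \<open>The points \<open>k powr (i + K j)\<close>, \<open>j\<close> an integer, are the cuts with offset \<open>i\<close>. For each \<open>x\<close> there is at most one
  offset \<open>i < K\<close> for which \<open>\<tau> x\<close> lies within a factor \<open>k\<close> above a cut.\<close>

lemma lorentz_decomp_le_dual_top:
  assumes M: "sigma_finite_measure M" and na: "nonatomic M" and p: "1 < p"
    and f: "f \<in> lorentz_space M p \<infinity>"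
    and d: "lorentz_dual_norm M p \<infinity> f = ennreal d" "0 \<le> d" and \<kappa>: "1 < (\<kappa>::real)"
  shows "lorentz_decomp_norm M p \<infinity> f \<le> ennreal (\<kappa> ^ 3 * d)"
proof -
  have s: "1 \<le> (\<infinity> :: ennreal)" by simp
  have [measurable]: "f \<in> borel_measurable M" using f by (simp add: lorentz_space_def)
  define \<alpha> where "\<alpha> = 1 - 1 / p"
  have \<alpha>: "0 < \<alpha>" "\<alpha> \<le> 1" using p by (auto simp: \<alpha>_def)
  obtain F :: "real \<Rightarrow> real" where F: "F \<in> borel_measurable borel" "\<And>t. 0 \<le> F t"
    "\<And>t. 0 < t \<Longrightarrow> rearr M f t = ennreal (F t)" "\<And>t t'. 0 < t \<Longrightarrow> t \<le> t' \<Longrightarrow> F t' \<le> F t"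
    "(\<lambda>n. F (real n)) \<longlonglongrightarrow> 0"
    by (rule lorentz_space_rearr_real[OF f p s]) (rule that)
  obtain \<tau> where \<tau>: "\<tau> \<in> borel_measurable M" "\<And>x. 0 \<le> \<tau> x"
    "\<And>x. x \<in> space M \<Longrightarrow> f x \<noteq> 0 \<Longrightarrow> rearr M f (\<tau> x) \<le> ennreal \<bar>f x\<bar>"
    "\<And>x t. x \<in> space M \<Longrightarrow> f x \<noteq> 0 \<Longrightarrow> 0 \<le> t \<Longrightarrow> t < \<tau> x \<Longrightarrow> ennreal \<bar>f x\<bar> \<le> rearr M f t"
    "\<And>t. 0 \<le> t \<Longrightarrow> emeasure M {x\<in>space M. f x \<noteq> 0 \<and> \<tau> x < t} = min (ennreal t) (emeasure M {x\<in>space M. f x \<noteq> 0})"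
    by (rule lorentz_space_Ryff[OF M na p s f]) (rule that)
  note [measurable] = \<tau>(1)
  have f_le: "\<bar>f x\<bar> \<le> F t" if "x \<in> space M" "f x \<noteq> 0" "0 < t" "t < \<tau> x" for x t
    using \<tau>(4)[of x t] F(3)[of t] F(2)[of t] that by simp
  have \<kappa>1: "0 < 1 - 1 / \<kappa>" using \<kappa> by simp
  \<comment> \<open>\<open>k\<close> makes the mass missing below a block negligible,
    \<open>K\<close> makes the loss of one offset among \<open>K\<close> cost at most a factor
    \<open>\<kappa>\<close>, and \<open>Q\<close> below does the same for the rounding. Each
    accounts for one factor in \<open>\<kappa> ^ 3\<close>.\<close>
  obtain k :: nat where k: "2 \<le> k" "(2 / real k) powr \<alpha> \<le> 1 - 1 / \<kappa>"
  proof -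
    define y where "y = (1 - 1 / \<kappa>) powr (1 / \<alpha>)"
    have y: "0 < y" using \<kappa> \<kappa>1 unfolding y_def by (simp add: powr_gt_zero)
    obtain k0 :: nat where "2 / y < real k0" using reals_Archimedean2 by blast
    then have k0: "2 / y < real (max 2 k0)" by simp
    then have "2 / real (max 2 k0) \<le> y" using y by (simp add: field_simps)
    then have "(2 / real (max 2 k0)) powr \<alpha> \<le> y powr \<alpha>" using \<alpha> by (intro powr_mono2) auto
    also have "\<dots> = 1 - 1 / \<kappa>" using \<alpha> \<kappa>1 by (simp add: y_def powr_powr)
    finally show ?thesis using that[of "max 2 k0"] by simp
  qed
  obtain K :: nat where K: "2 \<le> K" "real K / (real K - 1) \<le> \<kappa>"
  proof -
    obtain K0 :: nat where "\<kappa> / (\<kappa> - 1) < real K0" using reals_Archimedean2 by blast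
    then have "\<kappa> / (\<kappa> - 1) < real (max 2 K0)" by simp
    then have "real (max 2 K0) / (real (max 2 K0) - 1) \<le> \<kappa>" using \<kappa> by (simp add: field_simps)
    then show ?thesis using that[of "max 2 K0"] by simp
  qed
  \<comment> \<open>A block reaches from \<open>T\<close> to \<open>k ^ K * T\<close> and so
    consists of \<open>n\<close> cells of length \<open>T\<close>; cell \<open>l\<close> starts at
    \<open>(l + 1) * T\<close>.\<close>
  define n where "n = k ^ K - 1"
  have kK: "k + 1 \<le> k ^ K"
  proof -
    have "k + 1 \<le> k * 2" using k(1) by simp
    also have "k * 2 \<le> k ^ 2" using k(1) unfolding power2_eq_square by (intro mult_left_mono) auto
    also have "\<dots> \<le> k ^ K" using k(1) K(1) by (intro power_increasing) auto
    finally show ?thesis .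
  qed
  have kn: "k \<le> n" using kK by (simp add: n_def)
  have n1: "real n + 1 = real k ^ K" using kK by (simp add: n_def of_nat_diff flip: of_nat_power)
  define R where "R = (2 / (real n + 1)) powr (\<alpha> - 1)"
  obtain Q :: nat where Q: "0 < Q" "fact n * R \<le> (\<kappa> - 1) * real Q"
  proof -
    obtain Q0 :: nat where "fact n * R / (\<kappa> - 1) < real Q0" using reals_Archimedean2 by blast
    then have "fact n * R \<le> (\<kappa> - 1) * real Q0" using \<kappa> by (simp add: field_simps)
    also have "\<dots> \<le> (\<kappa> - 1) * real (max 1 Q0)" using \<kappa> by (intro mult_left_mono) auto
    finally have "fact n * R \<le> (\<kappa> - 1) * real (max 1 Q0)" .
    then show ?thesis using that[of "max 1 Q0"] by simp
  qed
  have k0: "0 < real k" "1 < real k" using k(1) by auto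
  define T where "T i j = real k powr (real i + real K * of_int j)" for i :: nat and j :: int
  have T0: "0 < T i j" for i j using k0 by (simp add: T_def)
  have T_Suc: "T i (j + 1) = (real n + 1) * T i j" for i j
    unfolding n1 T_def using k0
    by (simp add: powr_add[symmetric] powr_realpow[symmetric] algebra_simps)
  \<comment> \<open>The number of the block containing \<open>t\<close>. Blocks contain their right
    ends, hence the ceiling minus 1.\<close>
  define jj where "jj i t = \<lceil>(log (real k) t - real i) / real K\<rceil> - 1" for i :: nat and t :: real
  have jj_iff: "T i j < t \<and> t \<le> T i (j + 1) \<longleftrightarrow> jj i t = j" if t: "0 < t" for i j t
  proof -
    have "T i j < t \<longleftrightarrow> real i + real K * of_int j < log (real k) t"
      "t \<le> T i (j + 1) \<longleftrightarrow> log (real k) t \<le> real i + real K * of_int (j + 1)"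
      unfolding T_def using k0 t by (simp_all add: less_log_iff log_le_iff)
    then have "T i j < t \<and> t \<le> T i (j + 1) \<longleftrightarrow>
        of_int j < (log (real k) t - real i) / real K \<and> (log (real k) t - real i) / real K \<le> of_int (j + 1)"
      using K(1) by (simp add: field_simps)
    also have "\<dots> \<longleftrightarrow> \<lceil>(log (real k) t - real i) / real K\<rceil> = j + 1"
      by (subst ceiling_eq_iff) auto
    also have "\<dots> \<longleftrightarrow> jj i t = j" by (auto simp: jj_def)
    finally show ?thesis .
  qed
  define ll where "ll i t = nat \<lceil>(t - T i (jj i t)) / T i (jj i t)\<rceil> - 1" for i t
  define J where "J i = (\<lambda>(j, l). {(real l + 1) * T i j<..(real l + 2) * T i j})" for i :: nat
  have J_cell: "t \<in> J i (j, l) \<longleftrightarrow> real l * T i j < t - T i j \<and> t - T i j \<le> (real l + 1) * T i j" for i j l t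
    by (auto simp: J_def algebra_simps)
  have J_pos: "0 < t" if "t \<in> J i (j, l)" for i j l t
  proof -
    have "0 < (real l + 1) * T i j" using T0 by (simp add: add_nonneg_pos)
    also have "\<dots> < t" using that by (simp add: J_def)
    finally show ?thesis .
  qed
  have J_index: "jj i t = j \<and> ll i t = l" if t: "t \<in> J i (j, l)" and l: "l < n" for i j l t
  proof -
    have t0: "0 < t" by (rule J_pos[OF t])
    have "1 * T i j \<le> (real l + 1) * T i j" using T0[of i j] by (intro mult_right_mono) auto
    then have "T i j < t" using t by (simp add: J_def)
    moreover have "(real l + 2) * T i j \<le> (real n + 1) * T i j" using T0[of i j] l by (intro mult_right_mono) auto
    then have "t \<le> T i (j + 1)" using t unfolding T_Suc by (simp add: J_def)
    ultimately have j: "jj i t = j" using jj_iff[OF t0] by blast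
    then show ?thesis using cell_index_iff[OF T0[of i j], of l "t - T i j"] t by (simp add: J_cell ll_def)
  qed
  have in_J: "ll i t < n \<and> t \<in> J i (jj i t, ll i t)" if t: "0 < t" for i t
  proof -
    define j where "j = jj i t"
    have j: "T i j < t" "t \<le> T i (j + 1)" using jj_iff[OF t, of i j] by (auto simp: j_def)
    have t': "0 < t - T i j" "t - T i j \<le> real n * T i j"
      using j unfolding T_Suc by (simp_all add: algebra_simps)
    have "ll i t < n" using cell_index_less[OF T0 t'(1), of n] t'(2) by (simp add: ll_def j_def)
    moreover have "t \<in> J i (j, ll i t)"
      unfolding J_cell using cell_index_iff[OF T0[of i j], of "ll i t" "t - T i j"] t'(1) by (simp add: ll_def j_def)
    ultimately show ?thesis by (simp add: j_def)
  qed
  \<comment> \<open>\<open>F\<close> is taken at the left end of cell \<open>l\<close> and flattened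
    on the first \<open>k\<close> cells of the block. The flattened values need not bound
    \<open>\<bar>f\<bar>\<close> where \<open>\<tau>\<close> is below \<open>k * T\<close>; this is
    the uncontrolled part next to the cut.\<close>
  have "\<exists>\<rho>. (\<forall>q<Q. \<rho> q permutes {..<n}) \<and> (\<forall>l<n. F (real (max (Suc l) k) * T i j)
    \<le> \<kappa> / real Q * (\<Sum>q<Q. \<kappa> * d * ((real (\<rho> q l) + 2) * T i j) powr (\<alpha> - 1)))" for i j
  proof (rule weak_type_block[where R = R and k = k])
    show "F (real (max (Suc l) k) * T i j) = F (real (max (Suc 0) k) * T i j)" if "l < k" for l
      using that k(1) by (simp add: max_absorb2 Suc_le_eq)
    show "F (real (max (Suc j') k) * T i j) \<le> F (real (max (Suc i') k) * T i j)" if "i' \<le> j'" for i' j'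
      using that k(1) T0[of i j] by (intro F(4)) (auto intro!: mult_right_mono)
    show "T i j * (\<Sum>l<m. F (real (max (Suc l) k) * T i j)) \<le> d * ((real m * T i j) powr \<alpha> / \<alpha>)" for m
      unfolding \<alpha>_def
    proof (rule lorentz_dual_norm_top_prefix[OF M na p f d T0 F(2)])
      fix l
      have "F (real (max (Suc l) k) * T i j) \<le> F ((real l + 1) * T i j)"
        using T0[of i j] by (intro F(4)) (auto intro!: mult_right_mono)
      then show "ennreal (F (real (max (Suc l) k) * T i j)) \<le> rearr M f ((real l + 1) * T i j)"
        using T0[of i j] by (subst F(3)) (auto intro!: ennreal_leI)
    qed
  qed (use \<alpha> T0 d \<kappa> Q k kn R_def in auto)
  then have "\<exists>\<rho>. \<forall>i j. (\<forall>q<Q. \<rho> i j q permutes {..<n}) \<and> (\<forall>l<n. F (real (max (Suc l) k) * T i j)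
    \<le> \<kappa> / real Q * (\<Sum>q<Q. \<kappa> * d * ((real (\<rho> i j q l) + 2) * T i j) powr (\<alpha> - 1)))"
    by metis
  then obtain \<rho> where \<rho>: "\<And>i j q. q < Q \<Longrightarrow> \<rho> i j q permutes {..<n}"
    "\<And>i j l. l < n \<Longrightarrow> F (real (max (Suc l) k) * T i j)
      \<le> \<kappa> / real Q * (\<Sum>q<Q. \<kappa> * d * ((real (\<rho> i j q l) + 2) * T i j) powr (\<alpha> - 1))" by blast
  define b where "b i = (\<lambda>(j, l). \<kappa> * d * ((real l + 2) * T i j) powr (\<alpha> - 1))" for i :: nat
  have b0: "0 \<le> b i z" for i z using \<kappa> d by (simp add: b_def split: prod.split)
  \<comment> \<open>The q-th permutation is used in all blocks of offset \<open>i\<close> at once,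
    which makes a single function out of infinitely many blocks.\<close>
  define hh where "hh i q t = b i (jj i t, \<rho> i (jj i t) q (ll i t))" for i q t
  have [measurable]: "jj i \<in> borel \<rightarrow>\<^sub>M count_space UNIV" for i
    unfolding jj_def[abs_def] by measurable
  have [measurable]: "hh i q \<in> borel_measurable borel" for i q
  proof -
    have 1: "(\<lambda>t. b i (j, \<rho> i j q (nat \<lceil>(t - T i j) / T i j\<rceil> - 1))) \<in> borel_measurable borel" for j
      by measurable
    have "hh i q = (\<lambda>t. (\<lambda>j t. b i (j, \<rho> i j q (nat \<lceil>(t - T i j) / T i j\<rceil> - 1))) (jj i t) t)"
      by (auto simp: hh_def ll_def)
    also have "\<dots> \<in> borel_measurable borel"
      by (rule measurable_compose_countable[OF 1]) measurable
    finally show ?thesis .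
  qed
  define h where "h i q x = (if f x \<noteq> 0 \<and> 0 < \<tau> x then hh i q (\<tau> x) else 0)" for i q x
  have [measurable]: "h i q \<in> borel_measurable M" for i q unfolding h_def by measurable
  have h0: "0 \<le> h i q x" for i q x by (simp add: h_def hh_def b0)
  define H where "H t = \<kappa> * d * t powr (\<alpha> - 1)" for t
  have H0: "0 \<le> H t" for t using \<kappa> d by (simp add: H_def)
  have h_rearr: "rearr M (h i q) t \<le> ennreal (H t)" if q: "q < Q" and t: "0 < t" for i q t
  proof (rule rearr_le_of_permuted_cells[where I = "UNIV \<times> {..<n}" and b = "b i" and J = "J i"
        and A = "\<lambda>z. {x\<in>space M. f x \<noteq> 0 \<and> \<tau> x \<in> J i z}" and \<sigma> = "\<lambda>(j, l). (j, \<rho> i j q l)"])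
    show "countable (UNIV \<times> {..<n} :: (int \<times> nat) set)" by (intro countable_SIGMA) auto
    have JM: "J i z \<in> sets borel" for z by (cases z) (simp add: J_def)
    then show "J i z \<in> sets lborel" for z by simp
    have "{x\<in>space M. f x \<noteq> 0 \<and> \<tau> x \<in> J i z} = {x\<in>space M. f x \<noteq> 0} \<inter> (\<tau> -` J i z \<inter> space M)" for z by auto
    moreover have "\<tau> -` J i z \<inter> space M \<in> sets M" for z by (rule measurable_sets[OF \<tau>(1) JM])
    ultimately show "{x\<in>space M. f x \<noteq> 0 \<and> \<tau> x \<in> J i z} \<in> sets M" for z by simp
    have disj: "z = z'" if "z \<in> UNIV \<times> {..<n}" "z' \<in> UNIV \<times> {..<n}" "t \<in> J i z" "t \<in> J i z'" for z z' t
      using that J_index[of t i "fst z" "snd z"] J_index[of t i "fst z'" "snd z'"] by (cases z; cases z') auto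
    then show "disjoint_family_on (J i) (UNIV \<times> {..<n})" unfolding disjoint_family_on_def by blast
    show "disjoint_family_on (\<lambda>z. {x\<in>space M. f x \<noteq> 0 \<and> \<tau> x \<in> J i z}) (UNIV \<times> {..<n})"
      unfolding disjoint_family_on_def using disj by blast
    show "inj_on (\<lambda>(j, l). (j, \<rho> i j q l)) (UNIV \<times> {..<n})"
      using permutes_inj[OF \<rho>(1)[OF q]] by (auto simp: inj_on_def dest: injD)
    have perm: "\<rho> i j q l < n \<longleftrightarrow> l < n" for j l
      using permutes_in_image[OF \<rho>(1)[OF q], of i j l] by simp
    show "(\<lambda>(j, l). (j, \<rho> i j q l)) ` (UNIV \<times> {..<n}) \<subseteq> UNIV \<times> {..<n}" by (auto simp: perm)
    show "emeasure M {x\<in>space M. f x \<noteq> 0 \<and> \<tau> x \<in> J i z} \<le> emeasure lborel (J i (case z of (j, l) \<Rightarrow> (j, \<rho> i j q l)))" for z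
    proof (cases z)
      case (Pair j l)
      have "emeasure M {x\<in>space M. f x \<noteq> 0 \<and> (real l + 1) * T i j < \<tau> x \<and> \<tau> x \<le> (real l + 2) * T i j}
        \<le> ennreal ((real l + 2) * T i j - (real l + 1) * T i j)"
        using T0[of i j] by (intro emeasure_Ryff_cell \<tau>(2,5)) (auto simp: mult_right_mono)
      also have "(real l + 2) * T i j - (real l + 1) * T i j = T i j" by (simp add: algebra_simps)
      also have "ennreal (T i j) = emeasure lborel (J i (j, \<rho> i j q l))"
        using T0[of i j] by (simp add: J_def algebra_simps)
      finally show ?thesis unfolding Pair by (simp add: J_def)
    qed
    show "\<exists>z\<in>UNIV \<times> {..<n}. x \<in> {x\<in>space M. f x \<noteq> 0 \<and> \<tau> x \<in> J i z} \<and> \<bar>h i q x\<bar> \<le> b i (case z of (j, l) \<Rightarrow> (j, \<rho> i j q l))"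
      if x: "x \<in> space M" "h i q x \<noteq> 0" for x
    proof -
      have x': "f x \<noteq> 0" "0 < \<tau> x" using x(2) by (auto simp: h_def split: if_splits)
      show ?thesis
        using x x' in_J[OF x'(2), of i] h0[of i q x]
        by (intro bexI[of _ "(jj i (\<tau> x), ll i (\<tau> x))"]) (auto simp: h_def hh_def)
    qed
    show "0 < t \<and> b i z \<le> H t" if "t \<in> J i z" for z t
    proof (cases z)
      case (Pair j l)
      have t: "0 < t" "t \<le> (real l + 2) * T i j" using that J_pos[of t i j l] unfolding Pair by (auto simp: J_def)
      then have "((real l + 2) * T i j) powr (\<alpha> - 1) \<le> t powr (\<alpha> - 1)" using \<alpha> by (intro powr_mono2') auto
      then show ?thesis using t \<kappa> d by (simp add: Pair b_def H_def mult_left_mono)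
    qed
    show "H t' \<le> H t" if "0 < t" "t \<le> t'" for t t'
      unfolding H_def using that \<kappa> d \<alpha> by (intro mult_left_mono powr_mono2') auto
  qed (use t H0 in auto)
  have h_norm: "lorentz_norm M p \<infinity> (h i q) \<le> ennreal (\<kappa> * d)" if q: "q < Q" for i q
    unfolding lorentz_norm_eq lorentz_fun_top
  proof (rule SUP_least)
    fix t :: real assume "t \<in> {0<..}"
    then have t: "0 < t" by simp
    have "ennreal (t powr (1 / p)) * rearr M (h i q) t \<le> ennreal (t powr (1 / p)) * ennreal (H t)"
      by (intro mult_left_mono h_rearr q t) simp
    also have "\<dots> = ennreal (\<kappa> * d * (t powr (1 / p) * t powr (\<alpha> - 1)))"
      using H0[of t] by (simp add: ennreal_mult[symmetric] H_def mult_ac)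
    also have "t powr (1 / p) * t powr (\<alpha> - 1) = 1" using t by (simp add: \<alpha>_def powr_add[symmetric])
    finally show "ennreal (t powr (1 / p)) * rearr M (h i q) t \<le> ennreal (\<kappa> * d)" by simp
  qed
  \<comment> \<open>The common weight of the \<open>K * Q\<close> functions: an average over
    \<open>Q\<close> permutations, with the factor \<open>\<kappa>\<close> from
    \<open>weak_type_block\<close>, and over the at least \<open>K - 1\<close> offsets that are good
    for a given point.\<close>
  define \<gamma> where "\<gamma> = \<kappa> / (real Q * (real K - 1))"
  have \<gamma>: "0 < \<gamma>" using \<kappa> Q K by (simp add: \<gamma>_def)
  have g_norm: "lorentz_norm M p \<infinity> (\<lambda>x. \<gamma> * h i q x) \<le> ennreal (\<gamma> * (\<kappa> * d))" if q: "q < Q" for i q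
  proof -
    have "lorentz_norm M p \<infinity> (\<lambda>x. \<gamma> * h i q x) = ennreal \<gamma> * lorentz_norm M p \<infinity> (h i q)"
      using \<gamma> by (subst lorentz_norm_cmult) auto
    also have "\<dots> \<le> ennreal \<gamma> * ennreal (\<kappa> * d)" by (intro mult_left_mono h_norm q) simp
    also have "\<dots> = ennreal (\<gamma> * (\<kappa> * d))" using \<gamma> \<kappa> d by (simp add: ennreal_mult)
    finally show ?thesis .
  qed
  have pointwise: "\<bar>f x\<bar> \<le> (\<Sum>z\<in>{..<K} \<times> {..<Q}. \<bar>\<gamma> * h (fst z) (snd z) x\<bar>)"
    if x: "x \<in> space M" "f x \<noteq> 0" "0 < \<tau> x" for x
  proof -
    \<comment> \<open>\<open>\<tau> x\<close> lies above \<open>k powr m\<close> and at most at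
      \<open>k powr (m + 1)\<close>. So it is within a factor \<open>k\<close> above a cut of offset
      \<open>i\<close> only if \<open>m\<close> is congruent to \<open>i\<close> modulo
      \<open>K\<close>.\<close>
    define m where "m = \<lceil>log (real k) (\<tau> x)\<rceil> - 1"
    define i0 where "i0 = nat (m mod int K)"
    have good: "\<bar>f x\<bar> \<le> \<kappa> / real Q * (\<Sum>q<Q. h i q x)" if i: "i < K" "i \<noteq> i0" for i
    proof -
      define j where "j = jj i (\<tau> x)"
      define l where "l = ll i (\<tau> x)"
      have l: "l < n" "\<tau> x \<in> J i (j, l)" using in_J[OF x(3), of i] by (auto simp: j_def l_def)
      have j: "T i j < \<tau> x" using jj_iff[OF x(3), of i j] by (simp add: j_def)
      have "real k * T i j < \<tau> x"
      proof (rule ccontr)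
        assume "\<not> ?thesis"
        then have "\<tau> x \<le> real k powr (real i + real K * of_int j + 1)"
          using k0 by (simp add: T_def powr_add mult.commute)
        then have "log (real k) (\<tau> x) \<le> real i + real K * of_int j + 1" using k0 x(3) by (simp add: log_le_iff)
        moreover have "real i + real K * of_int j < log (real k) (\<tau> x)"
          using j k0 x(3) by (simp add: T_def less_log_iff)
        ultimately have "\<lceil>log (real k) (\<tau> x)\<rceil> = int i + int K * j + 1"
          by (subst ceiling_eq_iff) auto
        then have "m = int i + int K * j" by (simp add: m_def)
        then have "i0 = i" using i by (simp add: i0_def)
        with i show False by simp
      qed
      also have "\<tau> x \<le> (real l + 2) * T i j" using l by (simp add: J_def)
      finally have "real k < real l + 2" using T0[of i j] by simp
      then have kl: "k \<le> Suc l" by linarith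
      have "\<bar>f x\<bar> \<le> F ((real l + 1) * T i j)"
        using l T0[of i j] by (intro f_le x) (auto simp: J_def add_nonneg_pos)
      also have "\<dots> = F (real (max (Suc l) k) * T i j)" using kl by (simp add: max_absorb1 add.commute)
      also have "\<dots> \<le> \<kappa> / real Q * (\<Sum>q<Q. \<kappa> * d * ((real (\<rho> i j q l) + 2) * T i j) powr (\<alpha> - 1))"
        by (rule \<rho>(2)[OF l(1)])
      also have "\<dots> = \<kappa> / real Q * (\<Sum>q<Q. h i q x)"
        using x by (simp add: h_def hh_def b_def j_def l_def)
      finally show ?thesis .
    qed
    have "(real K - 1) * \<bar>f x\<bar> \<le> (\<Sum>i\<in>{..<K} - {i0}. \<bar>f x\<bar>)"
    proof -
      have "real K - 1 \<le> real (card ({..<K} - {i0}))" by (auto simp: card_Diff_singleton_if of_nat_diff)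
      then show ?thesis by (simp add: mult_right_mono)
    qed
    also have "\<dots> \<le> (\<Sum>i\<in>{..<K} - {i0}. \<kappa> / real Q * (\<Sum>q<Q. h i q x))" by (intro sum_mono good) auto
    also have "\<dots> \<le> (\<Sum>i<K. \<kappa> / real Q * (\<Sum>q<Q. h i q x))"
      using \<kappa> h0 by (intro sum_mono2) (auto intro!: divide_nonneg_nonneg mult_nonneg_nonneg sum_nonneg)
    finally have "(real K - 1) * \<bar>f x\<bar> \<le> \<kappa> / real Q * (\<Sum>i<K. \<Sum>q<Q. h i q x)" by (simp add: sum_distrib_left)
    then have "\<bar>f x\<bar> * (real K - 1) \<le> \<kappa> / real Q * (\<Sum>i<K. \<Sum>q<Q. h i q x)"
      by (metis mult.commute)
    then have "\<bar>f x\<bar> \<le> \<kappa> / real Q * (\<Sum>i<K. \<Sum>q<Q. h i q x) / (real K - 1)"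
      using K(1) by (subst pos_le_divide_eq) auto
    also have "\<dots> = \<gamma> * (\<Sum>i<K. \<Sum>q<Q. h i q x)" by (simp add: \<gamma>_def)
    also have "\<dots> = (\<Sum>z\<in>{..<K} \<times> {..<Q}. \<bar>\<gamma> * h (fst z) (snd z) x\<bar>)"
      using \<gamma> h0 by (simp add: sum_distrib_left sum.cartesian_product case_prod_beta abs_mult)
    finally show ?thesis .
  qed
  \<comment> \<open>Where \<open>\<tau> x = 0\<close>, no value of the rearrangement at a positive
    argument is known to bound \<open>\<bar>f x\<bar>\<close>, so these points have to be
    negligible.\<close>
  have null: "{x\<in>space M. f x \<noteq> 0 \<and> \<tau> x = 0} \<in> null_sets M"
  proof (rule null_setsI)
    have "emeasure M {x\<in>space M. f x \<noteq> 0 \<and> \<tau> x = 0} \<le> 0"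
    proof (rule ennreal_le_epsilon)
      fix e :: real assume e: "0 < e"
      have "emeasure M {x\<in>space M. f x \<noteq> 0 \<and> \<tau> x = 0} \<le> emeasure M {x\<in>space M. f x \<noteq> 0 \<and> \<tau> x < e}"
        using e by (intro emeasure_mono) auto
      also have "\<dots> \<le> ennreal e" using \<tau>(5)[of e] e by simp
      finally show "emeasure M {x\<in>space M. f x \<noteq> 0 \<and> \<tau> x = 0} \<le> 0 + ennreal e" by simp
    qed
    then show "emeasure M {x\<in>space M. f x \<noteq> 0 \<and> \<tau> x = 0} = 0" by simp
  qed measurable
  have "lorentz_decomp_norm M p \<infinity> f \<le> (\<Sum>z\<in>{..<K} \<times> {..<Q}. lorentz_norm M p \<infinity> (\<lambda>x. \<gamma> * h (fst z) (snd z) x))"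
  proof (rule lorentz_decomp_le_sum)
    show "(\<lambda>x. \<gamma> * h (fst z) (snd z) x) \<in> lorentz_space M p \<infinity>" if "z \<in> {..<K} \<times> {..<Q}" for z
    proof -
      have "snd z < Q" using that by auto
      then have "lorentz_norm M p \<infinity> (\<lambda>x. \<gamma> * h (fst z) (snd z) x) < \<infinity>"
        by (rule le_less_trans[OF g_norm]) simp
      then show ?thesis by (simp add: lorentz_space_def)
    qed
    show "AE x in M. \<bar>f x\<bar> \<le> (\<Sum>z\<in>{..<K} \<times> {..<Q}. \<bar>\<gamma> * h (fst z) (snd z) x\<bar>)"
      using AE_not_in[OF null] AE_space
    proof eventually_elim
      case (elim x)
      show ?case
      proof (cases "f x = 0")
        case False
        with elim have "0 < \<tau> x" using \<tau>(2)[of x] by (auto simp: less_le)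
        with elim False show ?thesis by (intro pointwise) auto
      qed (simp add: sum_nonneg)
    qed
  qed auto
  also have "\<dots> \<le> (\<Sum>z\<in>{..<K} \<times> {..<Q}. ennreal (\<gamma> * (\<kappa> * d)))"
    by (intro sum_mono g_norm) auto
  also have "\<dots> = ennreal (real (K * Q) * (\<gamma> * (\<kappa> * d)))"
    by (simp add: ennreal_mult' ennreal_of_nat_eq_real_of_nat[symmetric])
  also have "\<dots> \<le> ennreal (\<kappa> ^ 3 * d)"
  proof (rule ennreal_leI)
    have "real (K * Q) * (\<gamma> * (\<kappa> * d)) = (real K / (real K - 1)) * (\<kappa> * (\<kappa> * d))"
      using Q K by (simp add: \<gamma>_def)
    also have "\<dots> \<le> \<kappa> * (\<kappa> * (\<kappa> * d))" using K(2) \<kappa> d by (intro mult_right_mono) auto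
    finally show "real (K * Q) * (\<gamma> * (\<kappa> * d)) \<le> \<kappa> ^ 3 * d" by (simp add: power3_eq_cube mult_ac)
  qed
  finally show ?thesis .
qed

theorem theorem5p2:
  fixes M :: "'a measure" and p :: real and s :: ennreal and f :: "'a \<Rightarrow> real"
  assumes "sigma_finite_measure M"
    and "nonatomic M"
    and "1 < p"
    and "1 \<le> s"
    and "f \<in> lorentz_space M p s"
  shows "lorentz_dual_norm M p s f = lorentz_decomp_norm M p s f"
proof (rule antisym)
  have [measurable]: "f \<in> borel_measurable M" using assms(5) by (simp add: lorentz_space_def)
  \<comment> \<open>The decomposition with one piece. It reduces the range \<open>s \<le> p\<close>
    to a lower bound of the dual norm, and for \<open>s = \<infinity>\<close> it makes the dual norm
    finite, so that it is a real number \<open>d\<close>.\<close>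
  have le_norm: "lorentz_decomp_norm M p s f \<le> lorentz_norm M p s f"
    using lorentz_decomp_le_sum[of f M "{()}" "\<lambda>_. f" p s] assms(5) by simp
  show dual_le: "lorentz_dual_norm M p s f \<le> lorentz_decomp_norm M p s f"
    using assms by (intro lorentz_dual_le_decomp) auto
  show "lorentz_decomp_norm M p s f \<le> lorentz_dual_norm M p s f"
  proof (cases s)
    case (real r)
    then have r: "1 \<le> r" using assms(4) by (simp flip: ennreal_1)
    show ?thesis
    proof (cases "r \<le> p")
      case True
      then show ?thesis
        using le_norm lorentz_norm_le_dual_norm[OF assms(1-3) r True] assms(5) real by (auto intro: order_trans)
    next
      case False
      then show ?thesis
        using lorentz_decomp_le_dual_norm_gt[OF assms(1-3)] assms(5) real by auto
    qed
  next
    case top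
    have "lorentz_dual_norm M p s f < \<infinity>"
      using dual_le le_norm assms(5) by (auto simp: lorentz_space_def intro: le_less_trans)
    then obtain d where d: "lorentz_dual_norm M p s f = ennreal d" "0 \<le> d"
      by (cases "lorentz_dual_norm M p s f") auto
    have "lorentz_decomp_norm M p s f \<le> ennreal ((1 + 1 / real (Suc n)) ^ 3 * d)" for n
      using lorentz_decomp_le_dual_top[OF assms(1-3), of f d "1 + 1 / real (Suc n)"] assms(5) d top by simp
    moreover have "(\<lambda>n. ennreal ((1 + 1 / real (Suc n)) ^ 3 * d)) \<longlonglongrightarrow> ennreal ((1 + 0) ^ 3 * d)"
      by (intro tendsto_ennrealI tendsto_intros LIMSEQ_Suc[OF lim_1_over_n])
    ultimately have "lorentz_decomp_norm M p s f \<le> ennreal ((1 + 0) ^ 3 * d)"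
      by (intro LIMSEQ_le_const) auto
    then show ?thesis using d by simp
  qed
qed

end
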